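(* Let $\mathrm{BH}$ be the higher inductive type with a point constructor $\mathrm{pt} : \mathrm{BH}$, four path constructors $a,b,c,d : \Omega\mathrm{BH}$, and four $2$-cell constructors $a = [d,a]$, $b = [a,b]$, $c = [b,c]$, $d = [c,d]$. Then $\mathrm{BH}$ is acyclic.
   Context: We work in homotopy type theory (HoTT) in the style of the HoTT Book: dependent type theory with univalent universes (hence function extensionality) and higher inductive types; no classical axioms are assumed. $\Omega\mathrm{BH}$ denotes the loop type $(\mathrm{pt} =_{\mathrm{BH}} \mathrm{pt})$, with product given by path concatenation, and $[x,y]$ denotes the commutator $xyx^{-1}y^{-1}$. ($\mathrm{BH}$ is the presentation complex of Higman's group $\mathrm{H} = \langle a,b,c,d \mid a=[d,a], b=[a,b], c=[b,c], d=[c,d]\rangle$.) The suspension $\Sigma A$ of a type $A$ is the pushout of $\mathbf{1} \leftarrow A \to \mathbf{1}$. A type is acyclic if its suspension is contractible. *)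

theory Defs
  imports Main
begin

text \<open>
  A deep embedding of the fragment of homotopy type theory needed to state that the presentation
  complex of Higman's group is acyclic: dependent functions with judgmental beta and eta, a
  cumulative hierarchy of univalent universes, empty, unit, sum and natural number types, dependent
  pairs, identity types, pushouts, and the higher inductive type BH.  Following the HoTT Book, every
  former other than functions and universes is a constant of a closed type.  Eliminators compute
  judgmentally on points, and up to identity on path and 2-cell constructors.  No classical axiom
  and no further higher inductive type is included.
\<close>

section \<open>Raw syntax\<close>

datatype gen = Ga | Gb | Gc | Gd

datatype const =
    cEmpty | cIndEmpty
  | cUnit | cStar | cIndUnit
  | cSum | cInl | cInr | cIndSum
  | cNat | cZero | cSucc | cIndNat
  | cSigma | cPair | cIndSigma
  | cId | cRefl | cIndId
  | cUA
  | cPushout | cPInl | cPInr | cGlue | cIndPushout | cGlueComp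
  | cBH | cPt | cLoop gen | cCell gen | cIndBH | cLoopComp gen | cCellComp gen

text \<open>De Bruijn indices; \<open>Pi A B\<close> and \<open>Lam A b\<close> bind index 0 in their second argument.\<close>

datatype tm = Var nat | Univ nat | Con const | App tm tm | Lam tm tm | Pi tm tm

primrec ren :: "(nat \<Rightarrow> nat) \<Rightarrow> tm \<Rightarrow> tm" where
  "ren r (Var n) = Var (r n)"
| "ren r (Univ i) = Univ i"
| "ren r (Con c) = Con c"
| "ren r (App t u) = App (ren r t) (ren r u)"
| "ren r (Lam A t) = Lam (ren r A) (ren (case_nat 0 (\<lambda>n. Suc (r n))) t)"
| "ren r (Pi A B) = Pi (ren r A) (ren (case_nat 0 (\<lambda>n. Suc (r n))) B)"

primrec sub :: "(nat \<Rightarrow> tm) \<Rightarrow> tm \<Rightarrow> tm" where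
  "sub s (Var n) = s n"
| "sub s (Univ i) = Univ i"
| "sub s (Con c) = Con c"
| "sub s (App t u) = App (sub s t) (sub s u)"
| "sub s (Lam A t) = Lam (sub s A) (sub (case_nat (Var 0) (\<lambda>n. ren Suc (s n))) t)"
| "sub s (Pi A B) = Pi (sub s A) (sub (case_nat (Var 0) (\<lambda>n. ren Suc (s n))) B)"

definition inst :: "tm \<Rightarrow> tm \<Rightarrow> tm" where
  "inst t a = sub (case_nat a Var) t"

section \<open>Named binders\<close>

text \<open>
  To write closed terms with named variables, a term is represented as a function of the number of
  binders above it.  A variable bound below \<open>n\<close> binders has de Bruijn index \<open>m - Suc n\<close> when it
  occurs below \<open>m\<close> binders.  A closed term is obtained by evaluation at depth 0.
\<close>

type_synonym dtm = "nat \<Rightarrow> tm"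

definition univ :: "nat \<Rightarrow> dtm" where
  "univ i = (\<lambda>n. Univ i)"

definition con :: "const \<Rightarrow> dtm" where
  "con c = (\<lambda>n. Con c)"

definition app :: "dtm \<Rightarrow> dtm \<Rightarrow> dtm"  (infixl "\<cdot>" 90) where
  "t \<cdot> u = (\<lambda>n. App (t n) (u n))"

definition lam :: "dtm \<Rightarrow> (dtm \<Rightarrow> dtm) \<Rightarrow> dtm" where
  "lam A F = (\<lambda>n. Lam (A n) (F (\<lambda>m. Var (m - Suc n)) (Suc n)))"

definition pi :: "dtm \<Rightarrow> (dtm \<Rightarrow> dtm) \<Rightarrow> dtm" where
  "pi A F = (\<lambda>n. Pi (A n) (F (\<lambda>m. Var (m - Suc n)) (Suc n)))"

definition sig :: "dtm \<Rightarrow> (dtm \<Rightarrow> dtm) \<Rightarrow> dtm" where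
  "sig A F = con cSigma \<cdot> A \<cdot> lam A F"

syntax
  "_lam" :: "pttrn \<Rightarrow> 'a \<Rightarrow> 'b \<Rightarrow> 'c"  ("(3\<^bold>\<lambda>_\<^bold>:_./ _)" [0, 0, 10] 10)
  "_pi" :: "pttrn \<Rightarrow> 'a \<Rightarrow> 'b \<Rightarrow> 'c"  ("(3\<^bold>\<Pi>_\<^bold>:_./ _)" [0, 0, 10] 10)
  "_sig" :: "pttrn \<Rightarrow> 'a \<Rightarrow> 'b \<Rightarrow> 'c"  ("(3\<^bold>\<Sigma>_\<^bold>:_./ _)" [0, 0, 10] 10)

translations
  "\<^bold>\<lambda>x\<^bold>:A. t" \<rightleftharpoons> "CONST lam A (\<lambda>x. t)"
  "\<^bold>\<Pi>x\<^bold>:A. B" \<rightleftharpoons> "CONST pi A (\<lambda>x. B)"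
  "\<^bold>\<Sigma>x\<^bold>:A. B" \<rightleftharpoons> "CONST sig A (\<lambda>x. B)"

definition arr :: "dtm \<Rightarrow> dtm \<Rightarrow> dtm"  (infixr "\<^bold>\<rightarrow>" 55) where
  "A \<^bold>\<rightarrow> B = (\<^bold>\<Pi>x\<^bold>:A. B)"

definition prod :: "dtm \<Rightarrow> dtm \<Rightarrow> dtm"  (infixr "\<^bold>\<times>" 60) where
  "A \<^bold>\<times> B = (\<^bold>\<Sigma>x\<^bold>:A. B)"

definition pair :: "dtm \<Rightarrow> (dtm \<Rightarrow> dtm) \<Rightarrow> dtm \<Rightarrow> dtm \<Rightarrow> dtm" where
  "pair A B a b = con cPair \<cdot> A \<cdot> lam A B \<cdot> a \<cdot> b"

definition idt :: "dtm \<Rightarrow> dtm \<Rightarrow> dtm \<Rightarrow> dtm"  ("(_ \<^bold>=\<^bsub>_\<^esub>/ _)" [66, 0, 66] 65) where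
  "x \<^bold>=\<^bsub>A\<^esub> y = con cId \<cdot> A \<cdot> x \<cdot> y"

definition rfl :: "dtm \<Rightarrow> dtm \<Rightarrow> dtm" where
  "rfl A x = con cRefl \<cdot> A \<cdot> x"

definition J :: "dtm \<Rightarrow> (dtm \<Rightarrow> dtm \<Rightarrow> dtm \<Rightarrow> dtm) \<Rightarrow> (dtm \<Rightarrow> dtm) \<Rightarrow> dtm \<Rightarrow> dtm \<Rightarrow> dtm \<Rightarrow> dtm" where
  "J A C c x y p =
     con cIndId \<cdot> A \<cdot> (\<^bold>\<lambda>x\<^bold>:A. \<^bold>\<lambda>y\<^bold>:A. \<^bold>\<lambda>p\<^bold>:x \<^bold>=\<^bsub>A\<^esub> y. C x y p) \<cdot> (\<^bold>\<lambda>x\<^bold>:A. c x) \<cdot> x \<cdot> y \<cdot> p"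

section \<open>Operations on paths\<close>

text \<open>
  Types, endpoints and paths are explicit arguments; \<open>p\<close> always runs from \<open>x\<close> to \<open>y\<close> in \<open>A\<close>, and
  \<open>q\<close> from \<open>y\<close> to \<open>z\<close>.
\<close>

definition cat :: "dtm \<Rightarrow> dtm \<Rightarrow> dtm \<Rightarrow> dtm \<Rightarrow> dtm \<Rightarrow> dtm \<Rightarrow> dtm" where
  "cat A x y z p q =
     J A (\<lambda>x y p. \<^bold>\<Pi>z\<^bold>:A. y \<^bold>=\<^bsub>A\<^esub> z \<^bold>\<rightarrow> x \<^bold>=\<^bsub>A\<^esub> z) (\<lambda>x. \<^bold>\<lambda>z\<^bold>:A. \<^bold>\<lambda>q\<^bold>:x \<^bold>=\<^bsub>A\<^esub> z. q) x y p \<cdot> z \<cdot> q"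

definition inv :: "dtm \<Rightarrow> dtm \<Rightarrow> dtm \<Rightarrow> dtm \<Rightarrow> dtm" where
  "inv A x y p = J A (\<lambda>x y p. y \<^bold>=\<^bsub>A\<^esub> x) (\<lambda>x. rfl A x) x y p"

definition ap :: "dtm \<Rightarrow> dtm \<Rightarrow> (dtm \<Rightarrow> dtm) \<Rightarrow> dtm \<Rightarrow> dtm \<Rightarrow> dtm \<Rightarrow> dtm" where
  "ap A B f x y p = J A (\<lambda>x y p. f x \<^bold>=\<^bsub>B\<^esub> f y) (\<lambda>x. rfl B (f x)) x y p"

definition tr :: "dtm \<Rightarrow> (dtm \<Rightarrow> dtm) \<Rightarrow> dtm \<Rightarrow> dtm \<Rightarrow> dtm \<Rightarrow> dtm \<Rightarrow> dtm" where
  "tr A P x y p u = J A (\<lambda>x y p. P x \<^bold>\<rightarrow> P y) (\<lambda>x. \<^bold>\<lambda>u\<^bold>:P x. u) x y p \<cdot> u"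

definition apd :: "dtm \<Rightarrow> (dtm \<Rightarrow> dtm) \<Rightarrow> (dtm \<Rightarrow> dtm) \<Rightarrow> dtm \<Rightarrow> dtm \<Rightarrow> dtm \<Rightarrow> dtm" where
  "apd A P f x y p = J A (\<lambda>x y p. tr A P x y p (f x) \<^bold>=\<^bsub>P y\<^esub> f y) (\<lambda>x. rfl (P x) (f x)) x y p"

text \<open>The commutator \<open>p q p\<inverse> q\<inverse>\<close> of two loops at \<open>x\<close>.\<close>

definition comm :: "dtm \<Rightarrow> dtm \<Rightarrow> dtm \<Rightarrow> dtm \<Rightarrow> dtm" where
  "comm A x p q = cat A x x x (cat A x x x (cat A x x x p q) (inv A x x p)) (inv A x x q)"

subsection \<open>Operations on dependent paths\<close>

text \<open>
  A path from \<open>u : P x\<close> to \<open>v : P y\<close> over \<open>p\<close> is an element of \<open>tr p u = v\<close>.  The operations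
  \<open>dcat\<close>, \<open>dinv\<close>, \<open>dcomm\<close> lie over \<open>cat\<close>, \<open>inv\<close>, \<open>comm\<close>; the identifications \<open>apd_cat\<close>, \<open>apd_inv\<close>,
  \<open>apd_comm\<close> say that \<open>apd f\<close> takes each of the latter to the corresponding former.
\<close>

definition tr_cat :: "dtm \<Rightarrow> (dtm \<Rightarrow> dtm) \<Rightarrow> dtm \<Rightarrow> dtm \<Rightarrow> dtm \<Rightarrow> dtm \<Rightarrow> dtm \<Rightarrow> dtm \<Rightarrow> dtm" where
  "tr_cat A P x y z p q u =
     J A (\<lambda>x y p. \<^bold>\<Pi>z\<^bold>:A. \<^bold>\<Pi>q\<^bold>:y \<^bold>=\<^bsub>A\<^esub> z. \<^bold>\<Pi>u\<^bold>:P x.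
            tr A P x z (cat A x y z p q) u \<^bold>=\<^bsub>P z\<^esub> tr A P y z q (tr A P x y p u))
         (\<lambda>x. \<^bold>\<lambda>z\<^bold>:A. \<^bold>\<lambda>q\<^bold>:x \<^bold>=\<^bsub>A\<^esub> z. \<^bold>\<lambda>u\<^bold>:P x. rfl (P z) (tr A P x z q u))
         x y p \<cdot> z \<cdot> q \<cdot> u"

definition tr_inv :: "dtm \<Rightarrow> (dtm \<Rightarrow> dtm) \<Rightarrow> dtm \<Rightarrow> dtm \<Rightarrow> dtm \<Rightarrow> dtm \<Rightarrow> dtm" where
  "tr_inv A P x y p u =
     J A (\<lambda>x y p. \<^bold>\<Pi>u\<^bold>:P x. tr A P y x (inv A x y p) (tr A P x y p u) \<^bold>=\<^bsub>P x\<^esub> u)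
         (\<lambda>x. \<^bold>\<lambda>u\<^bold>:P x. rfl (P x) u)
         x y p \<cdot> u"

definition dcat ::
  "dtm \<Rightarrow> (dtm \<Rightarrow> dtm) \<Rightarrow> dtm \<Rightarrow> dtm \<Rightarrow> dtm \<Rightarrow> dtm \<Rightarrow> dtm \<Rightarrow>
   dtm \<Rightarrow> dtm \<Rightarrow> dtm \<Rightarrow> dtm \<Rightarrow> dtm \<Rightarrow> dtm" where
  "dcat A P x y z p q u v w s t =
     (let pu = tr A P x y p u; q_tr = tr A P y z q in
      cat (P z) (tr A P x z (cat A x y z p q) u) (q_tr pu) w
        (tr_cat A P x y z p q u)
        (cat (P z) (q_tr pu) (q_tr v) w (ap (P y) (P z) q_tr pu v s) t))"

definition dinv ::
  "dtm \<Rightarrow> (dtm \<Rightarrow> dtm) \<Rightarrow> dtm \<Rightarrow> dtm \<Rightarrow> dtm \<Rightarrow> dtm \<Rightarrow> dtm \<Rightarrow> dtm \<Rightarrow> dtm" where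
  "dinv A P x y p u v s =
     (let pu = tr A P x y p u; p_inv_tr = tr A P y x (inv A x y p) in
      cat (P x) (p_inv_tr v) (p_inv_tr pu) u
        (ap (P y) (P x) p_inv_tr v pu (inv (P y) pu v s))
        (tr_inv A P x y p u))"

definition dcomm ::
  "dtm \<Rightarrow> (dtm \<Rightarrow> dtm) \<Rightarrow> dtm \<Rightarrow> dtm \<Rightarrow> dtm \<Rightarrow> dtm \<Rightarrow> dtm \<Rightarrow> dtm \<Rightarrow> dtm" where
  "dcomm A P x p q u s t =
     (let p' = inv A x x p; q' = inv A x x q; pq = cat A x x x p q; pqp' = cat A x x x pq p' in
      dcat A P x x x pqp' q' u u u
        (dcat A P x x x pq p' u u u (dcat A P x x x p q u u u s t) (dinv A P x x p u u s))
        (dinv A P x x q u u t))"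

definition apd_cat ::
  "dtm \<Rightarrow> (dtm \<Rightarrow> dtm) \<Rightarrow> (dtm \<Rightarrow> dtm) \<Rightarrow> dtm \<Rightarrow> dtm \<Rightarrow> dtm \<Rightarrow> dtm \<Rightarrow> dtm \<Rightarrow> dtm" where
  "apd_cat A P f x y z p q =
     J A (\<lambda>x y p. \<^bold>\<Pi>z\<^bold>:A. \<^bold>\<Pi>q\<^bold>:y \<^bold>=\<^bsub>A\<^esub> z.
            apd A P f x z (cat A x y z p q)
              \<^bold>=\<^bsub>tr A P x z (cat A x y z p q) (f x) \<^bold>=\<^bsub>P z\<^esub> f z\<^esub>
            dcat A P x y z p q (f x) (f y) (f z) (apd A P f x y p) (apd A P f y z q))
         (\<lambda>x. \<^bold>\<lambda>z\<^bold>:A. \<^bold>\<lambda>q\<^bold>:x \<^bold>=\<^bsub>A\<^esub> z. rfl (tr A P x z q (f x) \<^bold>=\<^bsub>P z\<^esub> f z) (apd A P f x z q))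
         x y p \<cdot> z \<cdot> q"

definition apd_inv ::
  "dtm \<Rightarrow> (dtm \<Rightarrow> dtm) \<Rightarrow> (dtm \<Rightarrow> dtm) \<Rightarrow> dtm \<Rightarrow> dtm \<Rightarrow> dtm \<Rightarrow> dtm" where
  "apd_inv A P f x y p =
     J A (\<lambda>x y p.
            apd A P f y x (inv A x y p)
              \<^bold>=\<^bsub>tr A P y x (inv A x y p) (f y) \<^bold>=\<^bsub>P x\<^esub> f x\<^esub>
            dinv A P x y p (f x) (f y) (apd A P f x y p))
         (\<lambda>x. rfl (f x \<^bold>=\<^bsub>P x\<^esub> f x) (rfl (P x) (f x)))
         x y p"

text \<open>
  For loops \<open>p\<close>, \<open>q\<close> at \<open>x\<close>: from \<open>e : apd f p = s\<close> and \<open>e' : apd f q = t\<close>, an identification of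
  \<open>apd f (p q)\<close> with \<open>dcat s t\<close>.
\<close>

definition apd_cat_to ::
  "dtm \<Rightarrow> (dtm \<Rightarrow> dtm) \<Rightarrow> (dtm \<Rightarrow> dtm) \<Rightarrow> dtm \<Rightarrow> dtm \<Rightarrow> dtm \<Rightarrow>
   dtm \<Rightarrow> dtm \<Rightarrow> dtm \<Rightarrow> dtm \<Rightarrow> dtm" where
  "apd_cat_to A P f x p q s t e e' =
     (let u = f x;
          pq = cat A x x x p q;
          over = (\<lambda>r. tr A P x x r u \<^bold>=\<^bsub>P x\<^esub> u);
          D = dcat A P x x x p q u u u;
          fp = apd A P f x x p; fq = apd A P f x x q; fpq = apd A P f x x pq in
      cat (over pq) fpq (D fp fq) (D s t)
        (apd_cat A P f x x x p q)
        (cat (over pq) (D fp fq) (D s fq) (D s t)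
          (ap (over p) (over pq) (\<lambda>s. D s fq) fp s e)
          (ap (over q) (over pq) (\<lambda>t. D s t) fq t e')))"

definition apd_comm ::
  "dtm \<Rightarrow> (dtm \<Rightarrow> dtm) \<Rightarrow> (dtm \<Rightarrow> dtm) \<Rightarrow> dtm \<Rightarrow> dtm \<Rightarrow> dtm \<Rightarrow> dtm" where
  "apd_comm A P f x p q =
     (let u = f x;
          p' = inv A x x p; q' = inv A x x q;
          pq = cat A x x x p q; pqp' = cat A x x x pq p';
          fp = apd A P f x x p; fq = apd A P f x x q;
          fp' = dinv A P x x p u u fp; fq' = dinv A P x x q u u fq;
          fpq = dcat A P x x x p q u u u fp fq;
          fpqp' = dcat A P x x x pq p' u u u fpq fp' in
      apd_cat_to A P f x pqp' q' fpqp' fq'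
        (apd_cat_to A P f x pq p' fpq fp' (apd_cat A P f x x x p q) (apd_inv A P f x x p))
        (apd_inv A P f x x q))"

section \<open>Equivalences and contractibility\<close>

definition isEquiv :: "dtm \<Rightarrow> dtm \<Rightarrow> dtm \<Rightarrow> dtm" where
  "isEquiv A B f =
     (\<^bold>\<Sigma>g\<^bold>:B \<^bold>\<rightarrow> A. \<^bold>\<Pi>y\<^bold>:B. f \<cdot> (g \<cdot> y) \<^bold>=\<^bsub>B\<^esub> y) \<^bold>\<times> (\<^bold>\<Sigma>h\<^bold>:B \<^bold>\<rightarrow> A. \<^bold>\<Pi>x\<^bold>:A. h \<cdot> (f \<cdot> x) \<^bold>=\<^bsub>A\<^esub> x)"

definition equiv :: "dtm \<Rightarrow> dtm \<Rightarrow> dtm" where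
  "equiv A B = (\<^bold>\<Sigma>f\<^bold>:A \<^bold>\<rightarrow> B. isEquiv A B f)"

definition idEquiv :: "dtm \<Rightarrow> dtm" where
  "idEquiv A =
     (let i = (\<^bold>\<lambda>x\<^bold>:A. x);
          T = (\<lambda>g. \<^bold>\<Pi>x\<^bold>:A. i \<cdot> (g \<cdot> x) \<^bold>=\<^bsub>A\<^esub> x);
          T' = (\<lambda>h. \<^bold>\<Pi>x\<^bold>:A. h \<cdot> (i \<cdot> x) \<^bold>=\<^bsub>A\<^esub> x);
          r = (\<^bold>\<lambda>x\<^bold>:A. rfl A x) in
      pair (A \<^bold>\<rightarrow> A) (\<lambda>f. isEquiv A A f) i
        (pair (\<^bold>\<Sigma>g\<^bold>:A \<^bold>\<rightarrow> A. T g) (\<lambda>x. \<^bold>\<Sigma>h\<^bold>:A \<^bold>\<rightarrow> A. T' h)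
          (pair (A \<^bold>\<rightarrow> A) T i r) (pair (A \<^bold>\<rightarrow> A) T' i r)))"

definition idtoeqv :: "nat \<Rightarrow> dtm \<Rightarrow> dtm \<Rightarrow> dtm" where
  "idtoeqv i A B = (\<^bold>\<lambda>p\<^bold>:A \<^bold>=\<^bsub>univ i\<^esub> B. J (univ i) (\<lambda>A B p. equiv A B) idEquiv A B p)"

definition isContr :: "dtm \<Rightarrow> dtm" where
  "isContr A = (\<^bold>\<Sigma>x\<^bold>:A. \<^bold>\<Pi>y\<^bold>:A. x \<^bold>=\<^bsub>A\<^esub> y)"

section \<open>The higher inductive type BH\<close>

text \<open>The 2-cell of a generator \<open>g\<close> identifies its loop with \<open>[h, g]\<close>, where \<open>h = prev g\<close>.\<close>

primrec prev :: "gen \<Rightarrow> gen" where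
  "prev Ga = Gd"
| "prev Gb = Ga"
| "prev Gc = Gb"
| "prev Gd = Gc"

abbreviation BH :: dtm where "BH \<equiv> con cBH"
abbreviation pt :: dtm where "pt \<equiv> con cPt"

definition loops :: dtm where
  "loops = (pt \<^bold>=\<^bsub>BH\<^esub> pt)"

definition rel :: "gen \<Rightarrow> dtm" where
  "rel g = comm BH pt (con (cLoop (prev g))) (con (cLoop g))"

text \<open>
  \<open>over P u p\<close> is the type of paths from \<open>u\<close> to \<open>u\<close> over the loop \<open>p\<close>.  Given such paths \<open>s\<close> and \<open>t\<close>
  over the loops of \<open>prev g\<close> and \<open>g\<close>, \<open>overCell P u g s t\<close> is the type of 2-dimensional paths from
  \<open>t\<close> to the commutator of \<open>s\<close> and \<open>t\<close> over the 2-cell of \<open>g\<close>.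
\<close>

definition over :: "(dtm \<Rightarrow> dtm) \<Rightarrow> dtm \<Rightarrow> dtm \<Rightarrow> dtm" where
  "over P u p = (tr BH P pt pt p u \<^bold>=\<^bsub>P pt\<^esub> u)"

definition overCell :: "(dtm \<Rightarrow> dtm) \<Rightarrow> dtm \<Rightarrow> gen \<Rightarrow> dtm \<Rightarrow> dtm \<Rightarrow> dtm" where
  "overCell P u g s t =
     (tr loops (over P u) (con (cLoop g)) (rel g) (con (cCell g)) t
        \<^bold>=\<^bsub>over P u (rel g)\<^esub>
      dcomm BH P pt (con (cLoop (prev g))) (con (cLoop g)) u s t)"

text \<open>
  The action of a dependent function \<open>f\<close> on the 2-cell of \<open>g\<close>, an element of
  \<open>overCell P (f pt) g (apd f (prev g)) (apd f g)\<close>.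
\<close>

definition apdCell :: "(dtm \<Rightarrow> dtm) \<Rightarrow> (dtm \<Rightarrow> dtm) \<Rightarrow> gen \<Rightarrow> dtm" where
  "apdCell P f g =
     (let h = con (cLoop (prev g)); l = con (cLoop g); Q = over P (f pt);
          F = apd BH P f pt pt in
      cat (Q (rel g)) (tr loops Q l (rel g) (con (cCell g)) (F l)) (F (rel g))
        (dcomm BH P pt h l (f pt) (F h) (F l))
        (apd loops Q F l (rel g) (con (cCell g)))
        (apd_comm BH P f pt h l))"

text \<open>
  The premises of BH-induction, quantified over a continuation that receives the motive, the image
  of the point, the images of the loops and of the 2-cells, and the function given by induction.
\<close>

primrec pick :: "'a \<Rightarrow> 'a \<Rightarrow> 'a \<Rightarrow> 'a \<Rightarrow> gen \<Rightarrow> 'a" where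
  "pick xa xb xc xd Ga = xa"
| "pick xa xb xc xd Gb = xb"
| "pick xa xb xc xd Gc = xc"
| "pick xa xb xc xd Gd = xd"

definition indBH :: "const \<Rightarrow> dtm \<Rightarrow> dtm \<Rightarrow> (gen \<Rightarrow> dtm) \<Rightarrow> (gen \<Rightarrow> dtm) \<Rightarrow> dtm" where
  "indBH c P u s r =
     con c \<cdot> P \<cdot> u \<cdot> s Ga \<cdot> s Gb \<cdot> s Gc \<cdot> s Gd \<cdot> r Ga \<cdot> r Gb \<cdot> r Gc \<cdot> r Gd"

definition piBH ::
  "nat \<Rightarrow> (dtm \<Rightarrow> dtm \<Rightarrow> (gen \<Rightarrow> dtm) \<Rightarrow> (gen \<Rightarrow> dtm) \<Rightarrow> dtm) \<Rightarrow> dtm" where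
  "piBH j K =
     (\<^bold>\<Pi>P\<^bold>:BH \<^bold>\<rightarrow> univ j. \<^bold>\<Pi>u\<^bold>:P \<cdot> pt.
      \<^bold>\<Pi>sa\<^bold>:over (\<lambda>x. P \<cdot> x) u (con (cLoop Ga)).
      \<^bold>\<Pi>sb\<^bold>:over (\<lambda>x. P \<cdot> x) u (con (cLoop Gb)).
      \<^bold>\<Pi>sc\<^bold>:over (\<lambda>x. P \<cdot> x) u (con (cLoop Gc)).
      \<^bold>\<Pi>sd\<^bold>:over (\<lambda>x. P \<cdot> x) u (con (cLoop Gd)).
      \<^bold>\<Pi>ra\<^bold>:overCell (\<lambda>x. P \<cdot> x) u Ga sd sa.
      \<^bold>\<Pi>rb\<^bold>:overCell (\<lambda>x. P \<cdot> x) u Gb sa sb.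
      \<^bold>\<Pi>rc\<^bold>:overCell (\<lambda>x. P \<cdot> x) u Gc sb sc.
      \<^bold>\<Pi>rd\<^bold>:overCell (\<lambda>x. P \<cdot> x) u Gd sc sd.
      K P u (pick sa sb sc sd) (pick ra rb rc rd))"

text \<open>
  \<open>cellComp\<close> is the computation rule for 2-cells: it lives in \<open>overCell\<close> over the given images of the
  loops, whereas \<open>apdCell f\<close> lives over the values of \<open>apd f\<close>, so the latter is transported along
  the computation rules for the loops of \<open>g\<close> and \<open>prev g\<close>.
\<close>

definition cellComp :: "gen \<Rightarrow> dtm \<Rightarrow> dtm \<Rightarrow> (gen \<Rightarrow> dtm) \<Rightarrow> (gen \<Rightarrow> dtm) \<Rightarrow> dtm" where
  "cellComp g P u s r =
     (let h = prev g;
          Px = (\<lambda>x. P \<cdot> x);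
          f = (\<lambda>x. indBH cIndBH P u s r \<cdot> x);
          F = (\<lambda>k. apd BH Px f pt pt (con (cLoop k)));
          \<beta> = (\<lambda>k. indBH (cLoopComp k) P u s r);
          Q = (\<lambda>k. over Px u (con (cLoop k))) in
      tr (Q h) (\<lambda>v. overCell Px u g v (s g)) (F h) (s h) (\<beta> h)
        (tr (Q g) (\<lambda>w. overCell Px u g (F h) w) (F g) (s g) (\<beta> g)
          (apdCell Px f g))
        \<^bold>=\<^bsub>overCell Px u g (s h) (s g)\<^esub> r g)"

section \<open>Types of the constants\<close>

definition pushout :: "dtm \<Rightarrow> dtm \<Rightarrow> dtm \<Rightarrow> dtm \<Rightarrow> dtm \<Rightarrow> dtm" where
  "pushout A B C f g = con cPushout \<cdot> A \<cdot> B \<cdot> C \<cdot> f \<cdot> g"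

text \<open>
  Pushouts of spans \<open>A \<leftarrow> C \<rightarrow> B\<close>.  As for BH, the continuation of \<open>piPushout\<close> receives the arguments
  of an application of pushout induction.
\<close>

definition piSpan :: "nat \<Rightarrow> (dtm \<Rightarrow> dtm \<Rightarrow> dtm \<Rightarrow> dtm \<Rightarrow> dtm \<Rightarrow> dtm) \<Rightarrow> dtm" where
  "piSpan i K =
     (\<^bold>\<Pi>A\<^bold>:univ i. \<^bold>\<Pi>B\<^bold>:univ i. \<^bold>\<Pi>C\<^bold>:univ i. \<^bold>\<Pi>f\<^bold>:C \<^bold>\<rightarrow> A. \<^bold>\<Pi>g\<^bold>:C \<^bold>\<rightarrow> B. K A B C f g)"

definition spanCon :: "const \<Rightarrow> dtm \<Rightarrow> dtm \<Rightarrow> dtm \<Rightarrow> dtm \<Rightarrow> dtm \<Rightarrow> dtm" where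
  "spanCon c A B C f g = con c \<cdot> A \<cdot> B \<cdot> C \<cdot> f \<cdot> g"

definition piPushout ::
  "nat \<Rightarrow> nat \<Rightarrow>
   (dtm \<Rightarrow> dtm \<Rightarrow> dtm \<Rightarrow> dtm \<Rightarrow> dtm \<Rightarrow> dtm \<Rightarrow> dtm \<Rightarrow> dtm \<Rightarrow> dtm \<Rightarrow> dtm) \<Rightarrow> dtm" where
  "piPushout i j K =
     piSpan i (\<lambda>A B C f g.
       \<^bold>\<Pi>P\<^bold>:pushout A B C f g \<^bold>\<rightarrow> univ j.
       \<^bold>\<Pi>l\<^bold>:(\<^bold>\<Pi>a\<^bold>:A. P \<cdot> (spanCon cPInl A B C f g \<cdot> a)).
       \<^bold>\<Pi>r\<^bold>:(\<^bold>\<Pi>b\<^bold>:B. P \<cdot> (spanCon cPInr A B C f g \<cdot> b)).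
       \<^bold>\<Pi>k\<^bold>:(\<^bold>\<Pi>c\<^bold>:C.
              tr (pushout A B C f g) (\<lambda>x. P \<cdot> x)
                 (spanCon cPInl A B C f g \<cdot> (f \<cdot> c)) (spanCon cPInr A B C f g \<cdot> (g \<cdot> c))
                 (spanCon cGlue A B C f g \<cdot> c) (l \<cdot> (f \<cdot> c))
              \<^bold>=\<^bsub>P \<cdot> (spanCon cPInr A B C f g \<cdot> (g \<cdot> c))\<^esub> r \<cdot> (g \<cdot> c)).
       K A B C f g P l r k)"

text \<open>
  The parameters \<open>i\<close> and \<open>j\<close> are the universe levels of the type arguments and of the motive.
  Constants carry no level themselves: each has the types \<open>cty i j c\<close> for all \<open>i\<close> and \<open>j\<close>.
\<close>

fun cty :: "nat \<Rightarrow> nat \<Rightarrow> const \<Rightarrow> dtm" where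
  "cty i j cEmpty = univ 0"
| "cty i j cIndEmpty = (\<^bold>\<Pi>P\<^bold>:con cEmpty \<^bold>\<rightarrow> univ j. \<^bold>\<Pi>x\<^bold>:con cEmpty. P \<cdot> x)"
| "cty i j cUnit = univ 0"
| "cty i j cStar = con cUnit"
| "cty i j cIndUnit = (\<^bold>\<Pi>P\<^bold>:con cUnit \<^bold>\<rightarrow> univ j. P \<cdot> con cStar \<^bold>\<rightarrow> (\<^bold>\<Pi>x\<^bold>:con cUnit. P \<cdot> x))"
| "cty i j cSum = univ i \<^bold>\<rightarrow> univ i \<^bold>\<rightarrow> univ i"
| "cty i j cInl = (\<^bold>\<Pi>A\<^bold>:univ i. \<^bold>\<Pi>B\<^bold>:univ i. A \<^bold>\<rightarrow> con cSum \<cdot> A \<cdot> B)"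
| "cty i j cInr = (\<^bold>\<Pi>A\<^bold>:univ i. \<^bold>\<Pi>B\<^bold>:univ i. B \<^bold>\<rightarrow> con cSum \<cdot> A \<cdot> B)"
| "cty i j cIndSum =
     (\<^bold>\<Pi>A\<^bold>:univ i. \<^bold>\<Pi>B\<^bold>:univ i. \<^bold>\<Pi>P\<^bold>:con cSum \<cdot> A \<cdot> B \<^bold>\<rightarrow> univ j.
      (\<^bold>\<Pi>a\<^bold>:A. P \<cdot> (con cInl \<cdot> A \<cdot> B \<cdot> a)) \<^bold>\<rightarrow> (\<^bold>\<Pi>b\<^bold>:B. P \<cdot> (con cInr \<cdot> A \<cdot> B \<cdot> b)) \<^bold>\<rightarrow>
      (\<^bold>\<Pi>x\<^bold>:con cSum \<cdot> A \<cdot> B. P \<cdot> x))"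
| "cty i j cNat = univ 0"
| "cty i j cZero = con cNat"
| "cty i j cSucc = con cNat \<^bold>\<rightarrow> con cNat"
| "cty i j cIndNat =
     (\<^bold>\<Pi>P\<^bold>:con cNat \<^bold>\<rightarrow> univ j. P \<cdot> con cZero \<^bold>\<rightarrow>
      (\<^bold>\<Pi>n\<^bold>:con cNat. P \<cdot> n \<^bold>\<rightarrow> P \<cdot> (con cSucc \<cdot> n)) \<^bold>\<rightarrow> (\<^bold>\<Pi>n\<^bold>:con cNat. P \<cdot> n))"
| "cty i j cSigma = (\<^bold>\<Pi>A\<^bold>:univ i. (A \<^bold>\<rightarrow> univ i) \<^bold>\<rightarrow> univ i)"
| "cty i j cPair =
     (\<^bold>\<Pi>A\<^bold>:univ i. \<^bold>\<Pi>B\<^bold>:A \<^bold>\<rightarrow> univ i. \<^bold>\<Pi>a\<^bold>:A. B \<cdot> a \<^bold>\<rightarrow> con cSigma \<cdot> A \<cdot> B)"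
| "cty i j cIndSigma =
     (\<^bold>\<Pi>A\<^bold>:univ i. \<^bold>\<Pi>B\<^bold>:A \<^bold>\<rightarrow> univ i. \<^bold>\<Pi>P\<^bold>:con cSigma \<cdot> A \<cdot> B \<^bold>\<rightarrow> univ j.
      (\<^bold>\<Pi>a\<^bold>:A. \<^bold>\<Pi>b\<^bold>:B \<cdot> a. P \<cdot> (con cPair \<cdot> A \<cdot> B \<cdot> a \<cdot> b)) \<^bold>\<rightarrow>
      (\<^bold>\<Pi>x\<^bold>:con cSigma \<cdot> A \<cdot> B. P \<cdot> x))"
| "cty i j cId = (\<^bold>\<Pi>A\<^bold>:univ i. A \<^bold>\<rightarrow> A \<^bold>\<rightarrow> univ i)"
| "cty i j cRefl = (\<^bold>\<Pi>A\<^bold>:univ i. \<^bold>\<Pi>x\<^bold>:A. x \<^bold>=\<^bsub>A\<^esub> x)"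
| "cty i j cIndId =
     (\<^bold>\<Pi>A\<^bold>:univ i. \<^bold>\<Pi>P\<^bold>:(\<^bold>\<Pi>x\<^bold>:A. \<^bold>\<Pi>y\<^bold>:A. x \<^bold>=\<^bsub>A\<^esub> y \<^bold>\<rightarrow> univ j).
      (\<^bold>\<Pi>x\<^bold>:A. P \<cdot> x \<cdot> x \<cdot> rfl A x) \<^bold>\<rightarrow> (\<^bold>\<Pi>x\<^bold>:A. \<^bold>\<Pi>y\<^bold>:A. \<^bold>\<Pi>p\<^bold>:x \<^bold>=\<^bsub>A\<^esub> y. P \<cdot> x \<cdot> y \<cdot> p))"
| "cty i j cUA =
     (\<^bold>\<Pi>A\<^bold>:univ i. \<^bold>\<Pi>B\<^bold>:univ i. isEquiv (A \<^bold>=\<^bsub>univ i\<^esub> B) (equiv A B) (idtoeqv i A B))"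
| "cty i j cPushout = piSpan i (\<lambda>A B C f g. univ i)"
| "cty i j cPInl = piSpan i (\<lambda>A B C f g. A \<^bold>\<rightarrow> pushout A B C f g)"
| "cty i j cPInr = piSpan i (\<lambda>A B C f g. B \<^bold>\<rightarrow> pushout A B C f g)"
| "cty i j cGlue =
     piSpan i (\<lambda>A B C f g. \<^bold>\<Pi>c\<^bold>:C.
       spanCon cPInl A B C f g \<cdot> (f \<cdot> c) \<^bold>=\<^bsub>pushout A B C f g\<^esub> spanCon cPInr A B C f g \<cdot> (g \<cdot> c))"
| "cty i j cIndPushout = piPushout i j (\<lambda>A B C f g P l r k. \<^bold>\<Pi>x\<^bold>:pushout A B C f g. P \<cdot> x)"
| "cty i j cGlueComp =
     piPushout i j (\<lambda>A B C f g P l r k. \<^bold>\<Pi>c\<^bold>:C.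
       (let x = spanCon cPInl A B C f g \<cdot> (f \<cdot> c); y = spanCon cPInr A B C f g \<cdot> (g \<cdot> c);
            p = spanCon cGlue A B C f g \<cdot> c; S = pushout A B C f g in
        apd S (\<lambda>x. P \<cdot> x) (\<lambda>x. spanCon cIndPushout A B C f g \<cdot> P \<cdot> l \<cdot> r \<cdot> k \<cdot> x) x y p
          \<^bold>=\<^bsub>tr S (\<lambda>x. P \<cdot> x) x y p (l \<cdot> (f \<cdot> c)) \<^bold>=\<^bsub>P \<cdot> y\<^esub> r \<cdot> (g \<cdot> c)\<^esub> k \<cdot> c))"
| "cty i j cBH = univ 0"
| "cty i j cPt = BH"
| "cty i j (cLoop g) = loops"
| "cty i j (cCell g) = (con (cLoop g) \<^bold>=\<^bsub>loops\<^esub> rel g)"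
| "cty i j cIndBH = piBH j (\<lambda>P u s r. \<^bold>\<Pi>x\<^bold>:BH. P \<cdot> x)"
| "cty i j (cLoopComp g) =
     piBH j (\<lambda>P u s r.
       apd BH (\<lambda>x. P \<cdot> x) (\<lambda>x. indBH cIndBH P u s r \<cdot> x) pt pt (con (cLoop g))
         \<^bold>=\<^bsub>over (\<lambda>x. P \<cdot> x) u (con (cLoop g))\<^esub> s g)"
| "cty i j (cCellComp g) = piBH j (cellComp g)"

section \<open>Judgments\<close>

definition apps :: "const \<Rightarrow> tm list \<Rightarrow> tm"  (infix "\<bullet>" 100) where
  "c \<bullet> ts = foldl App (Con c) ts"

text \<open>
  Judgmental computation rules of the eliminators.  A step is imposed below only on well-typed
  left-hand sides.
\<close>

inductive compstep :: "tm \<Rightarrow> tm \<Rightarrow> bool"  (infix "\<leadsto>" 50) where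
  comp_unit: "cIndUnit \<bullet> [P, t, cStar \<bullet> []] \<leadsto> t"
| comp_inl: "cIndSum \<bullet> [A, B, P, l, r, cInl \<bullet> [A, B, a]] \<leadsto> App l a"
| comp_inr: "cIndSum \<bullet> [A, B, P, l, r, cInr \<bullet> [A, B, b]] \<leadsto> App r b"
| comp_zero: "cIndNat \<bullet> [P, z, s, cZero \<bullet> []] \<leadsto> z"
| comp_succ: "cIndNat \<bullet> [P, z, s, cSucc \<bullet> [n]] \<leadsto> App (App s n) (cIndNat \<bullet> [P, z, s, n])"
| comp_pair: "cIndSigma \<bullet> [A, B, P, t, cPair \<bullet> [A, B, a, b]] \<leadsto> App (App t a) b"
| comp_refl: "cIndId \<bullet> [A, P, t, x, x, cRefl \<bullet> [A, x]] \<leadsto> App t x"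
| comp_pinl:
    "cIndPushout \<bullet> [A, B, C, f, g, P, l, r, k, cPInl \<bullet> [A, B, C, f, g, a]] \<leadsto> App l a"
| comp_pinr:
    "cIndPushout \<bullet> [A, B, C, f, g, P, l, r, k, cPInr \<bullet> [A, B, C, f, g, b]] \<leadsto> App r b"
| comp_pt: "cIndBH \<bullet> [P, u, sa, sb, sc, sd, ra, rb, rc, rd, cPt \<bullet> []] \<leadsto> u"

text \<open>A context lists the types of its variables, the most recent one (index 0) first.\<close>

inductive
  wf_ctx :: "tm list \<Rightarrow> bool" and
  has_type :: "tm list \<Rightarrow> tm \<Rightarrow> tm \<Rightarrow> bool"  ("(_ \<turnstile> _ \<^bold>: _)" [51, 51, 51] 50) and
  judg_eq :: "tm list \<Rightarrow> tm \<Rightarrow> tm \<Rightarrow> tm \<Rightarrow> bool"  ("(_ \<turnstile> _ \<^bold>\<equiv> _ \<^bold>: _)" [51, 51, 51, 51] 50)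
where
  ctx_empty: "wf_ctx []"
| ctx_extend: "\<lbrakk>wf_ctx \<Gamma>; \<Gamma> \<turnstile> A \<^bold>: Univ i\<rbrakk> \<Longrightarrow> wf_ctx (A # \<Gamma>)"

| ty_var: "\<lbrakk>wf_ctx \<Gamma>; n < length \<Gamma>\<rbrakk> \<Longrightarrow> \<Gamma> \<turnstile> Var n \<^bold>: ren (\<lambda>k. k + Suc n) (\<Gamma> ! n)"
| ty_con: "wf_ctx \<Gamma> \<Longrightarrow> \<Gamma> \<turnstile> Con c \<^bold>: cty i j c 0"
| ty_univ: "wf_ctx \<Gamma> \<Longrightarrow> \<Gamma> \<turnstile> Univ i \<^bold>: Univ (Suc i)"
| ty_cumul: "\<Gamma> \<turnstile> A \<^bold>: Univ i \<Longrightarrow> \<Gamma> \<turnstile> A \<^bold>: Univ (Suc i)"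
| ty_pi: "\<lbrakk>\<Gamma> \<turnstile> A \<^bold>: Univ i; A # \<Gamma> \<turnstile> B \<^bold>: Univ i\<rbrakk> \<Longrightarrow> \<Gamma> \<turnstile> Pi A B \<^bold>: Univ i"
| ty_lam: "\<lbrakk>\<Gamma> \<turnstile> A \<^bold>: Univ i; A # \<Gamma> \<turnstile> t \<^bold>: B\<rbrakk> \<Longrightarrow> \<Gamma> \<turnstile> Lam A t \<^bold>: Pi A B"
| ty_app: "\<lbrakk>\<Gamma> \<turnstile> f \<^bold>: Pi A B; \<Gamma> \<turnstile> a \<^bold>: A\<rbrakk> \<Longrightarrow> \<Gamma> \<turnstile> App f a \<^bold>: inst B a"
| ty_conv: "\<lbrakk>\<Gamma> \<turnstile> t \<^bold>: A; \<Gamma> \<turnstile> A \<^bold>\<equiv> B \<^bold>: Univ i\<rbrakk> \<Longrightarrow> \<Gamma> \<turnstile> t \<^bold>: B"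

| eq_refl: "\<Gamma> \<turnstile> t \<^bold>: A \<Longrightarrow> \<Gamma> \<turnstile> t \<^bold>\<equiv> t \<^bold>: A"
| eq_sym: "\<Gamma> \<turnstile> t \<^bold>\<equiv> u \<^bold>: A \<Longrightarrow> \<Gamma> \<turnstile> u \<^bold>\<equiv> t \<^bold>: A"
| eq_trans: "\<lbrakk>\<Gamma> \<turnstile> t \<^bold>\<equiv> u \<^bold>: A; \<Gamma> \<turnstile> u \<^bold>\<equiv> v \<^bold>: A\<rbrakk> \<Longrightarrow> \<Gamma> \<turnstile> t \<^bold>\<equiv> v \<^bold>: A"
| eq_conv: "\<lbrakk>\<Gamma> \<turnstile> t \<^bold>\<equiv> u \<^bold>: A; \<Gamma> \<turnstile> A \<^bold>\<equiv> B \<^bold>: Univ i\<rbrakk> \<Longrightarrow> \<Gamma> \<turnstile> t \<^bold>\<equiv> u \<^bold>: B"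
| eq_cumul: "\<Gamma> \<turnstile> A \<^bold>\<equiv> B \<^bold>: Univ i \<Longrightarrow> \<Gamma> \<turnstile> A \<^bold>\<equiv> B \<^bold>: Univ (Suc i)"
| eq_pi: "\<lbrakk>\<Gamma> \<turnstile> A \<^bold>: Univ i; \<Gamma> \<turnstile> A \<^bold>\<equiv> A' \<^bold>: Univ i; A # \<Gamma> \<turnstile> B \<^bold>\<equiv> B' \<^bold>: Univ i\<rbrakk>
    \<Longrightarrow> \<Gamma> \<turnstile> Pi A B \<^bold>\<equiv> Pi A' B' \<^bold>: Univ i"
| eq_lam: "\<lbrakk>\<Gamma> \<turnstile> A \<^bold>: Univ i; \<Gamma> \<turnstile> A \<^bold>\<equiv> A' \<^bold>: Univ i; A # \<Gamma> \<turnstile> t \<^bold>\<equiv> t' \<^bold>: B\<rbrakk>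
    \<Longrightarrow> \<Gamma> \<turnstile> Lam A t \<^bold>\<equiv> Lam A' t' \<^bold>: Pi A B"
| eq_app: "\<lbrakk>\<Gamma> \<turnstile> f \<^bold>\<equiv> f' \<^bold>: Pi A B; \<Gamma> \<turnstile> a \<^bold>\<equiv> a' \<^bold>: A\<rbrakk> \<Longrightarrow> \<Gamma> \<turnstile> App f a \<^bold>\<equiv> App f' a' \<^bold>: inst B a"
| eq_beta: "\<lbrakk>\<Gamma> \<turnstile> A \<^bold>: Univ i; A # \<Gamma> \<turnstile> t \<^bold>: B; \<Gamma> \<turnstile> a \<^bold>: A\<rbrakk>
    \<Longrightarrow> \<Gamma> \<turnstile> App (Lam A t) a \<^bold>\<equiv> inst t a \<^bold>: inst B a"
| eq_eta: "\<Gamma> \<turnstile> f \<^bold>: Pi A B \<Longrightarrow> \<Gamma> \<turnstile> f \<^bold>\<equiv> Lam A (App (ren Suc f) (Var 0)) \<^bold>: Pi A B"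
| eq_comp: "\<lbrakk>\<Gamma> \<turnstile> t \<^bold>: A; t \<leadsto> t'\<rbrakk> \<Longrightarrow> \<Gamma> \<turnstile> t \<^bold>\<equiv> t' \<^bold>: A"

section \<open>Suspensions and acyclicity\<close>

definition susp :: "dtm \<Rightarrow> dtm" where
  "susp A =
     pushout (con cUnit) (con cUnit) A (\<^bold>\<lambda>x\<^bold>:A. con cStar) (\<^bold>\<lambda>x\<^bold>:A. con cStar)"

definition acyclic :: "dtm \<Rightarrow> dtm" where
  "acyclic A = isContr (susp A)"

definition inhabited :: "dtm \<Rightarrow> bool" where
  "inhabited A \<longleftrightarrow> (\<exists>t. [] \<turnstile> t \<^bold>: A 0)"

end

(*
  By pushout induction, the suspension of BH is contractible as soon as all its meridians are equal.
  We show more: every map f from BH to an identity type n = s is constant.  By BH-induction for the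
  family f x = f pt, this requires a path over each generator g such that, along the 2-cell of g, the
  path over g corresponds to the dependent commutator of the paths over prev g and g.

  By the Eckmann-Hilton argument, a loop at one point of n = s extends to a homotopy from the
  identity of n = s to itself.  Hence transport along a loop p in the family f x = f pt is homotopic
  to a map defined on the whole family, and such a map commutes with transport along any loop q.
  A path over p makes this map homotopic to the identity.  It follows that the dependent commutator
  over [p, q] of two paths s, t over p, q equals a path that depends on p and q only.  With this path,
  carried back along the 2-cells, as the path over each generator, the four equations hold.

  The typing derivation is obtained by reflection, from a type checker for terms with named
  definitions that is proved sound for the type theory and evaluated by the simplifier.
*)

theory Submission
  imports Defs "HOL-Library.Monad_Syntax"
begin

section \<open>Algebra of renamings and substitutions on raw de Bruijn terms\<close>

section \<open>Renaming and substitution\<close>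

text \<open>The obstacle is that \<open>n = s\<close> need not be a set. BH-induction therefore asks
  for 2-dimensional paths over the cells as well, and these form a cyclic system: the equation for g
  involves the unknown paths over both \<open>prev g\<close> and g. The system decouples because the
  dependent commutator of s and t depends on neither of them; each unknown can then be prescribed by
  its own cell. This is the proof-relevant form of the remark that commutators vanish in an abelian
  group. The Eckmann-Hilton argument supplies the commutativity: a loop in a path space becomes
  natural against all paths, so that multiplying by it on the left can be traded for multiplying on
  the right, an operation that makes sense in every fibre.

  In the object theory, most steps are stated for abstract families, maps and homotopies, and the
  identity types of the suspension are put in only at the end; this keeps terms and normal forms
  small. Equations between 2-dimensional paths are stated with enough free endpoints for path
  induction to reduce them to unit laws.\<close>

abbreviation up_ren :: "(nat \<Rightarrow> nat) \<Rightarrow> nat \<Rightarrow> nat" where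
  "up_ren r \<equiv> case_nat 0 (\<lambda>n. Suc (r n))"

abbreviation up_sub :: "(nat \<Rightarrow> tm) \<Rightarrow> nat \<Rightarrow> tm" where
  "up_sub s \<equiv> case_nat (Var 0) (\<lambda>n. ren Suc (s n))"

lemma up_ren_comp: "up_ren r \<circ> up_ren q = up_ren (r \<circ> q)"
  by (auto simp: fun_eq_iff split: nat.split)

lemma ren_ren: "ren r (ren q t) = ren (r \<circ> q) t"
  by (induction t arbitrary: r q) (simp_all add: up_ren_comp)

lemma up_sub_up_ren: "up_sub s \<circ> up_ren r = up_sub (s \<circ> r)"
  by (auto simp: fun_eq_iff split: nat.split)

lemma sub_ren: "sub s (ren r t) = sub (s \<circ> r) t"
  by (induction t arbitrary: s r) (simp_all add: up_sub_up_ren)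

lemma ren_up_sub: "(\<lambda>n. ren (up_ren r) (up_sub s n)) = up_sub (\<lambda>n. ren r (s n))"
  by (auto simp: fun_eq_iff ren_ren comp_def split: nat.split)

lemma ren_sub: "ren r (sub s t) = sub (\<lambda>n. ren r (s n)) t"
  by (induction t arbitrary: s r) (simp_all add: ren_up_sub)

lemma sub_up_sub: "(\<lambda>n. sub (up_sub s) (up_sub q n)) = up_sub (\<lambda>n. sub s (q n))"
  by (auto simp: fun_eq_iff sub_ren ren_sub comp_def split: nat.split)

lemma sub_sub: "sub s (sub q t) = sub (\<lambda>n. sub s (q n)) t"
  by (induction t arbitrary: s q) (simp_all add: sub_up_sub)

lemma up_sub_Var: "case_nat (Var 0) (\<lambda>n. Var (Suc (r n))) = (\<lambda>n. Var (up_ren r n))"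
  by (auto simp: fun_eq_iff split: nat.split)

text \<open>A renaming is a substitution by variables; through this, facts about instantiation,
  closed terms and computation steps pass from substitutions to renamings.\<close>

lemma ren_eq_sub: "ren r t = sub (\<lambda>n. Var (r n)) t"
  by (induction t arbitrary: r) (simp_all add: up_sub_Var)

lemma sub_Var: "sub Var t = t"
proof -
  have "up_sub Var = Var"
    by (auto simp: fun_eq_iff split: nat.split)
  show ?thesis by (induction t) (simp_all only: sub.simps \<open>up_sub Var = Var\<close>)
qed

lemma ren_id: "ren (\<lambda>n. n) t = t"
  by (simp add: ren_eq_sub sub_Var)

primrec scoped :: "nat \<Rightarrow> tm \<Rightarrow> bool" where
  "scoped k (Var n) = (n < k)"
| "scoped k (Univ i) = True"
| "scoped k (Con c) = True"
| "scoped k (App t u) = (scoped k t \<and> scoped k u)"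
| "scoped k (Lam A t) = (scoped k A \<and> scoped (Suc k) t)"
| "scoped k (Pi A B) = (scoped k A \<and> scoped (Suc k) B)"

lemma sub_cong_scoped: "scoped k t \<Longrightarrow> (\<And>n. n < k \<Longrightarrow> s n = q n) \<Longrightarrow> sub s t = sub q t"
proof (induction t arbitrary: k s q)
  case (Lam A t)
  have "sub (up_sub s) t = sub (up_sub q) t"
    by (rule Lam.IH(2)[of "Suc k"]) (use Lam.prems in \<open>auto split: nat.split\<close>)
  moreover have "sub s A = sub q A"
    by (rule Lam.IH(1)) (use Lam.prems in auto)
  ultimately show ?case by simp
next
  case (Pi A t)
  have "sub (up_sub s) t = sub (up_sub q) t"
    by (rule Pi.IH(2)[of "Suc k"]) (use Pi.prems in \<open>auto split: nat.split\<close>)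
  moreover have "sub s A = sub q A"
    by (rule Pi.IH(1)) (use Pi.prems in auto)
  ultimately show ?case by simp
next
  case (App t u)
  have "sub s t = sub q t" "sub s u = sub q u"
    by (rule App.IH, use App.prems in auto)+
  then show ?case by simp
qed simp_all

lemma sub_closed: "scoped 0 t \<Longrightarrow> sub s t = t"
  using sub_cong_scoped[of 0 t s Var] by (simp add: sub_Var)

lemma ren_closed: "scoped 0 t \<Longrightarrow> ren r t = t"
  by (simp add: ren_eq_sub sub_closed)

section \<open>Closedness of named terms, by a depth-indexed logical predicate\<close>

section \<open>The types of the constants are closed\<close>

text \<open>A depth-indexed term may be evaluated under any number of further binders, so closedness
  from depth n has to speak of all larger depths; this makes it monotone in n.\<close>

definition closed_at :: "nat \<Rightarrow> dtm \<Rightarrow> bool" where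
  "closed_at n t \<longleftrightarrow> (\<forall>m\<ge>n. scoped m (t m))"

lemma closed_at_mono: "closed_at n t \<Longrightarrow> n \<le> m \<Longrightarrow> closed_at m t"
  by (auto simp: closed_at_def)

lemma closed_at_univ: "closed_at n (univ i)"
  and closed_at_con: "closed_at n (con c)"
  and closed_at_app: "\<lbrakk>closed_at n t; closed_at n u\<rbrakk> \<Longrightarrow> closed_at n (t \<cdot> u)"
  by (auto simp: closed_at_def univ_def con_def app_def)

lemma closed_at_var: "closed_at (Suc n) (\<lambda>m. Var (m - Suc n))"
  by (auto simp: closed_at_def)

text \<open>The abstraction may itself be evaluated at any depth k from n on, where its variable is
  closed only from \<open>Suc k\<close> on. Hence the premise on \<open>F\<close> ranges over all
  larger depths, as in a Kripke logical relation.\<close>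

lemma closed_at_lam:
  assumes "closed_at n A" and "\<And>m x. n \<le> m \<Longrightarrow> closed_at m x \<Longrightarrow> closed_at m (F x)"
  shows "closed_at n (lam A F)"
  using assms(1) assms(2)[OF _ closed_at_var] by (auto simp: closed_at_def lam_def)

lemma closed_at_pi:
  assumes "closed_at n A" and "\<And>m x. n \<le> m \<Longrightarrow> closed_at m x \<Longrightarrow> closed_at m (F x)"
  shows "closed_at n (pi A F)"
  using assms(1) assms(2)[OF _ closed_at_var] by (auto simp: closed_at_def pi_def)

lemmas closed_at_basic = closed_at_univ closed_at_con closed_at_app closed_at_lam closed_at_pi

definition closed_fun :: "nat \<Rightarrow> (dtm \<Rightarrow> dtm) \<Rightarrow> bool" where
  "closed_fun n F \<longleftrightarrow> (\<forall>m\<ge>n. \<forall>x. closed_at m x \<longrightarrow> closed_at m (F x))"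

lemma closed_funI: "(\<And>m x. n \<le> m \<Longrightarrow> closed_at m x \<Longrightarrow> closed_at m (F x)) \<Longrightarrow> closed_fun n F"
  by (simp add: closed_fun_def)

lemma closed_fun_mono: "closed_fun n F \<Longrightarrow> n \<le> m \<Longrightarrow> closed_fun m F"
  by (simp add: closed_fun_def)

lemma closed_funD: "\<lbrakk>closed_fun n F; closed_at m x\<rbrakk> \<Longrightarrow> n \<le> m \<Longrightarrow> closed_at m (F x)"
  by (simp add: closed_fun_def)

lemmas closed_mono = closed_at_mono closed_funD closed_fun_mono order_trans

lemma closed_at_idt: "\<lbrakk>closed_at n A; closed_at n x; closed_at n y\<rbrakk> \<Longrightarrow> closed_at n (x \<^bold>=\<^bsub>A\<^esub> y)"
  and closed_at_rfl: "\<lbrakk>closed_at n A; closed_at n x\<rbrakk> \<Longrightarrow> closed_at n (rfl A x)"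
  by (simp_all add: idt_def rfl_def closed_at_basic)

lemma closed_at_arr: "\<lbrakk>closed_at n A; closed_at n B\<rbrakk> \<Longrightarrow> closed_at n (A \<^bold>\<rightarrow> B)"
  and closed_at_prod: "\<lbrakk>closed_at n A; closed_at n B\<rbrakk> \<Longrightarrow> closed_at n (A \<^bold>\<times> B)"
  unfolding arr_def prod_def sig_def
  by (intro closed_at_basic; (assumption | rule closed_at_mono, assumption, assumption))+

lemma closed_at_sig:
  assumes "closed_at n A" and "\<And>m x. n \<le> m \<Longrightarrow> closed_at m x \<Longrightarrow> closed_at m (F x)"
  shows "closed_at n (sig A F)"
  unfolding sig_def by (intro closed_at_basic assms)

lemma closed_at_pair:
  assumes "closed_at n A" and "\<And>m x. n \<le> m \<Longrightarrow> closed_at m x \<Longrightarrow> closed_at m (F x)"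
    and "closed_at n a" and "closed_at n b"
  shows "closed_at n (pair A F a b)"
  unfolding pair_def by (intro closed_at_basic assms)

lemma closed_at_J:
  assumes A: "closed_at n A"
    and C: "\<And>m x y p. n \<le> m \<Longrightarrow> \<lbrakk>closed_at m x; closed_at m y; closed_at m p\<rbrakk> \<Longrightarrow> closed_at m (C x y p)"
    and c: "\<And>m x. n \<le> m \<Longrightarrow> closed_at m x \<Longrightarrow> closed_at m (c x)"
    and xyp: "closed_at n x" "closed_at n y" "closed_at n p"
  shows "closed_at n (J A C c x y p)"
proof -
  have "closed_at m (\<^bold>\<lambda>x\<^bold>:A. \<^bold>\<lambda>y\<^bold>:A. \<^bold>\<lambda>p\<^bold>:x \<^bold>=\<^bsub>A\<^esub> y. C x y p)" if "n \<le> m" for m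
    using that A
    by (intro closed_at_lam closed_at_idt C; blast intro: closed_mono)
  from this[of n] show ?thesis
    unfolding J_def by (intro closed_at_app closed_at_con A xyp closed_at_lam[OF A c]) simp_all
qed

lemmas closed_at_intros = closed_at_basic closed_at_idt closed_at_rfl closed_at_arr closed_at_prod
  closed_at_sig closed_at_pair closed_at_J

lemma closed_at_cat:
  "\<lbrakk>closed_at n A; closed_at n x; closed_at n y; closed_at n z; closed_at n p; closed_at n q\<rbrakk> \<Longrightarrow>
    closed_at n (cat A x y z p q)"
  unfolding cat_def
  by (intro closed_at_intros; blast intro: closed_mono)

lemma closed_at_inv:
  "\<lbrakk>closed_at n A; closed_at n x; closed_at n y; closed_at n p\<rbrakk> \<Longrightarrow> closed_at n (inv A x y p)"
  unfolding inv_def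
  by (intro closed_at_intros; blast intro: closed_mono)

lemma closed_at_tr:
  "\<lbrakk>closed_at n A; closed_fun n P; closed_at n x; closed_at n y; closed_at n p; closed_at n u\<rbrakk> \<Longrightarrow>
    closed_at n (tr A P x y p u)"
  unfolding tr_def
  by (intro closed_at_intros; blast intro: closed_mono)

lemmas closed_at_paths = closed_at_cat closed_at_inv closed_at_tr

lemma closed_at_ap:
  "\<lbrakk>closed_at n A; closed_at n B; closed_fun n f; closed_at n x; closed_at n y; closed_at n p\<rbrakk> \<Longrightarrow>
    closed_at n (ap A B f x y p)"
  unfolding ap_def
  by (intro closed_at_intros; blast intro: closed_mono)

lemma closed_at_tr_cat:
  "\<lbrakk>closed_at n A; closed_fun n P; closed_at n x; closed_at n y; closed_at n z; closed_at n p;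
    closed_at n q; closed_at n u\<rbrakk> \<Longrightarrow> closed_at n (tr_cat A P x y z p q u)"
  unfolding tr_cat_def
  by (intro closed_at_intros closed_at_paths closed_funI; blast intro: closed_mono)

lemma closed_at_tr_inv:
  "\<lbrakk>closed_at n A; closed_fun n P; closed_at n x; closed_at n y; closed_at n p; closed_at n u\<rbrakk> \<Longrightarrow>
    closed_at n (tr_inv A P x y p u)"
  unfolding tr_inv_def
  by (intro closed_at_intros closed_at_paths closed_funI; blast intro: closed_mono)

lemma closed_at_apd:
  "\<lbrakk>closed_at n A; closed_fun n P; closed_fun n f; closed_at n x; closed_at n y; closed_at n p\<rbrakk> \<Longrightarrow>
    closed_at n (apd A P f x y p)"
  unfolding apd_def
  by (intro closed_at_intros closed_at_paths closed_funI; blast intro: closed_mono)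

lemmas closed_at_paths' = closed_at_paths closed_at_tr_cat closed_at_tr_inv closed_at_apd closed_at_ap

lemma closed_at_dcat:
  "\<lbrakk>closed_at n A; closed_fun n P; closed_at n x; closed_at n y; closed_at n z; closed_at n p;
    closed_at n q; closed_at n u; closed_at n v; closed_at n w; closed_at n s; closed_at n t\<rbrakk> \<Longrightarrow>
    closed_at n (dcat A P x y z p q u v w s t)"
  unfolding dcat_def Let_def
  by (intro closed_at_intros closed_at_paths' closed_funI; blast intro: closed_mono)

lemma closed_at_dinv:
  "\<lbrakk>closed_at n A; closed_fun n P; closed_at n x; closed_at n y; closed_at n p; closed_at n u;
    closed_at n v; closed_at n s\<rbrakk> \<Longrightarrow> closed_at n (dinv A P x y p u v s)"
  unfolding dinv_def Let_def
  by (intro closed_at_intros closed_at_paths' closed_funI; blast intro: closed_mono)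

lemmas closed_at_dpaths = closed_at_paths' closed_at_dcat closed_at_dinv

lemma closed_at_dcomm:
  "\<lbrakk>closed_at n A; closed_fun n P; closed_at n x; closed_at n p; closed_at n q; closed_at n u;
    closed_at n s; closed_at n t\<rbrakk> \<Longrightarrow> closed_at n (dcomm A P x p q u s t)"
  unfolding dcomm_def Let_def
  by (intro closed_at_intros closed_at_dpaths closed_funI; blast intro: closed_mono)

lemma closed_at_comm:
  "\<lbrakk>closed_at n A; closed_at n x; closed_at n p; closed_at n q\<rbrakk> \<Longrightarrow> closed_at n (comm A x p q)"
  unfolding comm_def
  by (intro closed_at_intros closed_at_dpaths closed_funI; blast intro: closed_mono)

lemma closed_at_apd_cat:
  "\<lbrakk>closed_at n A; closed_fun n P; closed_fun n f; closed_at n x; closed_at n y; closed_at n z;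
    closed_at n p; closed_at n q\<rbrakk> \<Longrightarrow> closed_at n (apd_cat A P f x y z p q)"
  unfolding apd_cat_def
  by (intro closed_at_intros closed_at_dpaths closed_funI; blast intro: closed_mono)

lemma closed_at_apd_inv:
  "\<lbrakk>closed_at n A; closed_fun n P; closed_fun n f; closed_at n x; closed_at n y; closed_at n p\<rbrakk> \<Longrightarrow>
    closed_at n (apd_inv A P f x y p)"
  unfolding apd_inv_def
  by (intro closed_at_intros closed_at_dpaths closed_funI; blast intro: closed_mono)

lemma closed_at_apd_cat_to:
  "\<lbrakk>closed_at n A; closed_fun n P; closed_fun n f; closed_at n x; closed_at n p; closed_at n q;
    closed_at n s; closed_at n t; closed_at n e; closed_at n e1\<rbrakk> \<Longrightarrow>
    closed_at n (apd_cat_to A P f x p q s t e e1)"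
  unfolding apd_cat_to_def Let_def
  by (intro closed_at_intros closed_at_dpaths closed_funI closed_at_apd_cat; blast intro: closed_mono)

lemma closed_at_apd_comm:
  "\<lbrakk>closed_at n A; closed_fun n P; closed_fun n f; closed_at n x; closed_at n p; closed_at n q\<rbrakk> \<Longrightarrow>
    closed_at n (apd_comm A P f x p q)"
  unfolding apd_comm_def Let_def
  by (intro closed_at_intros closed_at_dpaths closed_funI closed_at_apd_cat closed_at_apd_inv closed_at_apd_cat_to; blast intro: closed_mono)

lemmas closed_at_all = closed_at_intros closed_at_dpaths closed_funI closed_at_dcomm closed_at_comm
  closed_at_apd_comm

lemma closed_at_loops: "closed_at n loops"
  unfolding loops_def by (intro closed_at_all)

lemma closed_at_rel: "closed_at n (rel g)"
  unfolding rel_def by (intro closed_at_all)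

lemma closed_at_over:
  "\<lbrakk>closed_fun n P; closed_at n u; closed_at n p\<rbrakk> \<Longrightarrow> closed_at n (over P u p)"
  unfolding over_def
  by (intro closed_at_all; blast intro: closed_mono closed_at_con)

lemma closed_at_overCell:
  "\<lbrakk>closed_fun n P; closed_at n u; closed_at n s; closed_at n t\<rbrakk> \<Longrightarrow> closed_at n (overCell P u g s t)"
  unfolding overCell_def
  by (intro closed_at_all closed_at_loops closed_at_rel closed_at_over;
      blast intro: closed_mono closed_at_con)

lemma closed_at_apdCell:
  "\<lbrakk>closed_fun n P; closed_fun n f\<rbrakk> \<Longrightarrow> closed_at n (apdCell P f g)"
  unfolding apdCell_def Let_def
  by (intro closed_at_all closed_at_loops closed_at_rel closed_at_over closed_at_apd;
      blast intro: closed_mono closed_at_con)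

lemma closed_at_indBH:
  "\<lbrakk>closed_at n P; closed_at n u\<rbrakk> \<Longrightarrow> (\<And>g. closed_at n (s g)) \<Longrightarrow> (\<And>g. closed_at n (r g)) \<Longrightarrow>
   closed_at n (indBH c P u s r)"
  unfolding indBH_def by (intro closed_at_basic)

lemma closed_at_pick:
  "\<lbrakk>closed_at n a; closed_at n b; closed_at n c; closed_at n d\<rbrakk> \<Longrightarrow> closed_at n (pick a b c d g)"
  by (cases g) simp_all

lemma closed_at_piBH:
  assumes "\<And>m P u s r. n \<le> m \<Longrightarrow> \<lbrakk>closed_at m P; closed_at m u\<rbrakk> \<Longrightarrow> (\<And>g. closed_at m (s g)) \<Longrightarrow>
      (\<And>g. closed_at m (r g)) \<Longrightarrow> closed_at m (K P u s r)"
  shows "closed_at n (piBH j K)"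
  unfolding piBH_def
  by (intro closed_at_all closed_at_over closed_at_overCell assms closed_at_pick;
      (assumption | (erule closed_at_mono, linarith) | linarith)?)

lemma closed_at_cellComp:
  assumes "closed_at m P" "closed_at m u" "\<And>g. closed_at m (s g)" "\<And>g. closed_at m (r g)"
  shows "closed_at m (cellComp g P u s r)"
proof -
  have s: "\<And>g k. m \<le> k \<Longrightarrow> closed_at k (s g)" and r: "\<And>g k. m \<le> k \<Longrightarrow> closed_at k (r g)"
    using assms(3,4) closed_at_mono by blast+
  show ?thesis
    unfolding cellComp_def Let_def
    using assms(1,2)
    by (intro closed_at_all closed_at_over closed_at_overCell closed_at_apdCell closed_at_indBH closed_at_apd
          assms(3,4) s r;
        (assumption | linarith | blast intro: closed_at_mono order_trans))
qed

lemma closed_at_isEquiv: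
  "\<lbrakk>closed_at n A; closed_at n B; closed_at n f\<rbrakk> \<Longrightarrow> closed_at n (isEquiv A B f)"
  unfolding isEquiv_def
  by (intro closed_at_all; (blast intro: closed_at_mono order_trans))

lemma closed_at_equiv: "\<lbrakk>closed_at n A; closed_at n B\<rbrakk> \<Longrightarrow> closed_at n (equiv A B)"
  unfolding equiv_def
  by (intro closed_at_all closed_at_isEquiv; (blast intro: closed_at_mono order_trans))

lemma closed_at_idEquiv: "closed_at n A \<Longrightarrow> closed_at n (idEquiv A)"
  unfolding idEquiv_def Let_def
  by (intro closed_at_all closed_at_isEquiv; (blast intro: closed_at_mono order_trans))

lemma closed_at_idtoeqv: "\<lbrakk>closed_at n A; closed_at n B\<rbrakk> \<Longrightarrow> closed_at n (idtoeqv i A B)"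
  unfolding idtoeqv_def
  by (intro closed_at_all closed_at_equiv closed_at_idEquiv; (blast intro: closed_at_mono order_trans))

lemma closed_at_pushout:
  "\<lbrakk>closed_at n A; closed_at n B; closed_at n C; closed_at n f; closed_at n g\<rbrakk> \<Longrightarrow>
    closed_at n (pushout A B C f g)"
  and closed_at_spanCon:
  "\<lbrakk>closed_at n A; closed_at n B; closed_at n C; closed_at n f; closed_at n g\<rbrakk> \<Longrightarrow>
    closed_at n (spanCon c A B C f g)"
  unfolding pushout_def spanCon_def by (intro closed_at_basic; assumption)+

lemma closed_at_piSpan:
  assumes "\<And>m A B C f g. n \<le> m \<Longrightarrow> \<lbrakk>closed_at m A; closed_at m B; closed_at m C; closed_at m f;
    closed_at m g\<rbrakk> \<Longrightarrow> closed_at m (K A B C f g)"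
  shows "closed_at n (piSpan i K)"
  unfolding piSpan_def
  by (intro closed_at_all assms; (assumption | (erule closed_at_mono, linarith) | linarith)?)

lemma closed_at_piPushout:
  assumes "\<And>m A B C f g P l r k. n \<le> m \<Longrightarrow> \<lbrakk>closed_at m A; closed_at m B; closed_at m C; closed_at m f;
    closed_at m g; closed_at m P; closed_at m l; closed_at m r; closed_at m k\<rbrakk> \<Longrightarrow>
    closed_at m (K A B C f g P l r k)"
  shows "closed_at n (piPushout i j K)"
  unfolding piPushout_def
  by (intro closed_at_piSpan closed_at_all closed_at_pushout closed_at_spanCon assms;
      (assumption | (blast intro: closed_at_mono order_trans))?)

lemma closed_at_cty: "closed_at n (cty i j c)"
proof (cases c)
  case (cCellComp g)
  then show ?thesis by (simp add: closed_at_piBH closed_at_cellComp)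
qed (simp only: cty.simps Let_def;
    intro closed_at_all closed_at_loops closed_at_rel closed_at_over closed_at_piBH closed_at_indBH closed_at_apd
      closed_at_isEquiv closed_at_equiv closed_at_idtoeqv closed_at_piSpan closed_at_piPushout closed_at_pushout
      closed_at_spanCon;
    (assumption | (blast intro: closed_at_mono order_trans)))+

text \<open>This is what makes the rule \<open>ty_con\<close> stable under renaming and
  substitution: the type of a constant is the same in every context.\<close>

lemma cty_closed: "scoped 0 (cty i j c 0)"
  using closed_at_cty[of 0] by (simp add: closed_at_def)

section \<open>Admissible rules: weakening, substitution and its functionality\<close>

section \<open>Renaming, substitution and congruence of derivations\<close>

lemma sub_inst: "sub s (inst t a) = inst (sub (up_sub s) t) (sub s a)"
  unfolding inst_def sub_sub
  by (rule arg_cong[where f = "\<lambda>s. sub s t"])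
    (auto simp: fun_eq_iff sub_ren comp_def sub_Var split: nat.split)

lemma ren_inst: "ren r (inst t a) = inst (ren (up_ren r) t) (ren r a)"
proof -
  have "up_sub (\<lambda>n. Var (r n)) = (\<lambda>n. Var (up_ren r n))"
    using up_sub_Var[of r] by simp
  then show ?thesis unfolding ren_eq_sub sub_inst by simp
qed

lemma sub_apps: "sub s (c \<bullet> ts) = c \<bullet> map (sub s) ts"
proof -
  have "sub s (foldl App t ts) = foldl App (sub s t) (map (sub s) ts)" for t
    by (induction ts arbitrary: t) simp_all
  then show ?thesis by (simp add: apps_def)
qed

text \<open>The parameters of a computation rule are arbitrary terms, so a substitution instance of
  a step is again an instance of the same rule.\<close>

lemma compstep_sub: "t \<leadsto> u \<Longrightarrow> sub s t \<leadsto> sub s u"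
  by (induction rule: compstep.induct) (simp_all add: sub_apps compstep.intros)

lemma compstep_ren: "t \<leadsto> u \<Longrightarrow> ren r t \<leadsto> ren r u"
  by (simp add: ren_eq_sub compstep_sub)

definition ren_typed :: "(nat \<Rightarrow> nat) \<Rightarrow> tm list \<Rightarrow> tm list \<Rightarrow> bool" where
  "ren_typed r \<Gamma> \<Delta> \<longleftrightarrow> wf_ctx \<Delta> \<and> (\<forall>n<length \<Gamma>. r n < length \<Delta> \<and>
     ren (\<lambda>k. k + Suc (r n)) (\<Delta> ! r n) = ren r (ren (\<lambda>k. k + Suc n) (\<Gamma> ! n)))"

lemma ren_typed_wf: "ren_typed r \<Gamma> \<Delta> \<Longrightarrow> wf_ctx \<Delta>"
  by (simp add: ren_typed_def)

lemma ren_typed_up: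
  assumes "ren_typed r \<Gamma> \<Delta>" and "\<Delta> \<turnstile> ren r A \<^bold>: Univ i"
  shows "ren_typed (up_ren r) (A # \<Gamma>) (ren r A # \<Delta>)"
  unfolding ren_typed_def
proof (intro conjI allI impI)
  show "wf_ctx (ren r A # \<Delta>)"
    using assms by (auto simp: ren_typed_def intro: ctx_extend)
next
  fix n assume "n < length (A # \<Gamma>)"
  then show "up_ren r n < length (ren r A # \<Delta>)"
    using assms by (cases n) (auto simp: ren_typed_def)
next
  fix n assume n: "n < length (A # \<Gamma>)"
  show "ren (\<lambda>k. k + Suc (up_ren r n)) ((ren r A # \<Delta>) ! up_ren r n) =
      ren (up_ren r) (ren (\<lambda>k. k + Suc n) ((A # \<Gamma>) ! n))"
  proof (cases n)
    case 0
    then show ?thesis by (simp add: ren_ren comp_def)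
  next
    case (Suc m)
    with n assms(1) have "ren Suc (ren (\<lambda>k. k + Suc (r m)) (\<Delta> ! r m)) = ren Suc (ren r (ren (\<lambda>k. k + Suc m) (\<Gamma> ! m)))"
      by (simp add: ren_typed_def)
    with Suc show ?thesis by (simp add: ren_ren comp_def)
  qed
qed

text \<open>The claim about contexts is a placeholder in the mutual induction. Well-formedness of
  the target context is carried by \<open>ren_typed\<close> and re-established under binders by
  \<open>ren_typed_up\<close>.\<close>

lemma typing_ren:
  shows "wf_ctx \<Gamma> \<Longrightarrow> True"
    and "\<Gamma> \<turnstile> t \<^bold>: A \<Longrightarrow> ren_typed r \<Gamma> \<Delta> \<Longrightarrow> \<Delta> \<turnstile> ren r t \<^bold>: ren r A"
    and "\<Gamma> \<turnstile> t \<^bold>\<equiv> u \<^bold>: A \<Longrightarrow> ren_typed r \<Gamma> \<Delta> \<Longrightarrow> \<Delta> \<turnstile> ren r t \<^bold>\<equiv> ren r u \<^bold>: ren r A"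
proof (induction arbitrary: and r \<Delta> and r \<Delta> rule: wf_ctx_has_type_judg_eq.inducts)
  case (ty_var \<Gamma> n)
  then have "\<Delta> \<turnstile> Var (r n) \<^bold>: ren (\<lambda>k. k + Suc (r n)) (\<Delta> ! r n)"
    by (intro wf_ctx_has_type_judg_eq.ty_var) (auto simp: ren_typed_def)
  with ty_var show ?case by (simp add: ren_typed_def)
next
  case (ty_con \<Gamma> c i j)
  then show ?case
    by (simp add: ren_closed[OF cty_closed] ren_typed_def wf_ctx_has_type_judg_eq.ty_con)
next
  case (ty_app \<Gamma> f A B a)
  then show ?case by (auto simp: ren_inst intro!: wf_ctx_has_type_judg_eq.ty_app)
next
  case (eq_app \<Gamma> f f' A B a a')
  then show ?case by (auto simp: ren_inst intro!: wf_ctx_has_type_judg_eq.eq_app)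
next
  case (eq_beta \<Gamma> A i t B a)
  then show ?case by (simp add: ren_inst; blast intro: wf_ctx_has_type_judg_eq.eq_beta ren_typed_up)
next
  case (eq_eta \<Gamma> f A B)
  then have "\<Delta> \<turnstile> ren r f \<^bold>\<equiv> Lam (ren r A) (App (ren Suc (ren r f)) (Var 0)) \<^bold>: Pi (ren r A) (ren (up_ren r) B)"
    by (auto intro!: wf_ctx_has_type_judg_eq.eq_eta)
  then show ?case by (simp add: ren_ren comp_def)
qed (simp_all, (blast intro: ty_univ ty_cumul ty_conv ty_pi ty_lam ren_typed_wf ren_typed_up
    | rule eq_pi eq_lam; blast intro: ren_typed_up | rule eq_refl, blast | rule eq_sym, blast
    | rule eq_trans; blast | rule eq_conv; blast | rule eq_cumul, blast
    | blast intro: eq_comp compstep_ren)+)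

text \<open>Every typing rule either demands a well-formed context outright or has a typing premise
  in its own context, so the induction can follow typing derivations alone.\<close>

lemma has_type_wf: "\<Gamma> \<turnstile> t \<^bold>: A \<Longrightarrow> wf_ctx \<Gamma>"
  by (induction rule: wf_ctx_has_type_judg_eq.inducts(2)[of _ _ _ "\<lambda>_. True" _ "\<lambda>_ _ _ _. True"]) auto

lemma weaken:
  assumes "\<Gamma> \<turnstile> A \<^bold>: Univ i"
  shows "\<Gamma> \<turnstile> t \<^bold>: B \<Longrightarrow> A # \<Gamma> \<turnstile> ren Suc t \<^bold>: ren Suc B"
    and "\<Gamma> \<turnstile> t \<^bold>\<equiv> u \<^bold>: B \<Longrightarrow> A # \<Gamma> \<turnstile> ren Suc t \<^bold>\<equiv> ren Suc u \<^bold>: ren Suc B"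
proof -
  have "wf_ctx (A # \<Gamma>)" using assms by (blast intro: ctx_extend has_type_wf)
  then have "ren_typed Suc \<Gamma> (A # \<Gamma>)" by (simp add: ren_typed_def ren_ren comp_def)
  then show "\<Gamma> \<turnstile> t \<^bold>: B \<Longrightarrow> A # \<Gamma> \<turnstile> ren Suc t \<^bold>: ren Suc B"
    and "\<Gamma> \<turnstile> t \<^bold>\<equiv> u \<^bold>: B \<Longrightarrow> A # \<Gamma> \<turnstile> ren Suc t \<^bold>\<equiv> ren Suc u \<^bold>: ren Suc B"
    by (blast intro: typing_ren)+
qed

definition sub_typed :: "(nat \<Rightarrow> tm) \<Rightarrow> tm list \<Rightarrow> tm list \<Rightarrow> bool" where
  "sub_typed s \<Gamma> \<Delta> \<longleftrightarrow> wf_ctx \<Delta> \<and> (\<forall>n<length \<Gamma>. \<Delta> \<turnstile> s n \<^bold>: sub s (ren (\<lambda>k. k + Suc n) (\<Gamma> ! n)))"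

lemma sub_typed_wf: "sub_typed s \<Gamma> \<Delta> \<Longrightarrow> wf_ctx \<Delta>"
  by (simp add: sub_typed_def)

lemma var_0: "\<Gamma> \<turnstile> A \<^bold>: Univ i \<Longrightarrow> A # \<Gamma> \<turnstile> Var 0 \<^bold>: ren Suc A"
  using ty_var[of "A # \<Gamma>" 0] by (auto intro: ctx_extend has_type_wf)

lemma sub_typed_up:
  assumes s: "sub_typed s \<Gamma> \<Delta>" and A: "\<Delta> \<turnstile> sub s A \<^bold>: Univ i"
  shows "sub_typed (up_sub s) (A # \<Gamma>) (sub s A # \<Delta>)"
  unfolding sub_typed_def
proof (intro conjI allI impI)
  show "wf_ctx (sub s A # \<Delta>)"
    using assms by (auto simp: sub_typed_def intro: ctx_extend)
next
  fix n assume n: "n < length (A # \<Gamma>)"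
  show "sub s A # \<Delta> \<turnstile> up_sub s n \<^bold>: sub (up_sub s) (ren (\<lambda>k. k + Suc n) ((A # \<Gamma>) ! n))"
  proof (cases n)
    case 0
    then show ?thesis using var_0[OF A] by (simp add: sub_ren ren_sub comp_def)
  next
    case (Suc m)
    with n s have "\<Delta> \<turnstile> s m \<^bold>: sub s (ren (\<lambda>k. k + Suc m) (\<Gamma> ! m))"
      by (simp add: sub_typed_def)
    from weaken(1)[OF A this] Suc show ?thesis by (simp add: sub_ren ren_sub comp_def)
  qed
qed

lemma typing_sub:
  shows "wf_ctx \<Gamma> \<Longrightarrow> True"
    and "\<Gamma> \<turnstile> t \<^bold>: A \<Longrightarrow> sub_typed s \<Gamma> \<Delta> \<Longrightarrow> \<Delta> \<turnstile> sub s t \<^bold>: sub s A"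
    and "\<Gamma> \<turnstile> t \<^bold>\<equiv> u \<^bold>: A \<Longrightarrow> sub_typed s \<Gamma> \<Delta> \<Longrightarrow> \<Delta> \<turnstile> sub s t \<^bold>\<equiv> sub s u \<^bold>: sub s A"
proof (induction arbitrary: and s \<Delta> and s \<Delta> rule: wf_ctx_has_type_judg_eq.inducts)
  case (ty_con \<Gamma> c i j)
  then show ?case
    by (simp add: sub_closed[OF cty_closed] sub_typed_def wf_ctx_has_type_judg_eq.ty_con)
next
  case (ty_app \<Gamma> f A B a)
  then show ?case by (auto simp: sub_inst intro!: wf_ctx_has_type_judg_eq.ty_app)
next
  case (eq_app \<Gamma> f f' A B a a')
  then show ?case by (auto simp: sub_inst intro!: wf_ctx_has_type_judg_eq.eq_app)
next
  case (eq_beta \<Gamma> A i t B a)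
  then show ?case by (simp add: sub_inst; blast intro: wf_ctx_has_type_judg_eq.eq_beta sub_typed_up)
next
  case (eq_eta \<Gamma> f A B)
  then have "\<Delta> \<turnstile> sub s f \<^bold>\<equiv> Lam (sub s A) (App (ren Suc (sub s f)) (Var 0)) \<^bold>: Pi (sub s A) (sub (up_sub s) B)"
    by (auto intro!: wf_ctx_has_type_judg_eq.eq_eta)
  then show ?case by (simp add: sub_ren ren_sub comp_def)
next
  case (ty_var \<Gamma> n)
  then show ?case by (simp add: sub_typed_def)
qed (simp_all, (blast intro: ty_univ ty_cumul ty_conv ty_pi ty_lam sub_typed_wf sub_typed_up
    | rule eq_pi eq_lam; blast intro: sub_typed_up | rule eq_refl, blast | rule eq_sym, blast
    | rule eq_trans; blast | rule eq_conv; blast | rule eq_cumul, blast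
    | blast intro: eq_comp compstep_sub)+)

definition sub_eq :: "(nat \<Rightarrow> tm) \<Rightarrow> (nat \<Rightarrow> tm) \<Rightarrow> tm list \<Rightarrow> tm list \<Rightarrow> bool" where
  "sub_eq s s' \<Gamma> \<Delta> \<longleftrightarrow> (\<forall>n<length \<Gamma>. \<Delta> \<turnstile> s n \<^bold>\<equiv> s' n \<^bold>: sub s (ren (\<lambda>k. k + Suc n) (\<Gamma> ! n)))"

lemma sub_eq_up:
  assumes s: "sub_eq s s' \<Gamma> \<Delta>" and A: "\<Delta> \<turnstile> sub s A \<^bold>: Univ i"
  shows "sub_eq (up_sub s) (up_sub s') (A # \<Gamma>) (sub s A # \<Delta>)"
  unfolding sub_eq_def
proof (intro allI impI)
  fix n assume n: "n < length (A # \<Gamma>)"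
  show "sub s A # \<Delta> \<turnstile> up_sub s n \<^bold>\<equiv> up_sub s' n \<^bold>: sub (up_sub s) (ren (\<lambda>k. k + Suc n) ((A # \<Gamma>) ! n))"
  proof (cases n)
    case 0
    then show ?thesis using eq_refl[OF var_0[OF A]] by (simp add: sub_ren ren_sub comp_def)
  next
    case (Suc m)
    with n s have "\<Delta> \<turnstile> s m \<^bold>\<equiv> s' m \<^bold>: sub s (ren (\<lambda>k. k + Suc m) (\<Gamma> ! m))"
      by (simp add: sub_eq_def)
    from weaken(2)[OF A this] Suc show ?thesis by (simp add: sub_ren ren_sub comp_def)
  qed
qed

text \<open>Functionality of substitution. It justifies reduction in the arguments of a defined
  constant, whose interpretation is a substitution instance of its body. The induction follows
  typing only; the equality in the conversion rule is dealt with by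
  \<open>typing_sub\<close>.\<close>

lemma typing_sub_eq:
  "\<Gamma> \<turnstile> t \<^bold>: A \<Longrightarrow> sub_typed s \<Gamma> \<Delta> \<Longrightarrow> sub_eq s s' \<Gamma> \<Delta> \<Longrightarrow> \<Delta> \<turnstile> sub s t \<^bold>\<equiv> sub s' t \<^bold>: sub s A"
proof (induction arbitrary: s s' \<Delta> rule: wf_ctx_has_type_judg_eq.inducts(2)[of _ _ _ "\<lambda>_. True" _ "\<lambda>_ _ _ _. True",
  consumes 1])
  case (ty_var \<Gamma> n)
  then show ?case by (simp add: sub_eq_def)
next
  case (ty_con \<Gamma> c i j)
  then show ?case
    by (auto simp: sub_closed[OF cty_closed] sub_typed_def
      intro: eq_refl wf_ctx_has_type_judg_eq.ty_con)
next
  case (ty_univ \<Gamma> i)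
  then show ?case
    by (auto simp: sub_typed_def intro: eq_refl wf_ctx_has_type_judg_eq.ty_univ)
next
  case (ty_cumul \<Gamma> A i)
  then show ?case by (auto intro: eq_cumul)
next
  case (ty_pi \<Gamma> A i B)
  have A: "\<Delta> \<turnstile> sub s A \<^bold>: Univ i" using typing_sub(2)[OF ty_pi.hyps(1) ty_pi.prems(1)] by simp
  from ty_pi.IH(1)[OF ty_pi.prems] ty_pi.IH(2)[OF sub_typed_up[OF ty_pi.prems(1) A] sub_eq_up[OF ty_pi.prems(2) A]] A
  show ?case by (auto intro: eq_pi)
next
  case (ty_lam \<Gamma> A i t B)
  have A: "\<Delta> \<turnstile> sub s A \<^bold>: Univ i" using typing_sub(2)[OF ty_lam.hyps(1) ty_lam.prems(1)] by simp
  from ty_lam.IH(1)[OF ty_lam.prems] ty_lam.IH(2)[OF sub_typed_up[OF ty_lam.prems(1) A] sub_eq_up[OF ty_lam.prems(2) A]] A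
  show ?case by (auto intro: eq_lam)
next
  case (ty_app \<Gamma> f A B a)
  from ty_app.IH(1)[OF ty_app.prems] ty_app.IH(2)[OF ty_app.prems]
  show ?case by (auto simp: sub_inst intro: eq_app)
next
  case (ty_conv \<Gamma> t A B i)
  from ty_conv.IH(1)[OF ty_conv.prems] typing_sub(3)[OF ty_conv.hyps(2) ty_conv.prems(1)]
  show ?case by (auto intro: eq_conv)
qed auto

section \<open>A term language with definitions, and its type checker\<close>

section \<open>Terms with named definitions\<close>

text \<open>Identity types, reflexivity and path induction have constructors of their own. In
  \<open>XJ\<close> the motive binds three variables and the method one, so that instantiating them
  is a substitution instead of a series of beta steps, each of which the checker would have to
  verify.\<close>

datatype 'm xtm = XV nat | XU nat | XK const | XA "'m xtm" "'m xtm" | XL "'m xtm" "'m xtm"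
  | XP "'m xtm" "'m xtm" | XE "'m xtm" "'m xtm" "'m xtm" | XR "'m xtm" "'m xtm"
  | XJ "'m xtm" "'m xtm" "'m xtm" "'m xtm" "'m xtm" "'m xtm" | XM 'm "'m xtm list"

text \<open>
  \<open>At i\<close>: a defined constant unfolds when its argument \<open>i\<close> is literally a reflexivity path, so that
  definitions by path induction compute only where they can.
\<close>

datatype mode = Never | Always | At nat

datatype 'm entry = Entry (tele: "'m xtm list") (mty: "'m xtm") (body: "'m xtm") (unf: mode)

type_synonym 'm sg = "'m \<Rightarrow> 'm entry"

primrec lift :: "nat \<Rightarrow> nat \<Rightarrow> 'm xtm \<Rightarrow> 'm xtm" where
  "lift k d (XV i) = (if i < d then XV i else XV (i + k))"
| "lift k d (XU i) = XU i"
| "lift k d (XK c) = XK c"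
| "lift k d (XA f a) = XA (lift k d f) (lift k d a)"
| "lift k d (XL A b) = XL (lift k d A) (lift k (Suc d) b)"
| "lift k d (XP A b) = XP (lift k d A) (lift k (Suc d) b)"
| "lift k d (XE A x y) = XE (lift k d A) (lift k d x) (lift k d y)"
| "lift k d (XR A x) = XR (lift k d A) (lift k d x)"
| "lift k d (XJ A C c x y p) = XJ (lift k d A) (lift k (Suc (Suc (Suc d))) C) (lift k (Suc d) c)
     (lift k d x) (lift k d y) (lift k d p)"
| "lift k d (XM m as) = XM m (map (lift k d) as)"

text \<open>The head of the list replaces the innermost variable. Each entry is lifted over the
  \<open>d\<close> binders crossed so far, and an index beyond the list has dropped by the length of
  the list.\<close>

fun vsub :: "nat \<Rightarrow> 'm xtm list \<Rightarrow> nat \<Rightarrow> 'm xtm" where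
  "vsub d [] i = XV (i + d)"
| "vsub d (s # ss) 0 = lift d 0 s"
| "vsub d (s # ss) (Suc i) = vsub d ss i"

primrec subst :: "'m xtm list \<Rightarrow> nat \<Rightarrow> 'm xtm \<Rightarrow> 'm xtm" where
  "subst s d (XV i) = (if i < d then XV i else vsub d s (i - d))"
| "subst s d (XU i) = XU i"
| "subst s d (XK c) = XK c"
| "subst s d (XA f a) = XA (subst s d f) (subst s d a)"
| "subst s d (XL A b) = XL (subst s d A) (subst s (Suc d) b)"
| "subst s d (XP A b) = XP (subst s d A) (subst s (Suc d) b)"
| "subst s d (XE A x y) = XE (subst s d A) (subst s d x) (subst s d y)"
| "subst s d (XR A x) = XR (subst s d A) (subst s d x)"
| "subst s d (XJ A C c x y p) = XJ (subst s d A) (subst s (Suc (Suc (Suc d))) C) (subst s (Suc d) c)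
     (subst s d x) (subst s d y) (subst s d p)"
| "subst s d (XM m as) = XM m (map (subst s d) as)"

text \<open>Unfolds one layer only: the substituted body is not expanded again. This keeps the
  function primitive recursive; deeper layers are reached by iterating it.\<close>

primrec expand :: "'m sg \<Rightarrow> 'm xtm \<Rightarrow> 'm xtm" where
  "expand e (XV i) = XV i"
| "expand e (XU i) = XU i"
| "expand e (XK c) = XK c"
| "expand e (XA f a) = XA (expand e f) (expand e a)"
| "expand e (XL A b) = XL (expand e A) (expand e b)"
| "expand e (XP A b) = XP (expand e A) (expand e b)"
| "expand e (XE A x y) = XE (expand e A) (expand e x) (expand e y)"
| "expand e (XR A x) = XR (expand e A) (expand e x)"
| "expand e (XJ A C c x y p) = XJ (expand e A) (expand e C) (expand e c) (expand e x) (expand e y) (expand e p)"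
| "expand e (XM m as) = (case unf (e m) of
     Always \<Rightarrow> if length as = length (tele (e m)) then subst (rev (map (expand e) as)) 0 (body (e m))
       else XM m (map (expand e) as)
   | _ \<Rightarrow> XM m (map (expand e) as))"

fun is_R :: "'m xtm \<Rightarrow> bool" where "is_R (XR A x) = True" | "is_R _ = False"
fun is_U :: "'m xtm \<Rightarrow> bool" where "is_U (XU k) = True" | "is_U _ = False"
fun is_P :: "'m xtm \<Rightarrow> bool" where "is_P (XP A B) = True" | "is_P _ = False"
fun dom_P :: "'m xtm \<Rightarrow> 'm xtm" where "dom_P (XP A B) = A" | "dom_P t = t"
fun cod_P :: "'m xtm \<Rightarrow> 'm xtm" where "cod_P (XP A B) = B" | "cod_P t = t"
fun lev :: "'m xtm \<Rightarrow> nat" where "lev (XU k) = k" | "lev _ = 0"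

fun unfolds :: "mode \<Rightarrow> 'm xtm list \<Rightarrow> bool" where
  "unfolds Never as = False"
| "unfolds Always as = True"
| "unfolds (At i) as = is_R (as ! i)"

text \<open>Besides beta there is the rule of the unit type. It lets \<open>AtInl\<close> and
  \<open>AtInr\<close> compute at \<open>cStar\<close>, as the premise of pushout induction for the
  glue paths requires.\<close>

fun redexA :: "'m xtm \<Rightarrow> 'm xtm \<Rightarrow> 'm xtm option" where
  "redexA (XL A b) a = Some (subst [a] 0 b)"
| "redexA (XA (XA h P) t) a = (if a = XK cStar \<and> h = XK cIndUnit then Some t else None)"
| "redexA _ a = None"

fun redex :: "'m sg \<Rightarrow> 'm xtm \<Rightarrow> 'm xtm option" where
  "redex e (XA f a) = redexA f a"
| "redex e (XJ A C c x y p) = (if p = XR A x \<and> x = y then Some (subst [x] 0 c) else None)"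
| "redex e (XM m as) = (if unfolds (unf (e m)) as \<and> length as = length (tele (e m))
     then Some (subst (rev as) 0 (body (e m))) else None)"
| "redex e _ = None"

definition ctxJ :: "'m xtm \<Rightarrow> 'm xtm list \<Rightarrow> 'm xtm list" where
  "ctxJ A G = XE (lift 2 0 A) (XV 1) (XV 0) # lift 1 0 A # A # G"

text \<open>The type demanded of the method: the motive, moved past the variable of the method, at
  that point, the same point and reflexivity. The path comes first in the list because it has index
  0.\<close>

definition J_refl :: "'m xtm \<Rightarrow> 'm xtm \<Rightarrow> 'm xtm" where
  "J_refl A C = subst [XR (lift 1 0 A) (XV 0), XV 0, XV 0] 0 (lift 1 3 C)"

text \<open>All procedures of the checker are queries to one function, so that a single fixed-point
  induction covers them. In \<open>Chks\<close>, the second list collects the arguments already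
  checked, for substitution into the rest of the telescope. \<open>Rck\<close> checks a reduct
  against the type inferred for its source. \<open>Conv\<close> is tried from cheap to expensive:
  cumulativity, equality up to \<open>expand\<close>, one head step on each side, and only then
  normal forms.\<close>

datatype 'm query =
    Infer "'m xtm list" "'m xtm"
  | Typ "'m xtm list" "'m xtm"
  | Chk "'m xtm list" "'m xtm" "'m xtm"
  | Chks "'m xtm list" "'m xtm list" "'m xtm list" "'m xtm list"
  | Conv "'m xtm list" "'m xtm" "'m xtm"
  | Rck "'m xtm list" "'m xtm" "'m xtm"
  | Step "'m xtm list" "'m xtm"
  | Nf "'m xtm list" "'m xtm"
  | Nfsub "'m xtm list" "'m xtm"
  | NfM "'m xtm list" 'm "'m xtm list" "'m xtm list"

text \<open>
  The checker needs neither confluence nor normalization of the theory: it may diverge, and every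
  reduct (\<open>Rck\<close>) is type-checked again, so that its type is known without subject reduction.
  In \<open>Nfsub\<close> the motive and the method of a path induction on reflexivity stay unevaluated, as the
  redex discards the one and substitutes into the other.
\<close>

context
  fixes e :: "'m sg" and kty :: "const \<Rightarrow> 'm xtm option" and ok :: "'m \<Rightarrow> bool"
begin

partial_function (option) run :: "'m query \<Rightarrow> 'm xtm option" where
 "run q = (case q of
   Infer G t \<Rightarrow> (case t of
       XV k \<Rightarrow> if k < length G then Some (lift (Suc k) 0 (G ! k)) else None
     | XU k \<Rightarrow> Some (XU (Suc k))
     | XK c \<Rightarrow> kty c
     | XA g a \<Rightarrow> do { F \<leftarrow> run (Infer G g);
          P \<leftarrow> (if is_P F then Some F else do { run (Typ G F); run (Nf G F) });
          if is_P P then do { run (Chk G a (dom_P P)); Some (subst [a] 0 (cod_P P)) } else None }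
     | XL A b \<Rightarrow> do { run (Typ G A); B \<leftarrow> run (Infer (A # G) b); Some (XP A B) }
     | XP A B \<Rightarrow> do { u \<leftarrow> run (Typ G A); v \<leftarrow> run (Typ (A # G) B); Some (XU (max (lev u) (lev v))) }
     | XE A x y \<Rightarrow> do { u \<leftarrow> run (Typ G A); run (Chk G x A); run (Chk G y A); Some u }
     | XR A x \<Rightarrow> do { run (Typ G A); run (Chk G x A); Some (XE A x x) }
     | XJ A C c x y p \<Rightarrow> do { run (Typ G A); run (Typ (ctxJ A G) C); run (Chk (A # G) c (J_refl A C));
          run (Chk G x A); run (Chk G y A); run (Chk G p (XE A x y)); Some (subst [p, y, x] 0 C) }
     | XM m as \<Rightarrow> if ok m then do { run (Chks G [] (tele (e m)) as);
       Some (subst (rev as) 0 (mty (e m))) } else None)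
 | Typ G t \<Rightarrow> do { T \<leftarrow> run (Infer G t); if is_U T then Some T else None }
 | Chk G t A \<Rightarrow> do { T \<leftarrow> run (Infer G t); if T = A then Some A else run (Conv G T A) }
 | Chks G s Ts as \<Rightarrow> (case Ts of [] \<Rightarrow> if as = [] then Some (XU 0) else None
     | T # Ts' \<Rightarrow> (case as of [] \<Rightarrow> None
        | a # as' \<Rightarrow> do { run (Chk G a (subst s 0 T)); run (Chks G (a # s) Ts' as') }))
 | Conv G T A \<Rightarrow> if is_U T \<and> is_U A \<and> lev T \<le> lev A then Some A
     else if expand e T = expand e A then Some A
     else do { run (Typ G (expand e T)); run (Typ G (expand e A));
       T' \<leftarrow> run (Step G (expand e T)); A' \<leftarrow> run (Step G (expand e A));
       if expand e T' = expand e A' then Some A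
       else do { T' \<leftarrow> run (Nf G (expand e T)); A' \<leftarrow> run (Nf G (expand e A));
         if T' = A' then Some A else None } }
 | Rck G t u \<Rightarrow> do { T \<leftarrow> run (Infer G t); run (Chk G u T) }
 | Step G t \<Rightarrow> (case redex e t of None \<Rightarrow> Some t | Some u \<Rightarrow> do { run (Rck G t u); Some u })
 | Nf G t \<Rightarrow> (case redex e t of Some u \<Rightarrow> do { run (Rck G t u); run (Nf G u) }
     | None \<Rightarrow> do { t' \<leftarrow> run (Nfsub G t);
         if redex e t' = None then Some t' else do { run (Rck G t t'); run (Nf G t') } })
 | Nfsub G t \<Rightarrow> (case t of
       XV k \<Rightarrow> Some (XV k)
     | XU k \<Rightarrow> Some (XU k)
     | XK k \<Rightarrow> Some (XK k)
     | XA g a \<Rightarrow> do { g' \<leftarrow> run (Nf G g); a' \<leftarrow> run (Nf G a); Some (XA g' a') }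
     | XL A b \<Rightarrow> do { A' \<leftarrow> run (Nf G A); b' \<leftarrow> run (Nf (A # G) b); Some (XL A' b') }
     | XP A b \<Rightarrow> do { A' \<leftarrow> run (Nf G A); b' \<leftarrow> run (Nf (A # G) b); Some (XP A' b') }
     | XE A x y \<Rightarrow> do { A' \<leftarrow> run (Nf G A); x' \<leftarrow> run (Nf G x); y' \<leftarrow> run (Nf G y); Some (XE A' x' y') }
     | XR A x \<Rightarrow> do { A' \<leftarrow> run (Nf G A); x' \<leftarrow> run (Nf G x); Some (XR A' x') }
     | XJ A C c x y p \<Rightarrow> do { A' \<leftarrow> run (Nf G A); x' \<leftarrow> run (Nf G x); y' \<leftarrow> run (Nf G y); p' \<leftarrow> run (Nf G p);
          if is_R p' then Some (XJ A' C c x' y' p')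
          else do { C' \<leftarrow> run (Nf (ctxJ A G) C); c' \<leftarrow> run (Nf (A # G) c); Some (XJ A' C' c' x' y' p') } }
     | XM m as \<Rightarrow> run (NfM G m [] as))
 | NfM G m ds as \<Rightarrow> (case as of [] \<Rightarrow> Some (XM m (rev ds))
     | a # as' \<Rightarrow> do { a' \<leftarrow> run (Nf G a); run (NfM G m (a' # ds) as') }))"

text \<open>One equation for each shape of query and term. Evaluation thus unfolds
  \<open>run\<close> only when that shape is known; the general recursive equation would rewrite
  without end.\<close>

lemmas run_code =
  run.simps[of "Infer G (XV k)" for G k, simplified]
  run.simps[of "Infer G (XU k)" for G k, simplified]
  run.simps[of "Infer G (XK k)" for G k, simplified]
  run.simps[of "Infer G (XA f a)" for G f a, simplified]
  run.simps[of "Infer G (XL f a)" for G f a, simplified]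
  run.simps[of "Infer G (XP f a)" for G f a, simplified]
  run.simps[of "Infer G (XE A x y)" for G A x y, simplified]
  run.simps[of "Infer G (XR A x)" for G A x, simplified]
  run.simps[of "Infer G (XJ A C c x y p)" for G A C c x y p, simplified]
  run.simps[of "Infer G (XM m as)" for G m as, simplified]
  run.simps[of "Typ G t" for G t, simplified]
  run.simps[of "Chk G t A" for G t A, simplified]
  run.simps[of "Chks G s [] as" for G s as, simplified]
  run.simps[of "Chks G s (T # Ts) []" for G s T Ts, simplified]
  run.simps[of "Chks G s (T # Ts) (a # as)" for G s T Ts a as, simplified]
  run.simps[of "Conv G T A" for G T A, simplified]
  run.simps[of "Rck G t u" for G t u, simplified]
  run.simps[of "Step G t" for G t, simplified]
  run.simps[of "Nf G t" for G t, simplified]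
  run.simps[of "Nfsub G (XV k)" for G k, simplified]
  run.simps[of "Nfsub G (XU k)" for G k, simplified]
  run.simps[of "Nfsub G (XK k)" for G k, simplified]
  run.simps[of "Nfsub G (XA f a)" for G f a, simplified]
  run.simps[of "Nfsub G (XL f a)" for G f a, simplified]
  run.simps[of "Nfsub G (XP f a)" for G f a, simplified]
  run.simps[of "Nfsub G (XE A x y)" for G A x y, simplified]
  run.simps[of "Nfsub G (XR A x)" for G A x, simplified]
  run.simps[of "Nfsub G (XJ A C c x y p)" for G A C c x y p, simplified]
  run.simps[of "Nfsub G (XM m as)" for G m as, simplified]
  run.simps[of "NfM G m ds []" for G m ds, simplified]
  run.simps[of "NfM G m ds (a # as)" for G m ds a as, simplified]

end

declare run_code [code]

section \<open>Translation of checker terms into raw terms\<close>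

section \<open>Interpretation\<close>

definition rawId :: "tm \<Rightarrow> tm \<Rightarrow> tm \<Rightarrow> tm" where
  "rawId A x y = App (App (App (Con cId) A) x) y"

definition rawRefl :: "tm \<Rightarrow> tm \<Rightarrow> tm" where
  "rawRefl A x = App (App (Con cRefl) A) x"

text \<open>The abstracted motive exactly as it occurs in \<open>J\<close> of the statement, so that
  translated terms can be compared with those of the statement syntactically.\<close>

definition motJ :: "tm \<Rightarrow> tm \<Rightarrow> tm" where
  "motJ A C = Lam A (Lam (ren Suc A) (Lam (rawId (ren (\<lambda>k. k + 2) A) (Var 1) (Var 0)) C))"

definition rawJ :: "tm \<Rightarrow> tm \<Rightarrow> tm \<Rightarrow> tm \<Rightarrow> tm \<Rightarrow> tm \<Rightarrow> tm" where
  "rawJ A C c x y p = App (App (App (App (App (App (Con cIndId) A) (motJ A C)) (Lam A c)) x) y) p"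

text \<open>
  The junk value \<open>Univ 0\<close> makes the interpretation of a defined constant a function of its arguments
  alone, so that it commutes with every substitution.
\<close>

definition msub :: "tm list \<Rightarrow> nat \<Rightarrow> tm" where
  "msub s n = (if n < length s then s ! n else Univ 0)"

definition lsub :: "tm list \<Rightarrow> nat \<Rightarrow> tm" where
  "lsub s n = (if n < length s then s ! n else Var (n - length s))"

primrec den :: "('m \<Rightarrow> tm) \<Rightarrow> 'm xtm \<Rightarrow> tm" where
  "den D (XV i) = Var i"
| "den D (XU i) = Univ i"
| "den D (XK c) = Con c"
| "den D (XA f a) = App (den D f) (den D a)"
| "den D (XL A b) = Lam (den D A) (den D b)"
| "den D (XP A b) = Pi (den D A) (den D b)"
| "den D (XE A x y) = rawId (den D A) (den D x) (den D y)"
| "den D (XR A x) = rawRefl (den D A) (den D x)"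
| "den D (XJ A C c x y p) = rawJ (den D A) (den D C) (den D c) (den D x) (den D y) (den D p)"
| "den D (XM m as) = sub (msub (rev (map (den D) as))) (D m)"

definition usub :: "nat \<Rightarrow> (nat \<Rightarrow> tm) \<Rightarrow> nat \<Rightarrow> tm" where
  "usub d s n = (if n < d then Var n else ren (\<lambda>k. k + d) (s (n - d)))"

lemma up_usub: "up_sub (usub d s) = usub (Suc d) s"
  by (auto simp: fun_eq_iff usub_def ren_ren comp_def split: nat.split)

lemma usub_0: "usub 0 s = s"
  by (auto simp: fun_eq_iff usub_def ren_id)

definition lren :: "nat \<Rightarrow> nat \<Rightarrow> nat \<Rightarrow> nat" where
  "lren k d i = (if i < d then i else i + k)"

lemma up_lren: "up_ren (lren k d) = lren k (Suc d)"
  by (auto simp: fun_eq_iff lren_def split: nat.split)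

lemma up3_lren: "up_ren (up_ren (up_ren (lren k d))) = lren k (Suc (Suc (Suc d)))"
  and up3_usub: "up_sub (up_sub (up_sub (usub d s))) = usub (Suc (Suc (Suc d))) s"
  by (simp_all only: up_lren up_usub)

lemma sub_rawId: "sub s (rawId A x y) = rawId (sub s A) (sub s x) (sub s y)"
  and sub_rawRefl: "sub s (rawRefl A x) = rawRefl (sub s A) (sub s x)"
  by (simp_all add: rawId_def rawRefl_def)

lemma sub_motJ: "sub s (motJ A C) = motJ (sub s A) (sub (up_sub (up_sub (up_sub s))) C)"
  by (simp add: motJ_def sub_rawId sub_ren ren_sub comp_def ren_ren)

lemma sub_rawJ: "sub s (rawJ A C c x y p) =
    rawJ (sub s A) (sub (up_sub (up_sub (up_sub s))) C) (sub (up_sub s) c) (sub s x) (sub s y) (sub s p)"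
  by (simp add: rawJ_def sub_motJ)

lemma ren_rawId: "ren r (rawId A x y) = rawId (ren r A) (ren r x) (ren r y)"
  and ren_rawRefl: "ren r (rawRefl A x) = rawRefl (ren r A) (ren r x)"
  by (simp_all add: rawId_def rawRefl_def)

lemma ren_rawJ: "ren r (rawJ A C c x y p) =
    rawJ (ren r A) (ren (up_ren (up_ren (up_ren r))) C) (ren (up_ren r) c) (ren r x) (ren r y) (ren r p)"
  by (simp add: rawJ_def motJ_def ren_rawId ren_ren comp_def)

text \<open>Variables beyond the list are sent to a closed term, so a further substitution acts on
  the listed terms only.\<close>

lemma sub_msub: "sub s (sub (msub ts) t) = sub (msub (map (sub s) ts)) t"
  unfolding sub_sub by (rule arg_cong[where f = "\<lambda>s. sub s t"]) (auto simp: fun_eq_iff msub_def)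

lemma ren_msub: "ren r (sub (msub ts) t) = sub (msub (map (ren r) ts)) t"
  unfolding ren_sub by (rule arg_cong[where f = "\<lambda>s. sub s t"]) (auto simp: fun_eq_iff msub_def)

lemma den_lift: "den D (lift k d t) = ren (lren k d) (den D t)"
proof (induction t arbitrary: d)
  case (XM m as)
  then have "map (den D) (map (lift k d) as) = map (ren (lren k d)) (map (den D) as)" by simp
  then show ?case by (simp only: lift.simps den.simps rev_map[symmetric] ren_msub)
qed (simp_all add: up_lren up3_lren ren_rawId ren_rawRefl ren_rawJ, simp add: lren_def)

lemma den_vsub: "den D (vsub d s i) = ren (\<lambda>k. k + d) (lsub (map (den D) s) i)"
proof (induction d s i rule: vsub.induct)
  case (2 d s ss)
  have "lren d 0 = (\<lambda>k. k + d)" by (simp add: fun_eq_iff lren_def)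
  then show ?case by (simp add: lsub_def den_lift)
qed (auto simp: lsub_def)

lemma den_subst: "den D (subst s d t) = sub (usub d (lsub (map (den D) s))) (den D t)"
proof (induction t arbitrary: d)
  case (XM m as)
  let ?s = "usub d (lsub (map (den D) s))"
  from XM have "map (den D) (map (subst s d) as) = map (sub ?s) (map (den D) as)" by simp
  then show ?case by (simp only: subst.simps den.simps rev_map[symmetric] sub_msub)
qed (simp_all add: up_usub up3_usub sub_rawId sub_rawRefl sub_rawJ, simp add: usub_def den_vsub)

lemma den_subst_0: "den D (subst s 0 t) = sub (lsub (map (den D) s)) (den D t)"
  by (simp add: den_subst usub_0)

lemma inst_lsub: "inst t a = sub (lsub [a]) t"
proof -
  have "case_nat a Var = lsub [a]"
    by (auto simp: fun_eq_iff lsub_def split: nat.split)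
  then show ?thesis by (simp add: inst_def)
qed

lemma den_subst_1: "den D (subst [a] 0 t) = inst (den D t) (den D a)"
  by (simp add: den_subst_0 inst_lsub)

lemma msub_lsub: "scoped (length s) t \<Longrightarrow> sub (msub s) t = sub (lsub s) t"
  by (erule sub_cong_scoped) (simp add: msub_def lsub_def)

section \<open>Typing, congruence and computation of path induction in raw syntax\<close>

section \<open>Derived rules for identity types\<close>

lemma cumul_le: "i \<le> j \<Longrightarrow> \<Gamma> \<turnstile> A \<^bold>: Univ i \<Longrightarrow> \<Gamma> \<turnstile> A \<^bold>: Univ j"
  by (induction j) (auto simp: le_Suc_eq intro: ty_cumul)

lemma eq_cumul_le: "i \<le> j \<Longrightarrow> \<Gamma> \<turnstile> A \<^bold>\<equiv> B \<^bold>: Univ i \<Longrightarrow> \<Gamma> \<turnstile> A \<^bold>\<equiv> B \<^bold>: Univ j"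
  by (induction j) (auto simp: le_Suc_eq intro: eq_cumul)

lemma sub_typed_id: "wf_ctx \<Gamma> \<Longrightarrow> sub_typed Var \<Gamma> \<Gamma>"
  using ty_var by (simp add: sub_typed_def sub_Var)

lemma sub_typed_extend:
  assumes "sub_typed s \<Gamma> \<Delta>" and "\<Delta> \<turnstile> a \<^bold>: sub s A"
  shows "sub_typed (case_nat a s) (A # \<Gamma>) \<Delta>"
  unfolding sub_typed_def
proof (intro conjI allI impI)
  show "wf_ctx \<Delta>" using assms(1) by (rule sub_typed_wf)
  fix n assume "n < length (A # \<Gamma>)"
  then show "\<Delta> \<turnstile> case_nat a s n \<^bold>: sub (case_nat a s) (ren (\<lambda>k. k + Suc n) ((A # \<Gamma>) ! n))"
    using assms by (cases n) (auto simp: sub_typed_def sub_ren comp_def)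
qed

lemma sub_typed_inst: "\<Gamma> \<turnstile> a \<^bold>: A \<Longrightarrow> sub_typed (case_nat a Var) (A # \<Gamma>) \<Gamma>"
  by (intro sub_typed_extend sub_typed_id) (auto simp: sub_Var dest: has_type_wf)

lemma sub_eq_extend:
  assumes "sub_eq s s' \<Gamma> \<Delta>" and "\<Delta> \<turnstile> a \<^bold>\<equiv> a' \<^bold>: sub s A"
  shows "sub_eq (case_nat a s) (case_nat a' s') (A # \<Gamma>) \<Delta>"
  unfolding sub_eq_def
proof (intro allI impI)
  fix n assume "n < length (A # \<Gamma>)"
  then show "\<Delta> \<turnstile> case_nat a s n \<^bold>\<equiv> case_nat a' s' n \<^bold>: sub (case_nat a s) (ren (\<lambda>k. k + Suc n) ((A # \<Gamma>) ! n))"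
    using assms by (cases n) (auto simp: sub_eq_def sub_ren comp_def)
qed

lemma cId_type: "wf_ctx \<Gamma> \<Longrightarrow> \<Gamma> \<turnstile> Con cId \<^bold>: Pi (Univ i) (Pi (Var 0) (Pi (Var 1) (Univ i)))"
  using ty_con[of \<Gamma> cId i i] by (simp add: pi_def arr_def univ_def)

lemma cRefl_type: "wf_ctx \<Gamma> \<Longrightarrow> \<Gamma> \<turnstile> Con cRefl \<^bold>: Pi (Univ i) (Pi (Var 0) (rawId (Var 1) (Var 0) (Var 0)))"
  using ty_con[of \<Gamma> cRefl i i] by (simp add: pi_def univ_def idt_def app_def con_def rawId_def)

lemma cIndId_type: "wf_ctx \<Gamma> \<Longrightarrow> \<Gamma> \<turnstile> Con cIndId \<^bold>:
   Pi (Univ i) (Pi (Pi (Var 0) (Pi (Var 1) (Pi (rawId (Var 2) (Var 1) (Var 0)) (Univ j))))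
     (Pi (Pi (Var 1) (App (App (App (Var 1) (Var 0)) (Var 0)) (rawRefl (Var 2) (Var 0))))
       (Pi (Var 2) (Pi (Var 3) (Pi (rawId (Var 4) (Var 1) (Var 0))
         (App (App (App (Var 4) (Var 2)) (Var 1)) (Var 0)))))))"
  using ty_con[of \<Gamma> cIndId i j]
  by (simp add: pi_def arr_def univ_def idt_def rfl_def app_def con_def rawId_def rawRefl_def numeral_eq_Suc)

lemma sub_Var_comp: "sub (\<lambda>n. Var (r n)) t = ren r t"
  by (simp add: ren_eq_sub)

lemmas inst_simps = sub_Var_comp ren_id inst_def sub_ren ren_sub ren_ren comp_def sub_Var sub_rawId sub_rawRefl ren_rawId ren_rawRefl

lemma rawId_eq:
  assumes A: "\<Gamma> \<turnstile> A \<^bold>\<equiv> A' \<^bold>: Univ i" and x: "\<Gamma> \<turnstile> x \<^bold>\<equiv> x' \<^bold>: A" and y: "\<Gamma> \<turnstile> y \<^bold>\<equiv> y' \<^bold>: A"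
    and wf: "wf_ctx \<Gamma>"
  shows "\<Gamma> \<turnstile> rawId A x y \<^bold>\<equiv> rawId A' x' y' \<^bold>: Univ i"
proof -
  have 1: "\<Gamma> \<turnstile> App (Con cId) A \<^bold>\<equiv> App (Con cId) A' \<^bold>: Pi A (Pi (ren Suc A) (Univ i))"
    using eq_app[OF eq_refl[OF cId_type[OF wf]] A] by (simp add: inst_simps)
  have 2: "\<Gamma> \<turnstile> App (App (Con cId) A) x \<^bold>\<equiv> App (App (Con cId) A') x' \<^bold>: Pi A (Univ i)"
    using eq_app[OF 1 x] by (simp add: inst_simps)
  show ?thesis
    using eq_app[OF 2 y] by (simp add: inst_simps rawId_def)
qed

lemma rawId_type:
  assumes A: "\<Gamma> \<turnstile> A \<^bold>: Univ i" and x: "\<Gamma> \<turnstile> x \<^bold>: A" and y: "\<Gamma> \<turnstile> y \<^bold>: A"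
  shows "\<Gamma> \<turnstile> rawId A x y \<^bold>: Univ i"
proof -
  have 1: "\<Gamma> \<turnstile> App (Con cId) A \<^bold>: Pi A (Pi (ren Suc A) (Univ i))"
    using ty_app[OF cId_type[OF has_type_wf[OF A]] A] by (simp add: inst_simps)
  have 2: "\<Gamma> \<turnstile> App (App (Con cId) A) x \<^bold>: Pi A (Univ i)"
    using ty_app[OF 1 x] by (simp add: inst_simps)
  show ?thesis
    using ty_app[OF 2 y] by (simp add: inst_simps rawId_def)
qed

lemma rawRefl_eq:
  assumes A: "\<Gamma> \<turnstile> A \<^bold>\<equiv> A' \<^bold>: Univ i" and x: "\<Gamma> \<turnstile> x \<^bold>\<equiv> x' \<^bold>: A" and wf: "wf_ctx \<Gamma>"
  shows "\<Gamma> \<turnstile> rawRefl A x \<^bold>\<equiv> rawRefl A' x' \<^bold>: rawId A x x"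
proof -
  have 1: "\<Gamma> \<turnstile> App (Con cRefl) A \<^bold>\<equiv> App (Con cRefl) A' \<^bold>: Pi A (rawId (ren Suc A) (Var 0) (Var 0))"
    using eq_app[OF eq_refl[OF cRefl_type[OF wf]] A] by (simp add: inst_simps)
  show ?thesis
    using eq_app[OF 1 x] by (simp add: inst_simps rawRefl_def)
qed

lemma rawRefl_type:
  assumes A: "\<Gamma> \<turnstile> A \<^bold>: Univ i" and x: "\<Gamma> \<turnstile> x \<^bold>: A"
  shows "\<Gamma> \<turnstile> rawRefl A x \<^bold>: rawId A x x"
proof -
  have 1: "\<Gamma> \<turnstile> App (Con cRefl) A \<^bold>: Pi A (rawId (ren Suc A) (Var 0) (Var 0))"
    using ty_app[OF cRefl_type[OF has_type_wf[OF A]] A] by (simp add: inst_simps)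
  show ?thesis
    using ty_app[OF 1 x] by (simp add: inst_simps rawRefl_def)
qed

definition ctx3 :: "tm \<Rightarrow> tm list \<Rightarrow> tm list" where
  "ctx3 A \<Gamma> = rawId (ren (\<lambda>k. k + 2) A) (Var 1) (Var 0) # ren Suc A # A # \<Gamma>"

lemma ctx3_types:
  assumes A: "\<Gamma> \<turnstile> A \<^bold>: Univ i"
  shows "A # \<Gamma> \<turnstile> ren Suc A \<^bold>: Univ i"
    and "ren Suc A # A # \<Gamma> \<turnstile> rawId (ren (\<lambda>k. k + 2) A) (Var 1) (Var 0) \<^bold>: Univ i"
    and "wf_ctx (ctx3 A \<Gamma>)"
proof -
  show 1: "A # \<Gamma> \<turnstile> ren Suc A \<^bold>: Univ i" using weaken(1)[OF A A] by simp
  have r: "ren (\<lambda>k. k + 2) A = ren Suc (ren Suc A)" by (simp add: ren_ren comp_def numeral_eq_Suc)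
  have 2: "ren Suc A # A # \<Gamma> \<turnstile> ren Suc (ren Suc A) \<^bold>: Univ i" using weaken(1)[OF 1 1] by simp
  have "ren Suc A # A # \<Gamma> \<turnstile> Var 1 \<^bold>: ren Suc (ren Suc A)"
    using weaken(1)[OF 1 var_0[OF A]] by simp
  then show 3: "ren Suc A # A # \<Gamma> \<turnstile> rawId (ren (\<lambda>k. k + 2) A) (Var 1) (Var 0) \<^bold>: Univ i"
    unfolding r by (intro rawId_type[OF 2] var_0[OF 1])
  then show "wf_ctx (ctx3 A \<Gamma>)" unfolding ctx3_def by (blast intro: ctx_extend has_type_wf)
qed

lemma motJ_type:
  assumes A: "\<Gamma> \<turnstile> A \<^bold>: Univ i" and C: "ctx3 A \<Gamma> \<turnstile> C \<^bold>: Univ j"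
  shows "\<Gamma> \<turnstile> motJ A C \<^bold>: Pi A (Pi (ren Suc A) (Pi (rawId (ren (\<lambda>k. k + 2) A) (Var 1) (Var 0)) (Univ j)))"
  unfolding motJ_def
  by (rule ty_lam[OF A ty_lam[OF ctx3_types(1)[OF A] ty_lam[OF ctx3_types(2)[OF A] C[unfolded ctx3_def]]]])

text \<open>Three beta steps, one for each abstraction of the motive; \<open>C1\<close> and
  \<open>C2\<close> are its body after one and two of them.\<close>

lemma motJ_app:
  assumes A: "\<Gamma> \<turnstile> A \<^bold>: Univ i" and C: "ctx3 A \<Gamma> \<turnstile> C \<^bold>: Univ j"
    and x: "\<Gamma> \<turnstile> x \<^bold>: A" and y: "\<Gamma> \<turnstile> y \<^bold>: A" and p: "\<Gamma> \<turnstile> p \<^bold>: rawId A x y"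
  shows "\<Gamma> \<turnstile> App (App (App (motJ A C) x) y) p \<^bold>\<equiv> sub (lsub [p, y, x]) C \<^bold>: Univ j"
proof -
  let ?I = "rawId (ren (\<lambda>k. k + 2) A) (Var 1) (Var 0)"
  let ?s = "case_nat x Var"
  define C1 where "C1 = sub (up_sub (up_sub ?s)) C"
  define C2 where "C2 = sub (up_sub (case_nat y Var)) C1"
  have L2: "A # \<Gamma> \<turnstile> Lam (ren Suc A) (Lam ?I C) \<^bold>: Pi (ren Suc A) (Pi ?I (Univ j))"
    by (rule ty_lam[OF ctx3_types(1)[OF A] ty_lam[OF ctx3_types(2)[OF A] C[unfolded ctx3_def]]])
  have 1: "\<Gamma> \<turnstile> App (motJ A C) x \<^bold>\<equiv> Lam A (Lam (rawId (ren Suc A) (ren Suc x) (Var 0)) C1)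
      \<^bold>: Pi A (Pi (rawId (ren Suc A) (ren Suc x) (Var 0)) (Univ j))"
    using eq_beta[OF A L2 x] by (simp add: inst_simps motJ_def C1_def numeral_eq_Suc)
  have s1: "sub_typed ?s (A # \<Gamma>) \<Gamma>" using x by (rule sub_typed_inst)
  have s2: "sub_typed (up_sub ?s) (ren Suc A # A # \<Gamma>) (A # \<Gamma>)"
    using sub_typed_up[OF s1, of "ren Suc A" i] A by (simp add: inst_simps)
  have I1: "A # \<Gamma> \<turnstile> rawId (ren Suc A) (ren Suc x) (Var 0) \<^bold>: Univ i"
    using typing_sub(2)[OF ctx3_types(2)[OF A] s2] by (simp add: inst_simps numeral_eq_Suc)
  have s3: "sub_typed (up_sub (up_sub ?s)) (ctx3 A \<Gamma>) (rawId (ren Suc A) (ren Suc x) (Var 0) # A # \<Gamma>)"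
    using sub_typed_up[OF s2, of ?I i] I1 by (simp add: inst_simps numeral_eq_Suc ctx3_def)
  have C1: "rawId (ren Suc A) (ren Suc x) (Var 0) # A # \<Gamma> \<turnstile> C1 \<^bold>: Univ j"
    unfolding C1_def using typing_sub(2)[OF C s3] by simp
  have L1: "A # \<Gamma> \<turnstile> Lam (rawId (ren Suc A) (ren Suc x) (Var 0)) C1 \<^bold>: Pi (rawId (ren Suc A) (ren Suc x) (Var 0)) (Univ j)"
    by (rule ty_lam[OF I1 C1])
  have 2: "\<Gamma> \<turnstile> App (Lam A (Lam (rawId (ren Suc A) (ren Suc x) (Var 0)) C1)) y \<^bold>\<equiv> Lam (rawId A x y) C2
      \<^bold>: Pi (rawId A x y) (Univ j)"
    using eq_beta[OF A L1 y] by (simp add: inst_simps C2_def)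
  have t1: "sub_typed (case_nat y Var) (A # \<Gamma>) \<Gamma>" using y by (rule sub_typed_inst)
  have I0: "\<Gamma> \<turnstile> rawId A x y \<^bold>: Univ i" by (rule rawId_type[OF A x y])
  have t2: "sub_typed (up_sub (case_nat y Var)) (rawId (ren Suc A) (ren Suc x) (Var 0) # A # \<Gamma>) (rawId A x y # \<Gamma>)"
    using sub_typed_up[OF t1, of "rawId (ren Suc A) (ren Suc x) (Var 0)" i] I0 by (simp add: inst_simps)
  have C2: "rawId A x y # \<Gamma> \<turnstile> C2 \<^bold>: Univ j"
    unfolding C2_def using typing_sub(2)[OF C1 t2] by simp
  \<comment> \<open>Three successive single instantiations amount to one simultaneous substitution.
    The list is in the order of the indices, with the innermost variable, the path, at its
    head.\<close>
  have C3: "inst C2 p = sub (lsub [p, y, x]) C"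
    unfolding C2_def C1_def inst_def sub_sub
    by (rule arg_cong[where f = "\<lambda>s. sub s C"])
      (auto simp: fun_eq_iff lsub_def inst_simps split: nat.split)
  have 3: "\<Gamma> \<turnstile> App (Lam (rawId A x y) C2) p \<^bold>\<equiv> sub (lsub [p, y, x]) C \<^bold>: Univ j"
    using eq_beta[OF I0 C2 p] by (simp add: C3) (simp add: inst_simps)
  have e1: "\<Gamma> \<turnstile> App (App (motJ A C) x) y \<^bold>\<equiv> Lam (rawId A x y) C2 \<^bold>: Pi (rawId A x y) (Univ j)"
    using eq_trans[OF _ 2] eq_app[OF 1 eq_refl[OF y]] by (simp add: inst_simps)
  have "\<Gamma> \<turnstile> App (App (App (motJ A C) x) y) p \<^bold>\<equiv> App (Lam (rawId A x y) C2) p \<^bold>: Univ j"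
    using eq_app[OF e1 eq_refl[OF p]] by (simp add: inst_simps)
  then show ?thesis using 3 by (rule eq_trans)
qed

definition reflJ :: "tm \<Rightarrow> tm \<Rightarrow> tm" where
  "reflJ A C = sub (lsub [rawRefl (ren Suc A) (Var 0), Var 0, Var 0]) (ren (lren 1 3) C)"

lemma ren_Suc_motJ: "ren Suc (motJ A C) = motJ (ren Suc A) (ren (lren 1 3) C)"
proof -
  have "up_ren (up_ren (up_ren Suc)) = lren 1 3"
    by (auto simp: fun_eq_iff lren_def split: nat.split)
  then show ?thesis by (simp add: motJ_def ren_rawId ren_ren comp_def)
qed

lemma ctx3_weaken:
  assumes A: "\<Gamma> \<turnstile> A \<^bold>: Univ i" and C: "ctx3 A \<Gamma> \<turnstile> C \<^bold>: Univ j"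
  shows "ctx3 (ren Suc A) (A # \<Gamma>) \<turnstile> ren (lren 1 3) C \<^bold>: Univ j"
proof -
  have up: "up_ren (up_ren (up_ren Suc)) = lren 1 3"
    by (auto simp: fun_eq_iff lren_def split: nat.split)
  have 0: "ren_typed Suc \<Gamma> (A # \<Gamma>)"
    using ctx_extend[OF has_type_wf[OF A] A] by (simp add: ren_typed_def ren_ren comp_def)
  note A1 = ctx3_types(1)[OF A]
  have 1: "ren_typed (up_ren Suc) (A # \<Gamma>) (ren Suc A # A # \<Gamma>)"
    by (rule ren_typed_up[OF 0 A1])
  have 2: "ren_typed (up_ren (up_ren Suc)) (ren Suc A # A # \<Gamma>) (ren Suc (ren Suc A) # ren Suc A # A # \<Gamma>)"
    using ren_typed_up[OF 1, of "ren Suc A" i] ctx3_types(1)[OF A1] by (simp add: ren_ren comp_def)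
  let ?I = "rawId (ren (\<lambda>k. k + 2) A) (Var 1) (Var 0)"
  have I: "ren (up_ren (up_ren Suc)) ?I = rawId (ren (\<lambda>k. k + 2) (ren Suc A)) (Var 1) (Var 0)"
    by (simp add: ren_rawId ren_ren comp_def)
  have "ren_typed (up_ren (up_ren (up_ren Suc))) (?I # ren Suc A # A # \<Gamma>)
      (ren (up_ren (up_ren Suc)) ?I # ren Suc (ren Suc A) # ren Suc A # A # \<Gamma>)"
    by (rule ren_typed_up[OF 2]) (use ctx3_types(2)[OF A1] in \<open>simp only: I\<close>)
  then have 3: "ren_typed (lren 1 3) (ctx3 A \<Gamma>) (ctx3 (ren Suc A) (A # \<Gamma>))"
    unfolding up I ctx3_def .
  from typing_ren(2)[OF C 3] show ?thesis by simp
qed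

lemma motJ_refl_app:
  assumes A: "\<Gamma> \<turnstile> A \<^bold>: Univ i" and C: "ctx3 A \<Gamma> \<turnstile> C \<^bold>: Univ j"
  shows "A # \<Gamma> \<turnstile> App (App (App (ren Suc (motJ A C)) (Var 0)) (Var 0)) (rawRefl (ren Suc A) (Var 0))
    \<^bold>\<equiv> reflJ A C \<^bold>: Univ j"
  unfolding ren_Suc_motJ reflJ_def
  by (rule motJ_app[OF ctx3_types(1)[OF A] ctx3_weaken[OF A C] var_0[OF A] var_0[OF A]
        rawRefl_type[OF ctx3_types(1)[OF A] var_0[OF A]]])

lemma motJ_eq:
  assumes A: "\<Gamma> \<turnstile> A \<^bold>: Univ i" and A': "\<Gamma> \<turnstile> A \<^bold>\<equiv> A' \<^bold>: Univ i"
    and C: "ctx3 A \<Gamma> \<turnstile> C \<^bold>\<equiv> C' \<^bold>: Univ j"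
  shows "\<Gamma> \<turnstile> motJ A C \<^bold>\<equiv> motJ A' C'
    \<^bold>: Pi A (Pi (ren Suc A) (Pi (rawId (ren (\<lambda>k. k + 2) A) (Var 1) (Var 0)) (Univ j)))"
proof -
  note A1 = ctx3_types(1)[OF A]
  have r: "ren (\<lambda>k. k + 2) A = ren Suc (ren Suc A)" for A by (simp add: ren_ren comp_def numeral_eq_Suc)
  have e1: "A # \<Gamma> \<turnstile> ren Suc A \<^bold>\<equiv> ren Suc A' \<^bold>: Univ i" using weaken(2)[OF A A'] by simp
  have e2: "ren Suc A # A # \<Gamma> \<turnstile> ren Suc (ren Suc A) \<^bold>\<equiv> ren Suc (ren Suc A') \<^bold>: Univ i"
    using weaken(2)[OF A1 e1] by simp
  have "ren Suc A # A # \<Gamma> \<turnstile> Var 1 \<^bold>: ren Suc (ren Suc A)"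
    using weaken(1)[OF A1 var_0[OF A]] by simp
  then have e3: "ren Suc A # A # \<Gamma> \<turnstile> rawId (ren (\<lambda>k. k + 2) A) (Var 1) (Var 0) \<^bold>\<equiv>
      rawId (ren (\<lambda>k. k + 2) A') (Var 1) (Var 0) \<^bold>: Univ i"
    unfolding r by (intro rawId_eq[OF e2] eq_refl var_0[OF A1] has_type_wf)
  show ?thesis
    unfolding motJ_def
    by (rule eq_lam[OF A A' eq_lam[OF A1 e1 eq_lam[OF ctx3_types(2)[OF A] e3 C[unfolded ctx3_def]]]])
qed

text \<open>Converts between the type that the checker demands of the method, an instantiated
  motive, and the type that \<open>cIndId\<close> demands, an applied motive. The level
  \<open>max i j\<close> appears because \<open>eq_pi\<close> wants domain and codomain in one
  universe.\<close>

lemma rawJ_fun_type: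
  assumes A: "\<Gamma> \<turnstile> A \<^bold>: Univ i" and C: "ctx3 A \<Gamma> \<turnstile> C \<^bold>: Univ j"
  shows "\<Gamma> \<turnstile> Pi A (reflJ A C) \<^bold>\<equiv>
    Pi A (App (App (App (ren Suc (motJ A C)) (Var 0)) (Var 0)) (rawRefl (ren Suc A) (Var 0))) \<^bold>: Univ (max i j)"
proof -
  have A': "\<Gamma> \<turnstile> A \<^bold>: Univ (max i j)" using cumul_le[OF _ A] by simp
  show ?thesis
    by (rule eq_pi[OF A' eq_refl[OF A']]) (use eq_cumul_le[OF _ eq_sym[OF motJ_refl_app[OF A C]]] in
      simp)
qed

text \<open>\<open>J_type1\<close> to \<open>J_type5\<close> are the types of \<open>cIndId\<close>
  after one to five arguments, with all instantiations carried out.\<close>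

abbreviation "J_type1 A j \<equiv>
  Pi (Pi A (Pi (ren Suc A) (Pi (rawId (ren (\<lambda>k. k + 2) A) (Var 1) (Var 0)) (Univ j))))
  (Pi (Pi (ren Suc A) (App (App (App (Var 1) (Var 0)) (Var 0)) (rawRefl (ren (\<lambda>k. k + 2) A) (Var 0))))
  (Pi (ren (\<lambda>k. k + 2) A) (Pi (ren (\<lambda>k. k + 3) A) (Pi (rawId (ren (\<lambda>k. k + 4) A) (Var 1) (Var 0))
  (App (App (App (Var 4) (Var 2)) (Var 1)) (Var 0))))))"

abbreviation "J_type2 A M \<equiv>
  Pi (Pi A (App (App (App (ren Suc M) (Var 0)) (Var 0)) (rawRefl (ren Suc A) (Var 0))))
  (Pi (ren Suc A) (Pi (ren (\<lambda>k. k + 2) A) (Pi (rawId (ren (\<lambda>k. k + 3) A) (Var 1) (Var 0))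
  (App (App (App (ren (\<lambda>k. k + 4) M) (Var 2)) (Var 1)) (Var 0)))))"

abbreviation "J_type3 A M \<equiv>
  Pi A (Pi (ren Suc A) (Pi (rawId (ren (\<lambda>k. k + 2) A) (Var 1) (Var 0))
  (App (App (App (ren (\<lambda>k. k + 3) M) (Var 2)) (Var 1)) (Var 0))))"

abbreviation "J_type4 A M x \<equiv>
  Pi A (Pi (rawId (ren Suc A) (ren Suc x) (Var 0)) (App (App (App (ren (\<lambda>k. k + 2) M) (ren (\<lambda>k. k + 2) x)) (Var 1)) (Var 0)))"

abbreviation "J_type5 A M x y \<equiv>
  Pi (rawId A x y) (App (App (App (ren Suc M) (ren Suc x)) (ren Suc y)) (Var 0))"

text \<open>The left-hand sides are assumed to be typed in addition to the equalities: typing of the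
  two sides is not read off from a judgmental equality anywhere in this development.\<close>

lemma rawJ_eq:
  assumes A: "\<Gamma> \<turnstile> A \<^bold>: Univ i" and A': "\<Gamma> \<turnstile> A \<^bold>\<equiv> A' \<^bold>: Univ i"
    and C: "ctx3 A \<Gamma> \<turnstile> C \<^bold>: Univ j" and C': "ctx3 A \<Gamma> \<turnstile> C \<^bold>\<equiv> C' \<^bold>: Univ j"
    and c': "A # \<Gamma> \<turnstile> c \<^bold>\<equiv> c' \<^bold>: reflJ A C"
    and x: "\<Gamma> \<turnstile> x \<^bold>: A" and x': "\<Gamma> \<turnstile> x \<^bold>\<equiv> x' \<^bold>: A"
    and y: "\<Gamma> \<turnstile> y \<^bold>: A" and y': "\<Gamma> \<turnstile> y \<^bold>\<equiv> y' \<^bold>: A"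
    and p: "\<Gamma> \<turnstile> p \<^bold>: rawId A x y" and p': "\<Gamma> \<turnstile> p \<^bold>\<equiv> p' \<^bold>: rawId A x y"
  shows "\<Gamma> \<turnstile> rawJ A C c x y p \<^bold>\<equiv> rawJ A' C' c' x' y' p' \<^bold>: sub (lsub [p, y, x]) C"
proof -
  note wf = has_type_wf[OF A]
  let ?M = "motJ A C"
  have 1: "\<Gamma> \<turnstile> App (Con cIndId) A \<^bold>\<equiv> App (Con cIndId) A' \<^bold>:
     J_type1 A j"
    using eq_app[OF eq_refl[OF cIndId_type[OF wf, of i j]] A'] by (simp add: inst_simps numeral_eq_Suc)
  have 2: "\<Gamma> \<turnstile> App (App (Con cIndId) A) ?M \<^bold>\<equiv> App (App (Con cIndId) A') (motJ A' C') \<^bold>: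
     J_type2 A ?M"
    using eq_app[OF 1 motJ_eq[OF A A' C']] by (simp add: inst_simps numeral_eq_Suc)
  have c1: "\<Gamma> \<turnstile> Lam A c \<^bold>\<equiv> Lam A' c' \<^bold>: Pi A (App (App (App (ren Suc ?M) (Var 0)) (Var 0)) (rawRefl (ren Suc A) (Var 0)))"
    by (rule eq_conv[OF eq_lam[OF A A' c'] rawJ_fun_type[OF A C]])
  have 3: "\<Gamma> \<turnstile> App (App (App (Con cIndId) A) ?M) (Lam A c) \<^bold>\<equiv> App (App (App (Con cIndId) A') (motJ A' C')) (Lam A' c') \<^bold>:
       J_type3 A ?M"
    using eq_app[OF 2 c1] by (simp add: inst_simps numeral_eq_Suc)
  have 4: "\<Gamma> \<turnstile> App (App (App (App (Con cIndId) A) ?M) (Lam A c)) x \<^bold>\<equiv>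
       App (App (App (App (Con cIndId) A') (motJ A' C')) (Lam A' c')) x' \<^bold>:
       J_type4 A ?M x"
    using eq_app[OF 3 x'] by (simp add: inst_simps numeral_eq_Suc)
  have 5: "\<Gamma> \<turnstile> App (App (App (App (App (Con cIndId) A) ?M) (Lam A c)) x) y \<^bold>\<equiv>
       App (App (App (App (App (Con cIndId) A') (motJ A' C')) (Lam A' c')) x') y' \<^bold>:
       J_type5 A ?M x y"
    using eq_app[OF 4 y'] by (simp add: inst_simps numeral_eq_Suc)
  have 6: "\<Gamma> \<turnstile> rawJ A C c x y p \<^bold>\<equiv> rawJ A' C' c' x' y' p' \<^bold>: App (App (App ?M x) y) p"
    unfolding rawJ_def using eq_app[OF 5 p'] by (simp add: inst_simps numeral_eq_Suc)
  then show ?thesis using motJ_app[OF A C x y p] by (rule eq_conv)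
qed

lemma rawJ_type:
  assumes A: "\<Gamma> \<turnstile> A \<^bold>: Univ i" and C: "ctx3 A \<Gamma> \<turnstile> C \<^bold>: Univ j" and c: "A # \<Gamma> \<turnstile> c \<^bold>: reflJ A C"
    and x: "\<Gamma> \<turnstile> x \<^bold>: A" and y: "\<Gamma> \<turnstile> y \<^bold>: A" and p: "\<Gamma> \<turnstile> p \<^bold>: rawId A x y"
  shows "\<Gamma> \<turnstile> rawJ A C c x y p \<^bold>: sub (lsub [p, y, x]) C"
proof -
  note wf = has_type_wf[OF A]
  let ?M = "motJ A C"
  have 1: "\<Gamma> \<turnstile> App (Con cIndId) A \<^bold>:
     J_type1 A j"
    using ty_app[OF cIndId_type[OF wf, of i j] A] by (simp add: inst_simps numeral_eq_Suc)
  have 2: "\<Gamma> \<turnstile> App (App (Con cIndId) A) ?M \<^bold>: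
     J_type2 A ?M"
    using ty_app[OF 1 motJ_type[OF A C]] by (simp add: inst_simps numeral_eq_Suc)
  have c1: "\<Gamma> \<turnstile> Lam A c \<^bold>: Pi A (App (App (App (ren Suc ?M) (Var 0)) (Var 0)) (rawRefl (ren Suc A) (Var 0)))"
    by (rule ty_conv[OF ty_lam[OF A c] rawJ_fun_type[OF A C]])
  have 3: "\<Gamma> \<turnstile> App (App (App (Con cIndId) A) ?M) (Lam A c) \<^bold>:
       J_type3 A ?M"
    using ty_app[OF 2 c1] by (simp add: inst_simps numeral_eq_Suc)
  have 4: "\<Gamma> \<turnstile> App (App (App (App (Con cIndId) A) ?M) (Lam A c)) x \<^bold>:
       J_type4 A ?M x"
    using ty_app[OF 3 x] by (simp add: inst_simps numeral_eq_Suc)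
  have 5: "\<Gamma> \<turnstile> App (App (App (App (App (Con cIndId) A) ?M) (Lam A c)) x) y \<^bold>:
       J_type5 A ?M x y"
    using ty_app[OF 4 y] by (simp add: inst_simps numeral_eq_Suc)
  have 6: "\<Gamma> \<turnstile> rawJ A C c x y p \<^bold>: App (App (App ?M x) y) p"
    unfolding rawJ_def using ty_app[OF 5 p] by (simp add: inst_simps numeral_eq_Suc)
  then show ?thesis using motJ_app[OF A C x y p] by (rule ty_conv)
qed

text \<open>The rule \<open>comp_refl\<close> yields the abstracted method applied to the point, and
  a beta step finishes. That rule wants type and endpoint repeated literally, which is why
  \<open>redex\<close> tests them for syntactic equality.\<close>

lemma rawJ_refl:
  assumes A: "\<Gamma> \<turnstile> A \<^bold>: Univ i" and C: "ctx3 A \<Gamma> \<turnstile> C \<^bold>: Univ j" and c: "A # \<Gamma> \<turnstile> c \<^bold>: reflJ A C"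
    and x: "\<Gamma> \<turnstile> x \<^bold>: A"
  shows "\<Gamma> \<turnstile> rawJ A C c x x (rawRefl A x) \<^bold>\<equiv> inst c x \<^bold>: sub (lsub [rawRefl A x, x, x]) C"
proof -
  have "rawJ A C c x x (rawRefl A x) \<leadsto> App (Lam A c) x"
    using comp_refl[of A "motJ A C" "Lam A c" x] by (simp add: rawJ_def rawRefl_def apps_def)
  with rawJ_type[OF A C c x x rawRefl_type[OF A x]]
  have "\<Gamma> \<turnstile> rawJ A C c x x (rawRefl A x) \<^bold>\<equiv> App (Lam A c) x \<^bold>: sub (lsub [rawRefl A x, x, x]) C"
    by (rule eq_comp)
  moreover have "inst (reflJ A C) x = sub (lsub [rawRefl A x, x, x]) C"
    unfolding reflJ_def inst_def sub_ren sub_sub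
    by (rule arg_cong[where f = "\<lambda>s. sub s C"])
      (auto simp: fun_eq_iff lsub_def lren_def inst_simps nth_Cons split: nat.split)
  then have "\<Gamma> \<turnstile> App (Lam A c) x \<^bold>\<equiv> inst c x \<^bold>: sub (lsub [rawRefl A x, x, x]) C"
    using eq_beta[OF A c x] by simp
  ultimately show ?thesis by (rule eq_trans)
qed

section \<open>Every accepted query yields a derivation\<close>

section \<open>Soundness of the checker\<close>

text \<open>Subtyping by its effect: whatever inhabits, or is equal in, the first type does so in
  the second. This treats conversion and cumulativity of universes alike and composes with any
  rule.\<close>

definition sle :: "tm list \<Rightarrow> tm \<Rightarrow> tm \<Rightarrow> bool" where
  "sle \<Gamma> A B \<longleftrightarrow> (\<forall>t. \<Gamma> \<turnstile> t \<^bold>: A \<longrightarrow> \<Gamma> \<turnstile> t \<^bold>: B) \<and> (\<forall>t u. \<Gamma> \<turnstile> t \<^bold>\<equiv> u \<^bold>: A \<longrightarrow> \<Gamma> \<turnstile> t \<^bold>\<equiv> u \<^bold>: B)"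

lemma sle_refl: "sle \<Gamma> A A"
  by (simp add: sle_def)

lemma sleD: "sle \<Gamma> A B \<Longrightarrow> \<Gamma> \<turnstile> t \<^bold>: A \<Longrightarrow> \<Gamma> \<turnstile> t \<^bold>: B"
  and sleD_eq: "sle \<Gamma> A B \<Longrightarrow> \<Gamma> \<turnstile> t \<^bold>\<equiv> u \<^bold>: A \<Longrightarrow> \<Gamma> \<turnstile> t \<^bold>\<equiv> u \<^bold>: B"
  by (simp_all add: sle_def)

lemma sle_conv: "\<Gamma> \<turnstile> A \<^bold>\<equiv> B \<^bold>: Univ i \<Longrightarrow> sle \<Gamma> A B"
  by (auto simp: sle_def intro: ty_conv eq_conv)

lemma sle_Univ: "i \<le> j \<Longrightarrow> sle \<Gamma> (Univ i) (Univ j)"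
  by (auto simp: sle_def intro: cumul_le eq_cumul_le)

lemma lsub_Cons: "lsub (a # s) = case_nat a (lsub s)"
  by (auto simp: fun_eq_iff lsub_def split: nat.split)

lemma lsub_Nil: "lsub [] = Var"
  by (simp add: fun_eq_iff lsub_def)

text \<open>\<open>ok\<close> marks the definitions that may be relied on. Only their typing is
  assumed; that a constant is interpreted by its body holds for all definitions, so unfolding is
  always sound.\<close>

locale signature =
  fixes e :: "'m sg" and kty :: "const \<Rightarrow> 'm xtm option" and ok :: "'m \<Rightarrow> bool" and D :: "'m \<Rightarrow> tm"
  assumes D: "\<And>m. D m = den D (body (e m))"
    and scoped_D: "\<And>m. scoped (length (tele (e m))) (D m)"
    and kty: "\<And>c T \<Gamma>. kty c = Some T \<Longrightarrow> wf_ctx \<Gamma> \<Longrightarrow> \<Gamma> \<turnstile> Con c \<^bold>: den D T"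
    and ok: "\<And>m. ok m \<Longrightarrow> rev (map (den D) (tele (e m))) \<turnstile> D m \<^bold>: den D (mty (e m))"
begin

abbreviation tr_tm :: "'m xtm \<Rightarrow> tm" ("\<lbrakk>_\<rbrakk>") where "\<lbrakk>t\<rbrakk> \<equiv> den D t"
abbreviation tr_ctx :: "'m xtm list \<Rightarrow> tm list" ("\<langle>_\<rangle>") where "\<langle>G\<rangle> \<equiv> map (den D) G"
abbreviation R :: "'m query \<Rightarrow> 'm xtm option" where "R \<equiv> run e kty ok"

text \<open>Each rule records the run of the checker: this makes the inferred type unique.\<close>

inductive infers :: "'m xtm list \<Rightarrow> 'm xtm \<Rightarrow> 'm xtm \<Rightarrow> bool"
  and infers_list :: "'m xtm list \<Rightarrow> 'm xtm list \<Rightarrow> 'm xtm list \<Rightarrow> 'm xtm list \<Rightarrow> bool" where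
  i_var: "R (Infer G (XV k)) = Some (lift (Suc k) 0 (G ! k)) \<Longrightarrow> k < length G \<Longrightarrow>
    infers G (XV k) (lift (Suc k) 0 (G ! k))"
| i_univ: "R (Infer G (XU k)) = Some (XU (Suc k)) \<Longrightarrow> infers G (XU k) (XU (Suc k))"
| i_con: "R (Infer G (XK c)) = Some T \<Longrightarrow> kty c = Some T \<Longrightarrow> infers G (XK c) T"
| i_app: "R (Infer G (XA g a)) = Some (subst [a] 0 B) \<Longrightarrow> infers G g F \<Longrightarrow>
    F = XP A B \<or> \<not> is_P F \<and> sle \<langle>G\<rangle> \<lbrakk>F\<rbrakk> \<lbrakk>XP A B\<rbrakk> \<Longrightarrow> infers G a T \<Longrightarrow> sle \<langle>G\<rangle> \<lbrakk>T\<rbrakk> \<lbrakk>A\<rbrakk> \<Longrightarrow>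
    infers G (XA g a) (subst [a] 0 B)"
| i_lam: "R (Infer G (XL A b)) = Some (XP A B) \<Longrightarrow> infers G A (XU k) \<Longrightarrow> infers (A # G) b B \<Longrightarrow>
    infers G (XL A b) (XP A B)"
| i_pi: "R (Infer G (XP A B)) = Some (XU (max k j)) \<Longrightarrow> infers G A (XU k) \<Longrightarrow> infers (A # G) B (XU j) \<Longrightarrow>
    infers G (XP A B) (XU (max k j))"
| i_id: "R (Infer G (XE A x y)) = Some (XU k) \<Longrightarrow> infers G A (XU k) \<Longrightarrow> infers G x X \<Longrightarrow> sle \<langle>G\<rangle> \<lbrakk>X\<rbrakk> \<lbrakk>A\<rbrakk> \<Longrightarrow>
    infers G y Y \<Longrightarrow> sle \<langle>G\<rangle> \<lbrakk>Y\<rbrakk> \<lbrakk>A\<rbrakk> \<Longrightarrow> infers G (XE A x y) (XU k)"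
| i_refl: "R (Infer G (XR A x)) = Some (XE A x x) \<Longrightarrow> infers G A (XU k) \<Longrightarrow> infers G x X \<Longrightarrow> sle \<langle>G\<rangle> \<lbrakk>X\<rbrakk> \<lbrakk>A\<rbrakk> \<Longrightarrow>
    infers G (XR A x) (XE A x x)"
| i_J: "R (Infer G (XJ A C c x y p)) = Some (subst [p, y, x] 0 C) \<Longrightarrow> infers G A (XU k) \<Longrightarrow>
    infers (ctxJ A G) C (XU j) \<Longrightarrow> infers (A # G) c T \<Longrightarrow> sle \<langle>A # G\<rangle> \<lbrakk>T\<rbrakk> \<lbrakk>J_refl A C\<rbrakk> \<Longrightarrow>
    infers G x X \<Longrightarrow> sle \<langle>G\<rangle> \<lbrakk>X\<rbrakk> \<lbrakk>A\<rbrakk> \<Longrightarrow> infers G y Y \<Longrightarrow> sle \<langle>G\<rangle> \<lbrakk>Y\<rbrakk> \<lbrakk>A\<rbrakk> \<Longrightarrow>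
    infers G p P \<Longrightarrow> sle \<langle>G\<rangle> \<lbrakk>P\<rbrakk> \<lbrakk>XE A x y\<rbrakk> \<Longrightarrow> infers G (XJ A C c x y p) (subst [p, y, x] 0 C)"
| i_mac: "R (Infer G (XM m as)) = Some (subst (rev as) 0 (mty (e m))) \<Longrightarrow> ok m \<Longrightarrow>
    infers_list G [] (tele (e m)) as \<Longrightarrow> infers G (XM m as) (subst (rev as) 0 (mty (e m)))"
| i_nil: "infers_list G s [] []"
| i_cons: "infers G a T \<Longrightarrow> sle \<langle>G\<rangle> \<lbrakk>T\<rbrakk> \<lbrakk>subst s 0 S\<rbrakk> \<Longrightarrow> infers_list G (a # s) Ss as \<Longrightarrow>
    infers_list G s (S # Ss) (a # as)"

lemma infers_run: "infers G t T \<Longrightarrow> R (Infer G t) = Some T"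
  by (erule infers.cases; hypsubst; assumption)

lemma infers_det: "infers G t T \<Longrightarrow> infers G t U \<Longrightarrow> T = U"
  by (drule infers_run)+ simp

lemma ctxJ_ctx3: "\<langle>ctxJ A G\<rangle> = ctx3 \<lbrakk>A\<rbrakk> \<langle>G\<rangle>"
proof -
  have "lren 2 0 = (\<lambda>k. k + 2)" "lren 1 0 = Suc" by (auto simp: fun_eq_iff lren_def)
  then show ?thesis by (simp add: ctxJ_def ctx3_def den_lift)
qed

lemma den_J_refl: "\<lbrakk>J_refl A C\<rbrakk> = reflJ \<lbrakk>A\<rbrakk> \<lbrakk>C\<rbrakk>"
proof -
  have "lren 1 0 = Suc" by (auto simp: fun_eq_iff lren_def)
  then show ?thesis by (simp add: J_refl_def reflJ_def den_subst_0 den_lift)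
qed

lemma wf_ctxJ: "\<langle>G\<rangle> \<turnstile> \<lbrakk>A\<rbrakk> \<^bold>: Univ k \<Longrightarrow> wf_ctx \<langle>ctxJ A G\<rangle>"
  unfolding ctxJ_ctx3 by (rule ctx3_types(3))

lemma infers_list_length:
  "infers G t T \<Longrightarrow> True" "infers_list G s Ts as \<Longrightarrow> length as = length Ts"
  by (induction rule: infers_infers_list.inducts) auto

lemma den_XM: "length as = length (tele (e m)) \<Longrightarrow> \<lbrakk>XM m as\<rbrakk> = sub (lsub (rev \<langle>as\<rangle>)) (D m)"
  using msub_lsub[of "rev \<langle>as\<rangle>" "D m"] scoped_D[of m] by simp

text \<open>A defined constant and its unfolding have the same interpretation, so unfolding leaves
  no trace in the derivation.\<close>

lemma den_unfold: "length as = length (tele (e m)) \<Longrightarrow> \<lbrakk>subst (rev as) 0 (body (e m))\<rbrakk> = \<lbrakk>XM m as\<rbrakk>"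
  by (simp only: den_XM den_subst_0 D[symmetric] rev_map)

lemma den_expand: "\<lbrakk>expand e t\<rbrakk> = \<lbrakk>t\<rbrakk>"
proof (induction t)
  case (XM m as)
  then have 1: "\<langle>map (expand e) as\<rangle> = \<langle>as\<rangle>" by simp
  have 2: "\<lbrakk>XM m (map (expand e) as)\<rbrakk> = \<lbrakk>XM m as\<rbrakk>" by (simp only: den.simps 1)
  show ?case
  proof (cases "unf (e m) = Always \<and> length as = length (tele (e m))")
    case True
    then have "\<lbrakk>expand e (XM m as)\<rbrakk> = \<lbrakk>XM m (map (expand e) as)\<rbrakk>"
      using den_unfold[of "map (expand e) as" m] by simp
    with 2 show ?thesis by simp
  next
    case False
    then have "expand e (XM m as) = XM m (map (expand e) as)" by (auto split: mode.split)
    with 2 show ?thesis by simp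
  qed
qed simp_all

text \<open>For a defined constant, the checked arguments form a typed substitution for its
  telescope, along which the typing of the constant is instantiated. The second claim builds this
  substitution argument by argument, the latest one having index 0.\<close>

lemma infers_typed:
  shows "infers G t T \<Longrightarrow> wf_ctx \<langle>G\<rangle> \<Longrightarrow> \<langle>G\<rangle> \<turnstile> \<lbrakk>t\<rbrakk> \<^bold>: \<lbrakk>T\<rbrakk>"
    and "infers_list G s Ts as \<Longrightarrow> wf_ctx \<langle>G\<rangle> \<Longrightarrow> sub_typed (lsub \<langle>s\<rangle>) \<Theta> \<langle>G\<rangle> \<Longrightarrow>
      sub_typed (lsub (rev \<langle>as\<rangle> @ \<langle>s\<rangle>)) (rev \<langle>Ts\<rangle> @ \<Theta>) \<langle>G\<rangle>"
proof (induction arbitrary: and \<Theta> rule: infers_infers_list.inducts)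
  case (i_var G k)
  have "lren (Suc k) 0 = (\<lambda>n. n + Suc k)" by (simp add: fun_eq_iff lren_def)
  then show ?case using ty_var[of "\<langle>G\<rangle>" k] i_var by (simp add: den_lift)
next
  case (i_con G c T)
  then show ?case by (simp add: kty)
next
  case (i_app G g a B F A T)
  have "\<langle>G\<rangle> \<turnstile> \<lbrakk>g\<rbrakk> \<^bold>: Pi \<lbrakk>A\<rbrakk> \<lbrakk>B\<rbrakk>"
    using i_app.IH(4) i_app.IH(3)[OF i_app.prems] by (auto dest: sleD)
  moreover have "\<langle>G\<rangle> \<turnstile> \<lbrakk>a\<rbrakk> \<^bold>: \<lbrakk>A\<rbrakk>"
    using i_app.IH(7) i_app.IH(6)[OF i_app.prems] by (rule sleD)
  ultimately show ?case by (simp add: den_subst_1 ty_app)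
next
  case (i_lam G A b B k)
  have A: "\<langle>G\<rangle> \<turnstile> \<lbrakk>A\<rbrakk> \<^bold>: Univ k" using i_lam.IH(3)[OF i_lam.prems] by simp
  with i_lam.IH(5) i_lam.prems show ?case by (auto intro: ty_lam ctx_extend)
next
  case (i_pi G A B k j)
  have A: "\<langle>G\<rangle> \<turnstile> \<lbrakk>A\<rbrakk> \<^bold>: Univ k" using i_pi.IH(3)[OF i_pi.prems] by simp
  have B: "\<lbrakk>A\<rbrakk> # \<langle>G\<rangle> \<turnstile> \<lbrakk>B\<rbrakk> \<^bold>: Univ j" using i_pi.IH(5) i_pi.prems A by (auto intro: ctx_extend)
  from cumul_le[OF _ A, of "max k j"] cumul_le[OF _ B, of "max k j"] show ?case by (auto intro: ty_pi)
next
  case (i_id G A x y k X Y)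
  then show ?case by (auto intro!: rawId_type elim: sleD)
next
  case (i_refl G A x k X)
  then show ?case by (auto intro!: rawRefl_type elim: sleD)
next
  case (i_J G A C c x y p k j T X Y P)
  have A: "\<langle>G\<rangle> \<turnstile> \<lbrakk>A\<rbrakk> \<^bold>: Univ k" using i_J.IH(3)[OF i_J.prems] by simp
  have "wf_ctx \<langle>A # G\<rangle>" using i_J.prems A by (auto intro: ctx_extend)
  from sleD[OF i_J.IH(8) i_J.IH(7)[OF this]]
  have c: "\<lbrakk>A\<rbrakk> # \<langle>G\<rangle> \<turnstile> \<lbrakk>c\<rbrakk> \<^bold>: reflJ \<lbrakk>A\<rbrakk> \<lbrakk>C\<rbrakk>" by (simp add: den_J_refl)
  have C: "ctx3 \<lbrakk>A\<rbrakk> \<langle>G\<rangle> \<turnstile> \<lbrakk>C\<rbrakk> \<^bold>: Univ j"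
    using i_J.IH(5)[OF wf_ctxJ[OF A]] by (simp add: ctxJ_ctx3)
  have xyp: "\<langle>G\<rangle> \<turnstile> \<lbrakk>x\<rbrakk> \<^bold>: \<lbrakk>A\<rbrakk>" "\<langle>G\<rangle> \<turnstile> \<lbrakk>y\<rbrakk> \<^bold>: \<lbrakk>A\<rbrakk>" "\<langle>G\<rangle> \<turnstile> \<lbrakk>p\<rbrakk> \<^bold>: rawId \<lbrakk>A\<rbrakk> \<lbrakk>x\<rbrakk> \<lbrakk>y\<rbrakk>"
    using sleD[OF i_J.IH(11) i_J.IH(10)[OF i_J.prems]] sleD[OF i_J.IH(14) i_J.IH(13)[OF i_J.prems]]
      sleD[OF i_J.IH(17) i_J.IH(16)[OF i_J.prems]] by simp_all
  from rawJ_type[OF A C c xyp] show ?case by (simp add: den_subst_0)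
next
  case (i_mac G m as)
  have "sub_typed (lsub (rev \<langle>as\<rangle>)) (rev \<langle>tele (e m)\<rangle>) \<langle>G\<rangle>"
    using i_mac.IH(4)[of "[]"] i_mac.prems by (simp add: lsub_Nil sub_typed_def)
  from typing_sub(2)[OF ok[OF i_mac.IH(2)] this] infers_list_length(2)[OF i_mac.IH(3)]
  show ?case by (simp only: den_XM den_subst_0 rev_map)
next
  case (i_cons G a T s S Ss as)
  have "\<langle>G\<rangle> \<turnstile> \<lbrakk>a\<rbrakk> \<^bold>: sub (lsub \<langle>s\<rangle>) \<lbrakk>S\<rbrakk>"
    using sleD[OF i_cons.IH(3) i_cons.IH(2)[OF i_cons.prems(1)]] by (simp add: den_subst_0)
  then have "sub_typed (lsub \<langle>a # s\<rangle>) (\<lbrakk>S\<rbrakk> # \<Theta>) \<langle>G\<rangle>"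
    using sub_typed_extend[OF i_cons.prems(2)] by (simp add: lsub_Cons)
  from i_cons.IH(5)[OF i_cons.prems(1) this] show ?case by simp
qed (auto intro: ty_univ)

text \<open>Conditional on an inferred type, because the normalizer does not check its own input.
  Inference being deterministic, the type in question is unique.\<close>

definition nf_ok :: "'m xtm list \<Rightarrow> 'm xtm \<Rightarrow> 'm xtm \<Rightarrow> bool" where
  "nf_ok G t t' \<longleftrightarrow> (\<forall>T. infers G t T \<longrightarrow> wf_ctx \<langle>G\<rangle> \<longrightarrow> \<langle>G\<rangle> \<turnstile> \<lbrakk>t\<rbrakk> \<^bold>\<equiv> \<lbrakk>t'\<rbrakk> \<^bold>: \<lbrakk>T\<rbrakk>)"

lemma nf_okD: "nf_ok G t t' \<Longrightarrow> infers G t T \<Longrightarrow> wf_ctx \<langle>G\<rangle> \<Longrightarrow> \<langle>G\<rangle> \<turnstile> \<lbrakk>t\<rbrakk> \<^bold>\<equiv> \<lbrakk>t'\<rbrakk> \<^bold>: \<lbrakk>T\<rbrakk>"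
  by (simp add: nf_ok_def)

lemma nf_okI: "(\<And>T. infers G t T \<Longrightarrow> wf_ctx \<langle>G\<rangle> \<Longrightarrow> \<langle>G\<rangle> \<turnstile> \<lbrakk>t\<rbrakk> \<^bold>\<equiv> \<lbrakk>t'\<rbrakk> \<^bold>: \<lbrakk>T\<rbrakk>) \<Longrightarrow> nf_ok G t t'"
  by (simp add: nf_ok_def)

lemma nf_ok_refl: "\<lbrakk>t'\<rbrakk> = \<lbrakk>t\<rbrakk> \<Longrightarrow> nf_ok G t t'"
  by (auto simp: nf_ok_def intro: eq_refl infers_typed(1))

lemma nf_ok_XA:
  assumes "nf_ok G g g'" and "nf_ok G a a'"
  shows "nf_ok G (XA g a) (XA g' a')"
proof (rule nf_okI)
  fix T assume "infers G (XA g a) T" and wf: "wf_ctx \<langle>G\<rangle>"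
  then show "\<langle>G\<rangle> \<turnstile> \<lbrakk>XA g a\<rbrakk> \<^bold>\<equiv> \<lbrakk>XA g' a'\<rbrakk> \<^bold>: \<lbrakk>T\<rbrakk>"
  proof (cases rule: infers.cases)
    case (i_app B F A U)
    have "\<langle>G\<rangle> \<turnstile> \<lbrakk>g\<rbrakk> \<^bold>\<equiv> \<lbrakk>g'\<rbrakk> \<^bold>: Pi \<lbrakk>A\<rbrakk> \<lbrakk>B\<rbrakk>"
      using nf_okD[OF assms(1) i_app(3) wf] i_app(4) by (auto dest: sleD_eq)
    moreover have "\<langle>G\<rangle> \<turnstile> \<lbrakk>a\<rbrakk> \<^bold>\<equiv> \<lbrakk>a'\<rbrakk> \<^bold>: \<lbrakk>A\<rbrakk>"
      using nf_okD[OF assms(2) i_app(5) wf] i_app(6) by (auto dest: sleD_eq)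
    ultimately show ?thesis by (simp add: i_app(1) den_subst_1 eq_app)
  qed
qed

lemma nf_ok_XL:
  assumes "nf_ok G A A'" and "nf_ok (A # G) b b'"
  shows "nf_ok G (XL A b) (XL A' b')"
proof (rule nf_okI)
  fix T assume "infers G (XL A b) T" and wf: "wf_ctx \<langle>G\<rangle>"
  then show "\<langle>G\<rangle> \<turnstile> \<lbrakk>XL A b\<rbrakk> \<^bold>\<equiv> \<lbrakk>XL A' b'\<rbrakk> \<^bold>: \<lbrakk>T\<rbrakk>"
  proof (cases rule: infers.cases)
    case (i_lam B k)
    have A: "\<langle>G\<rangle> \<turnstile> \<lbrakk>A\<rbrakk> \<^bold>: Univ k" using infers_typed(1)[OF i_lam(3) wf] by simp
    have A': "\<langle>G\<rangle> \<turnstile> \<lbrakk>A\<rbrakk> \<^bold>\<equiv> \<lbrakk>A'\<rbrakk> \<^bold>: Univ k" using nf_okD[OF assms(1) i_lam(3) wf] by simp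
    have "wf_ctx \<langle>A # G\<rangle>" using A wf by (auto intro: ctx_extend)
    from nf_okD[OF assms(2) i_lam(4) this] A A' show ?thesis by (simp add: i_lam(1) eq_lam)
  qed
qed

lemma nf_ok_XP:
  assumes "nf_ok G A A'" and "nf_ok (A # G) b b'"
  shows "nf_ok G (XP A b) (XP A' b')"
proof (rule nf_okI)
  fix T assume "infers G (XP A b) T" and wf: "wf_ctx \<langle>G\<rangle>"
  then show "\<langle>G\<rangle> \<turnstile> \<lbrakk>XP A b\<rbrakk> \<^bold>\<equiv> \<lbrakk>XP A' b'\<rbrakk> \<^bold>: \<lbrakk>T\<rbrakk>"
  proof (cases rule: infers.cases)
    case (i_pi k j)
    have A: "\<langle>G\<rangle> \<turnstile> \<lbrakk>A\<rbrakk> \<^bold>: Univ k" using infers_typed(1)[OF i_pi(3) wf] by simp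
    have A': "\<langle>G\<rangle> \<turnstile> \<lbrakk>A\<rbrakk> \<^bold>\<equiv> \<lbrakk>A'\<rbrakk> \<^bold>: Univ k" using nf_okD[OF assms(1) i_pi(3) wf] by simp
    have "wf_ctx \<langle>A # G\<rangle>" using A wf by (auto intro: ctx_extend)
    from nf_okD[OF assms(2) i_pi(4) this] have b: "\<lbrakk>A\<rbrakk> # \<langle>G\<rangle> \<turnstile> \<lbrakk>b\<rbrakk> \<^bold>\<equiv> \<lbrakk>b'\<rbrakk> \<^bold>: Univ j" by simp
    from cumul_le[OF _ A, of "max k j"] eq_cumul_le[OF _ A', of "max k j"] eq_cumul_le[OF _ b,
      of "max k j"]
    show ?thesis by (simp add: i_pi(1) eq_pi)
  qed
qed

lemma nf_ok_XE:
  assumes "nf_ok G A A'" and "nf_ok G x x'" and "nf_ok G y y'"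
  shows "nf_ok G (XE A x y) (XE A' x' y')"
proof (rule nf_okI)
  fix T assume "infers G (XE A x y) T" and wf: "wf_ctx \<langle>G\<rangle>"
  then show "\<langle>G\<rangle> \<turnstile> \<lbrakk>XE A x y\<rbrakk> \<^bold>\<equiv> \<lbrakk>XE A' x' y'\<rbrakk> \<^bold>: \<lbrakk>T\<rbrakk>"
  proof (cases rule: infers.cases)
    case (i_id k X Y)
    have A: "\<langle>G\<rangle> \<turnstile> \<lbrakk>A\<rbrakk> \<^bold>\<equiv> \<lbrakk>A'\<rbrakk> \<^bold>: Univ k" using nf_okD[OF assms(1) i_id(3) wf] by simp
    from rawId_eq[OF A sleD_eq[OF i_id(5) nf_okD[OF assms(2) i_id(4) wf]]
        sleD_eq[OF i_id(7) nf_okD[OF assms(3) i_id(6) wf]] wf]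
    show ?thesis by (simp add: i_id(1))
  qed
qed

lemma nf_ok_XR:
  assumes "nf_ok G A A'" and "nf_ok G x x'"
  shows "nf_ok G (XR A x) (XR A' x')"
proof (rule nf_okI)
  fix T assume "infers G (XR A x) T" and wf: "wf_ctx \<langle>G\<rangle>"
  then show "\<langle>G\<rangle> \<turnstile> \<lbrakk>XR A x\<rbrakk> \<^bold>\<equiv> \<lbrakk>XR A' x'\<rbrakk> \<^bold>: \<lbrakk>T\<rbrakk>"
  proof (cases rule: infers.cases)
    case (i_refl k X)
    have A: "\<langle>G\<rangle> \<turnstile> \<lbrakk>A\<rbrakk> \<^bold>\<equiv> \<lbrakk>A'\<rbrakk> \<^bold>: Univ k" using nf_okD[OF assms(1) i_refl(3) wf] by simp
    from rawRefl_eq[OF A sleD_eq[OF i_refl(5) nf_okD[OF assms(2) i_refl(4) wf]] wf]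
    show ?thesis by (simp add: i_refl(1))
  qed
qed

lemma infers_J_typed:
  assumes "infers G (XJ A C c x y p) T" and wf: "wf_ctx \<langle>G\<rangle>"
  obtains k j c\<^sub>T X Y P where "infers G A (XU k)" "infers (ctxJ A G) C (XU j)" "infers (A # G) c c\<^sub>T"
    "infers G x X" "infers G y Y" "infers G p P"
    "T = subst [p, y, x] 0 C"
    "sle (\<lbrakk>A\<rbrakk> # \<langle>G\<rangle>) \<lbrakk>c\<^sub>T\<rbrakk> (reflJ \<lbrakk>A\<rbrakk> \<lbrakk>C\<rbrakk>)" "sle \<langle>G\<rangle> \<lbrakk>X\<rbrakk> \<lbrakk>A\<rbrakk>" "sle \<langle>G\<rangle> \<lbrakk>Y\<rbrakk> \<lbrakk>A\<rbrakk>" "sle \<langle>G\<rangle> \<lbrakk>P\<rbrakk> (rawId \<lbrakk>A\<rbrakk> \<lbrakk>x\<rbrakk> \<lbrakk>y\<rbrakk>)"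
    "\<langle>G\<rangle> \<turnstile> \<lbrakk>A\<rbrakk> \<^bold>: Univ k" "ctx3 \<lbrakk>A\<rbrakk> \<langle>G\<rangle> \<turnstile> \<lbrakk>C\<rbrakk> \<^bold>: Univ j" "\<lbrakk>A\<rbrakk> # \<langle>G\<rangle> \<turnstile> \<lbrakk>c\<rbrakk> \<^bold>: reflJ \<lbrakk>A\<rbrakk> \<lbrakk>C\<rbrakk>"
    "\<langle>G\<rangle> \<turnstile> \<lbrakk>x\<rbrakk> \<^bold>: \<lbrakk>A\<rbrakk>" "\<langle>G\<rangle> \<turnstile> \<lbrakk>y\<rbrakk> \<^bold>: \<lbrakk>A\<rbrakk>" "\<langle>G\<rangle> \<turnstile> \<lbrakk>p\<rbrakk> \<^bold>: rawId \<lbrakk>A\<rbrakk> \<lbrakk>x\<rbrakk> \<lbrakk>y\<rbrakk>"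
    "wf_ctx \<langle>A # G\<rangle>" "wf_ctx \<langle>ctxJ A G\<rangle>"
  using assms(1)
proof (cases rule: infers.cases)
  case (i_J k j c\<^sub>T X Y P)
  have A: "\<langle>G\<rangle> \<turnstile> \<lbrakk>A\<rbrakk> \<^bold>: Univ k" using infers_typed(1)[OF i_J(3) wf] by simp
  have wfA: "wf_ctx \<langle>A # G\<rangle>" using A wf by (auto intro: ctx_extend)
  have C: "ctx3 \<lbrakk>A\<rbrakk> \<langle>G\<rangle> \<turnstile> \<lbrakk>C\<rbrakk> \<^bold>: Univ j"
    using infers_typed(1)[OF i_J(4) wf_ctxJ[OF A]] by (simp add: ctxJ_ctx3)
  show ?thesis
    by (rule that[OF i_J(3-5) i_J(7) i_J(9) i_J(11) i_J(1) _ i_J(8) i_J(10) _ A C _ sleD[OF i_J(8) infers_typed(1)[OF i_J(7) wf]]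
        sleD[OF i_J(10) infers_typed(1)[OF i_J(9) wf]] _ wfA wf_ctxJ[OF A]])
      (use i_J(6) i_J(12) sleD[OF i_J(6) infers_typed(1)[OF i_J(5) wfA]] sleD[OF i_J(12) infers_typed(1)[OF i_J(11) wf]]
        in \<open>simp_all add: den_J_refl\<close>)
qed

lemma nf_ok_XJ:
  assumes "nf_ok G A A'" and "nf_ok (ctxJ A G) C C'" and "nf_ok (A # G) c c'"
    and "nf_ok G x x'" and "nf_ok G y y'" and "nf_ok G p p'"
  shows "nf_ok G (XJ A C c x y p) (XJ A' C' c' x' y' p')"
proof (rule nf_okI)
  fix T assume "infers G (XJ A C c x y p) T" and wf: "wf_ctx \<langle>G\<rangle>"
  then obtain k j c\<^sub>T X Y P where i: "infers G A (XU k)" "infers (ctxJ A G) C (XU j)" "infers (A # G) c c\<^sub>T"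
      "infers G x X" "infers G y Y" "infers G p P"
    and T: "T = subst [p, y, x] 0 C"
    and s: "sle (\<lbrakk>A\<rbrakk> # \<langle>G\<rangle>) \<lbrakk>c\<^sub>T\<rbrakk> (reflJ \<lbrakk>A\<rbrakk> \<lbrakk>C\<rbrakk>)" "sle \<langle>G\<rangle> \<lbrakk>X\<rbrakk> \<lbrakk>A\<rbrakk>" "sle \<langle>G\<rangle> \<lbrakk>Y\<rbrakk> \<lbrakk>A\<rbrakk>" "sle \<langle>G\<rangle> \<lbrakk>P\<rbrakk> (rawId \<lbrakk>A\<rbrakk> \<lbrakk>x\<rbrakk> \<lbrakk>y\<rbrakk>)"
    and t: "\<langle>G\<rangle> \<turnstile> \<lbrakk>A\<rbrakk> \<^bold>: Univ k" "ctx3 \<lbrakk>A\<rbrakk> \<langle>G\<rangle> \<turnstile> \<lbrakk>C\<rbrakk> \<^bold>: Univ j" "\<langle>G\<rangle> \<turnstile> \<lbrakk>x\<rbrakk> \<^bold>: \<lbrakk>A\<rbrakk>" "\<langle>G\<rangle> \<turnstile> \<lbrakk>y\<rbrakk> \<^bold>: \<lbrakk>A\<rbrakk>"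
      "\<langle>G\<rangle> \<turnstile> \<lbrakk>p\<rbrakk> \<^bold>: rawId \<lbrakk>A\<rbrakk> \<lbrakk>x\<rbrakk> \<lbrakk>y\<rbrakk>"
    and w: "wf_ctx \<langle>A # G\<rangle>" "wf_ctx \<langle>ctxJ A G\<rangle>"
    by (rule infers_J_typed)
  have A: "\<langle>G\<rangle> \<turnstile> \<lbrakk>A\<rbrakk> \<^bold>\<equiv> \<lbrakk>A'\<rbrakk> \<^bold>: Univ k" using nf_okD[OF assms(1) i(1) wf] by simp
  have C: "ctx3 \<lbrakk>A\<rbrakk> \<langle>G\<rangle> \<turnstile> \<lbrakk>C\<rbrakk> \<^bold>\<equiv> \<lbrakk>C'\<rbrakk> \<^bold>: Univ j" using nf_okD[OF assms(2) i(2) w(2)] by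
    (simp add: ctxJ_ctx3)
  have c: "\<lbrakk>A\<rbrakk> # \<langle>G\<rangle> \<turnstile> \<lbrakk>c\<rbrakk> \<^bold>\<equiv> \<lbrakk>c'\<rbrakk> \<^bold>: reflJ \<lbrakk>A\<rbrakk> \<lbrakk>C\<rbrakk>"
    using sleD_eq[OF s(1)] nf_okD[OF assms(3) i(3) w(1)] by simp
  from rawJ_eq[OF t(1) A t(2) C c t(3) sleD_eq[OF s(2) nf_okD[OF assms(4) i(4) wf]]
      t(4) sleD_eq[OF s(3) nf_okD[OF assms(5) i(5) wf]] t(5) sleD_eq[OF s(4) nf_okD[OF assms(6) i(6) wf]]]
  show "\<langle>G\<rangle> \<turnstile> \<lbrakk>XJ A C c x y p\<rbrakk> \<^bold>\<equiv> \<lbrakk>XJ A' C' c' x' y' p'\<rbrakk> \<^bold>: \<lbrakk>T\<rbrakk>"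
    by (simp add: T den_subst_0)
qed

lemma infers_list_eq:
  "infers G t T \<Longrightarrow> True"
  "infers_list G s Ts as \<Longrightarrow> wf_ctx \<langle>G\<rangle> \<Longrightarrow> list_all2 (nf_ok G) as as' \<Longrightarrow>
    sub_eq (lsub \<langle>s\<rangle>) (lsub \<langle>s'\<rangle>) \<Theta> \<langle>G\<rangle> \<Longrightarrow>
    sub_eq (lsub (rev \<langle>as\<rangle> @ \<langle>s\<rangle>)) (lsub (rev \<langle>as'\<rangle> @ \<langle>s'\<rangle>)) (rev \<langle>Ts\<rangle> @ \<Theta>) \<langle>G\<rangle>"
proof (induction arbitrary: and as' s' \<Theta> rule: infers_infers_list.inducts)
  case (i_cons G a T s S Ss as)
  from i_cons.prems(2) obtain a' bs where as': "as' = a' # bs" and a: "nf_ok G a a'"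
      and bs: "list_all2 (nf_ok G) as bs"
    by (auto simp: list_all2_Cons1)
  have "\<langle>G\<rangle> \<turnstile> \<lbrakk>a\<rbrakk> \<^bold>\<equiv> \<lbrakk>a'\<rbrakk> \<^bold>: sub (lsub \<langle>s\<rangle>) \<lbrakk>S\<rbrakk>"
    using sleD_eq[OF i_cons.IH(3) nf_okD[OF a i_cons.IH(1) i_cons.prems(1)]] by (simp add: den_subst_0)
  then have "sub_eq (lsub \<langle>a # s\<rangle>) (lsub \<langle>a' # s'\<rangle>) (\<lbrakk>S\<rbrakk> # \<Theta>) \<langle>G\<rangle>"
    using sub_eq_extend[OF i_cons.prems(3)] by (simp add: lsub_Cons)
  from i_cons.IH(5)[OF i_cons.prems(1) bs this] show ?case by (simp add: as')
qed auto

text \<open>Reducing the arguments replaces the substitution into the body by a judgmentally equal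
  one, so \<open>typing_sub_eq\<close> applies.\<close>

lemma nf_ok_XM:
  assumes "list_all2 (nf_ok G) as as'"
  shows "nf_ok G (XM m as) (XM m as')"
proof (rule nf_okI)
  fix T assume "infers G (XM m as) T" and wf: "wf_ctx \<langle>G\<rangle>"
  then show "\<langle>G\<rangle> \<turnstile> \<lbrakk>XM m as\<rbrakk> \<^bold>\<equiv> \<lbrakk>XM m as'\<rbrakk> \<^bold>: \<lbrakk>T\<rbrakk>"
  proof (cases rule: infers.cases)
    case i_mac
    have len: "length as = length (tele (e m))" using infers_list_length(2)[OF i_mac(4)] .
    with assms have len': "length as' = length (tele (e m))" by (auto dest: list_all2_lengthD)
    have "sub_typed (lsub \<langle>[]\<rangle>) [] \<langle>G\<rangle>" "sub_eq (lsub \<langle>[]\<rangle>) (lsub \<langle>[]\<rangle>) [] \<langle>G\<rangle>"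
      using wf by (simp_all add: sub_typed_def sub_eq_def)
    with infers_typed(2)[OF i_mac(4) wf] infers_list_eq(2)[OF i_mac(4) wf assms]
    have "sub_typed (lsub (rev \<langle>as\<rangle>)) (rev \<langle>tele (e m)\<rangle>) \<langle>G\<rangle>"
      and "sub_eq (lsub (rev \<langle>as\<rangle>)) (lsub (rev \<langle>as'\<rangle>)) (rev \<langle>tele (e m)\<rangle>) \<langle>G\<rangle>"
      by fastforce+
    from typing_sub_eq[OF ok[OF i_mac(3)] this] show ?thesis
      by (simp only: i_mac(1) den_XM[OF len] den_XM[OF len'] den_subst_0 rev_map)
  qed
qed

lemma redexA_Some:
  "redexA g a = Some u \<Longrightarrow>
    (\<exists>A b. g = XL A b \<and> u = subst [a] 0 b) \<or> (\<exists>P. g = XA (XA (XK cIndUnit) P) u \<and> a = XK cStar)"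
  by (induction g a rule: redexA.induct) (auto split: if_splits)

lemma redex_ok:
  assumes "redex e t = Some u"
  shows "nf_ok G t u"
proof (rule nf_okI)
  fix T assume t: "infers G t T" and wf: "wf_ctx \<langle>G\<rangle>"
  show "\<langle>G\<rangle> \<turnstile> \<lbrakk>t\<rbrakk> \<^bold>\<equiv> \<lbrakk>u\<rbrakk> \<^bold>: \<lbrakk>T\<rbrakk>"
  proof (cases t)
    case (XA g a)
    show ?thesis
    proof (cases "\<exists>A b. g = XL A b")
      case True
      then obtain A b where g: "g = XL A b" by blast
      with assms XA have u: "u = subst [a] 0 b" by simp
      from t XA g have "infers G (XA (XL A b) a) T" by simp
      then show ?thesis
      proof (cases rule: infers.cases)
        case (i_app B F A' U)
        note app = i_app
        from app(3) show ?thesis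
        proof (cases rule: infers.cases)
          case (i_lam B' k)
          \<comment> \<open>The type inferred for an abstraction is literally an \<open>XP\<close>,
            so its domain and codomain coincide syntactically with those of the application. This
            takes the place of injectivity of dependent function types.\<close>
          with app(4) have eq: "A' = A" "B' = B" by auto
          have A: "\<langle>G\<rangle> \<turnstile> \<lbrakk>A\<rbrakk> \<^bold>: Univ k" using infers_typed(1)[OF i_lam(3) wf] by simp
          have "wf_ctx \<langle>A # G\<rangle>" using A wf by (auto intro: ctx_extend)
          from infers_typed(1)[OF i_lam(4) this] have b: "\<lbrakk>A\<rbrakk> # \<langle>G\<rangle> \<turnstile> \<lbrakk>b\<rbrakk> \<^bold>: \<lbrakk>B\<rbrakk>" by (simp add: eq)
          have a: "\<langle>G\<rangle> \<turnstile> \<lbrakk>a\<rbrakk> \<^bold>: \<lbrakk>A\<rbrakk>" using sleD[OF app(6) infers_typed(1)[OF app(5) wf]] by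
            (simp add: eq)
          from eq_beta[OF A b a] show ?thesis by (simp add: u XA g app(1) den_subst_1)
        qed
      qed
    next
      case False
      with assms XA have "redexA g a = Some u" by simp
      with False obtain P where "g = XA (XA (XK cIndUnit) P) u" "a = XK cStar"
        using redexA_Some by blast
      then have "\<lbrakk>t\<rbrakk> \<leadsto> \<lbrakk>u\<rbrakk>" using comp_unit[of "\<lbrakk>P\<rbrakk>" "\<lbrakk>u\<rbrakk>"] by (simp add: XA apps_def)
      with infers_typed(1)[OF t wf] show ?thesis by (rule eq_comp)
    qed
  next
    case (XJ A C c x y p)
    with assms have p: "p = XR A x" and y: "y = x" and u: "u = subst [x] 0 c"
      by (auto split: if_splits)
    from t XJ have "infers G (XJ A C c x y p) T" by simp
    then show ?thesis
    proof (rule infers_J_typed[OF _ wf])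
      fix k j
      assume "\<langle>G\<rangle> \<turnstile> \<lbrakk>A\<rbrakk> \<^bold>: Univ k" "ctx3 \<lbrakk>A\<rbrakk> \<langle>G\<rangle> \<turnstile> \<lbrakk>C\<rbrakk> \<^bold>: Univ j" "\<lbrakk>A\<rbrakk> # \<langle>G\<rangle> \<turnstile> \<lbrakk>c\<rbrakk> \<^bold>: reflJ \<lbrakk>A\<rbrakk> \<lbrakk>C\<rbrakk>"
        "\<langle>G\<rangle> \<turnstile> \<lbrakk>x\<rbrakk> \<^bold>: \<lbrakk>A\<rbrakk>" and T: "T = subst [p, y, x] 0 C"
      from rawJ_refl[OF this(1-4)] show ?thesis
        by (simp add: XJ T p y u den_subst_0 inst_lsub)
    qed
  next
    case (XM m as)
    with assms have "length as = length (tele (e m))" "u = subst (rev as) 0 (body (e m))"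
      by (auto split: if_splits)
    then have "\<lbrakk>u\<rbrakk> = \<lbrakk>t\<rbrakk>" using den_unfold XM by simp
    with eq_refl[OF infers_typed(1)[OF t wf]] show ?thesis by simp
  qed (use assms in simp_all)
qed

text \<open>The equation for the reduct holds at the type inferred for the reduct. The recheck
  places this type below that of the source, which stands in for subject reduction.\<close>

lemma nf_ok_trans:
  assumes t: "nf_ok G t u" and u: "nf_ok G u v"
    and rck: "wf_ctx \<langle>G\<rangle> \<Longrightarrow> \<exists>T U. infers G t T \<and> infers G u U \<and> sle \<langle>G\<rangle> \<lbrakk>U\<rbrakk> \<lbrakk>T\<rbrakk>"
  shows "nf_ok G t v"
proof (rule nf_okI)
  fix T assume T: "infers G t T" and wf: "wf_ctx \<langle>G\<rangle>"
  with rck infers_det obtain U where U: "infers G u U" "sle \<langle>G\<rangle> \<lbrakk>U\<rbrakk> \<lbrakk>T\<rbrakk>" by blast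
  show "\<langle>G\<rangle> \<turnstile> \<lbrakk>t\<rbrakk> \<^bold>\<equiv> \<lbrakk>v\<rbrakk> \<^bold>: \<lbrakk>T\<rbrakk>"
    by (rule eq_trans[OF nf_okD[OF t T wf] sleD_eq[OF U(2) nf_okD[OF u U(1) wf]]])
qed

fun sound :: "'m query \<Rightarrow> 'm xtm \<Rightarrow> bool" where
  "sound (Infer G t) T \<longleftrightarrow> (wf_ctx \<langle>G\<rangle> \<longrightarrow> infers G t T)"
| "sound (Typ G t) T \<longleftrightarrow> (\<exists>k. T = XU k \<and> (wf_ctx \<langle>G\<rangle> \<longrightarrow> infers G t (XU k)))"
| "sound (Chk G t A) a \<longleftrightarrow> (wf_ctx \<langle>G\<rangle> \<longrightarrow> (\<exists>T. infers G t T \<and> sle \<langle>G\<rangle> \<lbrakk>T\<rbrakk> \<lbrakk>A\<rbrakk>))"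
| "sound (Chks G s Ts as) a \<longleftrightarrow> (wf_ctx \<langle>G\<rangle> \<longrightarrow> infers_list G s Ts as)"
| "sound (Conv G T A) a \<longleftrightarrow> (wf_ctx \<langle>G\<rangle> \<longrightarrow> sle \<langle>G\<rangle> \<lbrakk>T\<rbrakk> \<lbrakk>A\<rbrakk>)"
| "sound (Rck G t u) a \<longleftrightarrow> (wf_ctx \<langle>G\<rangle> \<longrightarrow> (\<exists>T U. infers G t T \<and> infers G u U \<and> sle \<langle>G\<rangle> \<lbrakk>U\<rbrakk> \<lbrakk>T\<rbrakk>))"
| "sound (Step G t) t' \<longleftrightarrow> nf_ok G t t'"
| "sound (Nf G t) t' \<longleftrightarrow> nf_ok G t t'"
| "sound (Nfsub G t) t' \<longleftrightarrow> nf_ok G t t'"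
| "sound (NfM G m ds as) t' \<longleftrightarrow> (\<exists>as'. t' = XM m (rev ds @ as') \<and> list_all2 (nf_ok G) as as')"

lemma sound_Typ: "sound (Typ G A) T \<Longrightarrow> wf_ctx \<langle>G\<rangle> \<Longrightarrow> \<exists>k. T = XU k \<and> infers G A (XU k)"
  by auto

lemma wf_extend: "infers G A (XU k) \<Longrightarrow> wf_ctx \<langle>G\<rangle> \<Longrightarrow> wf_ctx \<langle>A # G\<rangle>"
  using infers_typed(1)[of G A "XU k"] by (auto intro: ctx_extend)

lemma wf_extend_J: "infers G A (XU k) \<Longrightarrow> wf_ctx \<langle>G\<rangle> \<Longrightarrow> wf_ctx \<langle>ctxJ A G\<rangle>"
  using infers_typed(1)[of G A "XU k"] by (auto intro: wf_ctxJ)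

lemma is_simps: "is_U T \<longleftrightarrow> (\<exists>k. T = XU k)" "is_P T \<longleftrightarrow> (\<exists>A B. T = XP A B)"
  by (cases T; simp)+

lemma sle_nf:
  assumes T: "infers G T (XU i)" and A: "infers G A (XU j)" and wf: "wf_ctx \<langle>G\<rangle>"
    and "nf_ok G T T'" and "nf_ok G A A'" and eq: "\<lbrakk>T'\<rbrakk> = \<lbrakk>A'\<rbrakk>"
  shows "sle \<langle>G\<rangle> \<lbrakk>T\<rbrakk> \<lbrakk>A\<rbrakk>"
proof (rule sle_conv)
  have "\<langle>G\<rangle> \<turnstile> \<lbrakk>T\<rbrakk> \<^bold>\<equiv> \<lbrakk>T'\<rbrakk> \<^bold>: Univ (max i j)"
    using nf_okD[OF assms(4) T wf] by (auto intro: eq_cumul_le[of i])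
  moreover have "\<langle>G\<rangle> \<turnstile> \<lbrakk>A\<rbrakk> \<^bold>\<equiv> \<lbrakk>A'\<rbrakk> \<^bold>: Univ (max i j)"
    using nf_okD[OF assms(5) A wf] by (auto intro: eq_cumul_le[of j])
  ultimately show "\<langle>G\<rangle> \<turnstile> \<lbrakk>T\<rbrakk> \<^bold>\<equiv> \<lbrakk>A\<rbrakk> \<^bold>: Univ (max i j)"
    unfolding eq by (blast intro: eq_trans eq_sym)
qed

text \<open>Fixed-point induction speaks of an approximation of \<open>run\<close>, whereas
  \<open>infers\<close> records answers of \<open>run\<close> itself. The first conjunct is carried
  along so that answers of the approximation can be turned into recorded ones.\<close>

theorem run_sound: "R q = Some a \<Longrightarrow> R q = Some a \<and> sound q a"
proof (erule run.raw_induct[where P = "\<lambda>q a. R q = Some a \<and> sound q a", rotated], goal_cases)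
  case (1 f q a)
  note IH = "1"(1) and prem = "1"(2)
  have R: "\<And>q a. f q = Some a \<Longrightarrow> R q = Some a" using IH by blast
  have S: "\<And>q a. f q = Some a \<Longrightarrow> sound q a" using IH by blast
  \<comment> \<open>Every answer of \<open>f\<close> is one of \<open>R\<close>, so a single
    unfolding of \<open>run\<close> arrives at the same result.\<close>
  have Rq: "R q = Some a"
    using prem by (auto simp: bind_eq_Some_conv dest!: R split: query.splits xtm.splits list.splits option.splits if_splits)
      (subst run.simps, simp)+
  moreover have "sound q a"
  proof (cases q)
    case (Infer G t)
    have "infers G t a" if wf: "wf_ctx \<langle>G\<rangle>"
    proof (cases t)
      case (XV k)
      with prem Infer Rq show ?thesis by (auto intro: i_var split: if_splits)
    next
      case (XU k)
      with prem Infer Rq show ?thesis by (auto intro: i_univ)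
    next
      case (XK c)
      with prem Infer Rq show ?thesis by (auto intro: i_con)
    next
      case (XA g b)
      have if_None: "(if c then x else None) = Some y \<longleftrightarrow> c \<and> x = Some y" for c and x :: "'m xtm option"
        and y
        by simp
      from prem Infer XA obtain F P where F: "f (Infer G g) = Some F"
        and P: "(if is_P F then Some F else f (Typ G F) \<bind> (\<lambda>_. f (Nf G F))) = Some P"
        and PP: "is_P P" and b: "\<exists>X. f (Chk G b (dom_P P)) = Some X" and a: "a = subst [b] 0 (cod_P P)"
        by (auto simp: bind_eq_Some_conv if_None)
      from PP obtain A B where P': "P = XP A B" by (auto simp: is_simps)
      from S[OF F] wf have g: "infers G g F" by simp
      have "F = XP A B \<or> \<not> is_P F \<and> sle \<langle>G\<rangle> \<lbrakk>F\<rbrakk> \<lbrakk>XP A B\<rbrakk>"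
      proof (cases "is_P F")
        case False
        with P obtain U where U: "f (Typ G F) = Some U" "f (Nf G F) = Some P"
          by (auto simp: bind_eq_Some_conv)
        from sound_Typ[OF S[OF U(1)] wf] obtain k where "infers G F (XU k)" by blast
        from nf_okD[OF _ this wf, of P] S[OF U(2)] False show ?thesis by (auto simp: P' intro: sle_conv)
      qed (use P P' in simp)
      with g b S wf Rq show ?thesis by (fastforce simp: a P' Infer XA intro: i_app)
    next
      case (XL A b)
      with prem Infer obtain T B where A: "f (Typ G A) = Some T"
        and B: "f (Infer (A # G) b) = Some B" "a = XP A B"
        by (auto simp: bind_eq_Some_conv)
      from sound_Typ[OF S[OF A] wf] obtain k where k: "infers G A (XU k)" by blast
      with S[OF B(1)] wf_extend[OF k wf] Rq show ?thesis by (auto simp: XL Infer B(2) intro: i_lam)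
    next
      case (XP A B)
      with prem Infer obtain U V where A: "f (Typ G A) = Some U" and B: "f (Typ (A # G) B) = Some V"
          "a = XU (max (lev U) (lev V))"
        by (auto simp: bind_eq_Some_conv)
      from sound_Typ[OF S[OF A] wf] obtain k where k: "infers G A (XU k)" "U = XU k" by blast
      from sound_Typ[OF S[OF B(1)] wf_extend[OF k(1) wf]] obtain
        j where "infers (A # G) B (XU j)" "V = XU j" by blast
      with k Rq show ?thesis by (auto simp: XP Infer B(2) intro: i_pi)
    next
      case (XE A x y)
      with prem Infer obtain X Y where A: "f (Typ G A) = Some a" and X: "f (Chk G x A) = Some X"
        and Y: "f (Chk G y A) = Some Y"
        by (auto simp: bind_eq_Some_conv)
      from sound_Typ[OF S[OF A] wf] obtain k where k: "infers G A (XU k)" "a = XU k" by blast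
      with S[OF X] S[OF Y] wf Rq show ?thesis by (auto simp: XE Infer intro: i_id)
    next
      case (XR A x)
      with prem Infer obtain U X where A: "f (Typ G A) = Some U" and X: "f (Chk G x A) = Some X"
        and a: "a = XE A x x"
        by (auto simp: bind_eq_Some_conv)
      from sound_Typ[OF S[OF A] wf] obtain k where k: "infers G A (XU k)" by blast
      with S[OF X] wf Rq show ?thesis by (auto simp: XR Infer a intro: i_refl)
    next
      case (XJ A C c x y p)
      with prem Infer obtain U V W X Y P where A: "f (Typ G A) = Some U"
        and C: "f (Typ (ctxJ A G) C) = Some V"
        and c: "f (Chk (A # G) c (J_refl A C)) = Some W"
        and xyp: "f (Chk G x A) = Some X" "f (Chk G y A) = Some Y" "f (Chk G p (XE A x y)) = Some P"
        and a: "a = subst [p, y, x] 0 C"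
        by (auto simp: bind_eq_Some_conv)
      from sound_Typ[OF S[OF A] wf] obtain k where k: "infers G A (XU k)" by blast
      from sound_Typ[OF S[OF C] wf_extend_J[OF k wf]] obtain j where j: "infers (ctxJ A G) C (XU j)"
        by blast
      from S[OF c] wf_extend[OF k wf]
      obtain T where T: "infers (A # G) c T" "sle \<langle>A # G\<rangle> \<lbrakk>T\<rbrakk> \<lbrakk>J_refl A C\<rbrakk>" by auto
      from S[OF xyp(1)] S[OF xyp(2)] S[OF xyp(3)] wf obtain X' Y' P'
        where "infers G x X'" "sle \<langle>G\<rangle> \<lbrakk>X'\<rbrakk> \<lbrakk>A\<rbrakk>" "infers G y Y'" "sle \<langle>G\<rangle> \<lbrakk>Y'\<rbrakk> \<lbrakk>A\<rbrakk>" "infers G p P'" "sle \<langle>G\<rangle> \<lbrakk>P'\<rbrakk> \<lbrakk>XE A x y\<rbrakk>"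
        unfolding sound.simps by blast
      from i_J[OF _ k j T this] Rq show ?thesis by (simp add: XJ Infer a)
    next
      case (XM m as)
      with prem Infer obtain U where "ok m" "f (Chks G [] (tele (e m)) as) = Some U"
          "a = subst (rev as) 0 (mty (e m))"
        by (auto simp: bind_eq_Some_conv split: if_splits)
      with S[of "Chks G [] (tele (e m)) as" U] wf Rq show ?thesis by (auto simp: XM Infer intro: i_mac)
    qed
    then show ?thesis by (simp add: Infer)
  next
    case (Typ G t)
    with prem have "f (Infer G t) = Some a" "is_U a" by (auto simp: bind_eq_Some_conv split: if_splits)
    with S[of "Infer G t" a] show ?thesis by (auto simp: Typ is_simps)
  next
    case (Chk G t A)
    with prem obtain T where T: "f (Infer G t) = Some T" "T \<noteq> A \<longrightarrow> f (Conv G T A) = Some a"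
      by (auto simp: bind_eq_Some_conv split: if_splits)
    with S[OF T(1)] S[of "Conv G T A" a] show ?thesis by (cases "T = A") (auto simp: Chk
      intro: sle_refl)
  next
    case (Chks G s Ts as)
    show ?thesis
    proof (cases Ts)
      case Nil
      with prem Chks show ?thesis by (auto intro: i_nil split: if_splits)
    next
      case (Cons T Us)
      with prem Chks obtain b bs X where as: "as = b # bs"
        and X: "f (Chk G b (subst s 0 T)) = Some X" "f (Chks G (b # s) Us bs) = Some a"
        by (auto simp: bind_eq_Some_conv split: list.splits)
      with S[OF X(1)] S[OF X(2)] show ?thesis by (auto simp: Cons Chks as intro: i_cons)
    qed
  next
    case (Conv G T A)
    have "sle \<langle>G\<rangle> \<lbrakk>T\<rbrakk> \<lbrakk>A\<rbrakk>" if wf: "wf_ctx \<langle>G\<rangle>"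
    proof -
      consider (univ) "is_U T" "is_U A" "lev T \<le> lev A" | (exp) "expand e T = expand e A"
        | (step) U V T' A' where "f (Typ G (expand e T)) = Some U" "f (Typ G (expand e A)) = Some V"
          "f (Step G (expand e T)) = Some T'" "f (Step G (expand e A)) = Some A'" "expand e T' = expand e A'"
        | (nf) U V T' where "f (Typ G (expand e T)) = Some U" "f (Typ G (expand e A)) = Some V"
          "f (Nf G (expand e T)) = Some T'" "f (Nf G (expand e A)) = Some T'"
        using prem Conv by (auto simp: bind_eq_Some_conv split: if_splits)
      then show ?thesis
      proof cases
        case univ
        then show ?thesis by (auto simp: is_simps intro: sle_Univ)
      next
        case exp
        then have "\<lbrakk>expand e T\<rbrakk> = \<lbrakk>expand e A\<rbrakk>" by simp
        then show ?thesis by (simp add: den_expand sle_refl)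
      next
        case step
        from sound_Typ[OF S[OF step(1)] wf] sound_Typ[OF S[OF step(2)] wf] obtain i j
          where ij: "infers G (expand e T) (XU i)" "infers G (expand e A) (XU j)" by blast
        have "\<lbrakk>T'\<rbrakk> = \<lbrakk>A'\<rbrakk>" using arg_cong[OF step(5), of tr_tm] by (simp add: den_expand)
        with sle_nf[OF ij wf] S[OF step(3)] S[OF step(4)] show ?thesis by (simp add: den_expand)
      next
        case nf
        from sound_Typ[OF S[OF nf(1)] wf] sound_Typ[OF S[OF nf(2)] wf] obtain i j
          where ij: "infers G (expand e T) (XU i)" "infers G (expand e A) (XU j)" by blast
        with sle_nf[OF ij wf] S[OF nf(3)] S[OF nf(4)] show ?thesis by (simp add: den_expand)
      qed
    qed
    then show ?thesis by (simp add: Conv)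
  next
    case (Rck G t u)
    with prem obtain T where T: "f (Infer G t) = Some T" "f (Chk G u T) = Some a"
      by (auto simp: bind_eq_Some_conv)
    from S[OF T(1)] S[OF T(2)] show ?thesis by (auto simp: Rck)
  next
    case (Step G t)
    with prem show ?thesis by (auto simp: Step bind_eq_Some_conv
      intro: nf_ok_refl redex_ok split: option.splits)
  next
    case (Nf G t)
    consider (head) u X where "redex e t = Some u" "f (Rck G t u) = Some X" "f (Nf G u) = Some a"
      | (sub) "f (Nfsub G t) = Some a"
      | (sub_head) t' X where "f (Nfsub G t) = Some t'" "f (Rck G t t') = Some X" "f (Nf G t') = Some a"
      using prem Nf by (auto simp: bind_eq_Some_conv split: option.splits if_splits)
    then have "nf_ok G t a"
    proof cases
      case head
      with nf_ok_trans[OF redex_ok[OF head(1)]] S[OF head(2)] S[OF head(3)] show ?thesis by auto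
    next
      case sub
      with S[OF sub] show ?thesis by simp
    next
      case sub_head
      with nf_ok_trans[of G t t' a] S[OF sub_head(1)] S[OF sub_head(2)] S[OF sub_head(3)] show ?thesis
        by auto
    qed
    then show ?thesis by (simp add: Nf)
  next
    case (Nfsub G t)
    have "nf_ok G t a"
    proof (cases t)
      case (XJ A C c x y p)
      with prem Nfsub obtain
        A' x' y' p' C' c' where "f (Nf G A) = Some A'" "f (Nf G x) = Some x'" "f (Nf G y) = Some y'" "f (Nf G p) = Some p'"
        and Cc: "C' = C \<and> c' = c \<or> f (Nf (ctxJ A G) C) = Some C' \<and> f (Nf (A # G) c) = Some c'"
        and a: "a = XJ A' C' c' x' y' p'"
        by (auto simp: bind_eq_Some_conv split: if_splits)
      from this(1-4)[THEN S] have n: "nf_ok G A A'" "nf_ok G x x'" "nf_ok G y y'" "nf_ok G p p'"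
        by simp_all
      have "nf_ok (ctxJ A G) C C'" "nf_ok (A # G) c c'" using Cc S by (fastforce intro: nf_ok_refl)+
      from nf_ok_XJ[OF n(1) this n(2-4)] show ?thesis by (simp add: XJ a)
    next
      case (XM m as)
      with prem Nfsub have "f (NfM G m [] as) = Some a" by simp
      from S[OF this] show ?thesis by (auto simp: XM intro: nf_ok_XM)
    qed (use prem Nfsub S in \<open>fastforce simp: bind_eq_Some_conv
      intro: nf_ok_refl nf_ok_XA nf_ok_XL nf_ok_XP nf_ok_XE nf_ok_XR\<close>)+
    then show ?thesis by (simp add: Nfsub)
  next
    case (NfM G m ds as)
    show ?thesis
    proof (cases as)
      case Nil
      with prem NfM show ?thesis by auto
    next
      case (Cons b bs)
      with prem NfM obtain b' where b: "f (Nf G b) = Some b'" "f (NfM G m (b' # ds) bs) = Some a"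
        by (auto simp: bind_eq_Some_conv)
      from S[OF b(2)] obtain bs' where "a = XM m (rev (b' # ds) @ bs')" "list_all2 (nf_ok G) bs bs'"
        by auto
      with S[OF b(1)] have "a = XM m (rev ds @ b' # bs') \<and> list_all2 (nf_ok G) (b # bs) (b' # bs')"
        by simp
      then show ?thesis unfolding NfM Cons sound.simps by blast
    qed
  qed
  ultimately show ?case ..
qed

end

section \<open>Well-founded families of definitions\<close>

section \<open>Developments\<close>

text \<open>Scoping and dependency in one predicate. With \<open>ok\<close> a bound on the rank, it
  says that a body refers to earlier definitions only; with \<open>ok\<close> constantly false, that
  no definition is left.\<close>

primrec wsc :: "('m \<Rightarrow> bool) \<Rightarrow> nat \<Rightarrow> 'm xtm \<Rightarrow> bool" where
  "wsc ok n (XV i) \<longleftrightarrow> i < n"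
| "wsc ok n (XU i) \<longleftrightarrow> True"
| "wsc ok n (XK c) \<longleftrightarrow> True"
| "wsc ok n (XA f a) \<longleftrightarrow> wsc ok n f \<and> wsc ok n a"
| "wsc ok n (XL A b) \<longleftrightarrow> wsc ok n A \<and> wsc ok (Suc n) b"
| "wsc ok n (XP A b) \<longleftrightarrow> wsc ok n A \<and> wsc ok (Suc n) b"
| "wsc ok n (XE A x y) \<longleftrightarrow> wsc ok n A \<and> wsc ok n x \<and> wsc ok n y"
| "wsc ok n (XR A x) \<longleftrightarrow> wsc ok n A \<and> wsc ok n x"
| "wsc ok n (XJ A C c x y p) \<longleftrightarrow> wsc ok n A \<and> wsc ok (Suc (Suc (Suc n))) C \<and> wsc ok (Suc n) c \<and>
     wsc ok n x \<and> wsc ok n y \<and> wsc ok n p"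
| "wsc ok n (XM m as) \<longleftrightarrow> ok m \<and> list_all id (map (wsc ok n) as)"

lemma den_cong: "wsc ok n t \<Longrightarrow> (\<And>m. ok m \<Longrightarrow> D m = D' m) \<Longrightarrow> den D t = den D' t"
proof (induction t arbitrary: n)
  case (XM m as)
  then have "map (den D) as = map (den D') as" by (auto simp: list_all_iff)
  with XM.prems show ?case by (simp only: den.simps wsc.simps)
qed auto

lemma scoped_ren: "scoped n t \<Longrightarrow> (\<And>i. i < n \<Longrightarrow> r i < k) \<Longrightarrow> scoped k (ren r t)"
proof (induction t arbitrary: n k r)
  case (Lam A t)
  have "\<And>i. i < Suc n \<Longrightarrow> up_ren r i < Suc k" using Lam.prems by (auto split: nat.split)
  with Lam show ?case by fastforce
next
  case (Pi A t)
  have "\<And>i. i < Suc n \<Longrightarrow> up_ren r i < Suc k" using Pi.prems by (auto split: nat.split)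
  with Pi show ?case by fastforce
qed auto

lemma scoped_sub: "(\<And>i. scoped k (s i)) \<Longrightarrow> scoped k (sub s t)"
proof (induction t arbitrary: k s)
  case (Lam A t)
  have "\<And>i. scoped (Suc k) (up_sub s i)" using Lam.prems by
    (simp split: nat.split) (meson Suc_mono scoped_ren)
  with Lam show ?case by simp
next
  case (Pi A t)
  have "\<And>i. scoped (Suc k) (up_sub s i)" using Pi.prems by
    (simp split: nat.split) (meson Suc_mono scoped_ren)
  with Pi show ?case by simp
qed auto

lemma scoped_den: "wsc ok n t \<Longrightarrow> scoped n (den D t)"
proof (induction t arbitrary: n)
  case (XM m as)
  then have "\<And>i. scoped n (msub (rev (map (den D) as)) i)"
    by (auto simp: msub_def list_all_iff rev_nth)
  then show ?case by (simp add: scoped_sub)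
next
  case (XJ A C c x y p)
  then have "scoped n (den D A)" by simp
  then have "scoped (Suc n) (ren Suc (den D A))" "scoped (Suc (Suc n)) (ren (\<lambda>k. k + 2) (den D A))"
    by (rule scoped_ren; simp)+
  with XJ show ?case by (simp add: rawJ_def motJ_def rawId_def)
qed (simp_all add: rawId_def rawRefl_def)

primrec ctxok :: "'m sg \<Rightarrow> (const \<Rightarrow> 'm xtm option) \<Rightarrow> ('m \<Rightarrow> bool) \<Rightarrow> 'm xtm list \<Rightarrow> 'm xtm list \<Rightarrow> 'm xtm list option" where
  "ctxok e kty ok G [] = Some G"
| "ctxok e kty ok G (T # Ts) =
    (case run e kty ok (Typ G T) of None \<Rightarrow> None | Some _ \<Rightarrow> ctxok e kty ok (T # G) Ts)"

definition check :: "'m sg \<Rightarrow> (const \<Rightarrow> 'm xtm option) \<Rightarrow> ('m \<Rightarrow> bool) \<Rightarrow> 'm \<Rightarrow> bool" where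
  "check e kty ok m \<longleftrightarrow> (case ctxok e kty ok [] (tele (e m)) of None \<Rightarrow> False
     | Some G \<Rightarrow> run e kty ok (Chk G (body (e m)) (mty (e m))) \<noteq> None)"

context signature
begin

lemma ctxok_wf: "ctxok e kty ok G Ts = Some H \<Longrightarrow> wf_ctx \<langle>G\<rangle> \<Longrightarrow> H = rev Ts @ G \<and> wf_ctx \<langle>H\<rangle>"
proof (induction Ts arbitrary: G)
  case (Cons T Ts)
  then obtain U where U: "R (Typ G T) = Some U" and H: "ctxok e kty ok (T # G) Ts = Some H"
    by (auto split: option.splits)
  from run_sound[OF U] sound_Typ Cons.prems(2) obtain k where "infers G T (XU k)" by blast
  from Cons.IH[OF H wf_extend[OF this Cons.prems(2)]] show ?case by auto
qed simp

lemma check_typed: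
  assumes "check e kty ok m"
  shows "rev (map (den D) (tele (e m))) \<turnstile> D m \<^bold>: den D (mty (e m))"
proof -
  from assms obtain G a where G: "ctxok e kty ok [] (tele (e m)) = Some G"
    and a: "R (Chk G (body (e m)) (mty (e m))) = Some a"
    by (auto simp: check_def split: option.splits)
  have "wf_ctx \<langle>[]\<rangle>" by (simp add: ctx_empty)
  from ctxok_wf[OF G this] have wf: "wf_ctx \<langle>G\<rangle>" and G': "\<langle>G\<rangle> = rev (map (den D) (tele (e m)))"
    by (auto simp: rev_map)
  from run_sound[OF a] wf obtain T where "infers G (body (e m)) T" "sle \<langle>G\<rangle> \<lbrakk>T\<rbrakk> \<lbrakk>mty (e m)\<rbrakk>" by auto
  with infers_typed(1)[OF _ wf] have "\<langle>G\<rangle> \<turnstile> \<lbrakk>body (e m)\<rbrakk> \<^bold>: \<lbrakk>mty (e m)\<rbrakk>" by (blast intro: sleD)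
  then show ?thesis by (simp only: G' D[symmetric])
qed

end

locale development =
  fixes e :: "'m sg" and kty :: "const \<Rightarrow> 'm xtm option" and rank :: "'m \<Rightarrow> nat"
  assumes body_below: "\<And>m. wsc (\<lambda>m'. rank m' < rank m) (length (tele (e m))) (body (e m))"
begin

text \<open>The guard on the rank makes the recursion terminate. By \<open>body_below\<close> its
  default value is never reached, so the plain equation \<open>D_body\<close> holds.\<close>

function D :: "'m \<Rightarrow> tm" where
  "D m = den (\<lambda>m'. if rank m' < rank m then D m' else Univ 0) (body (e m))"
  by auto
termination by (relation "measure rank") auto

declare D.simps [simp del]

lemma D_body: "D m = den D (body (e m))"
  by (subst D.simps) (rule den_cong[OF body_below], simp)

lemma scoped_D: "scoped (length (tele (e m))) (D m)"
  by (subst D_body) (rule scoped_den[OF body_below])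

text \<open>The modes of unfolding may differ between the two signatures, because the interpretation
  depends on telescopes and bodies alone. With no constant typed and no definition relied on, the
  typing assumptions of \<open>signature\<close> hold vacuously.\<close>

lemma den_expand_sg: "(\<And>m. tele (e' m) = tele (e m) \<and> body (e' m) = body (e m)) \<Longrightarrow>
  den D (expand e' t) = den D t"
proof -
  assume *: "\<And>m. tele (e' m) = tele (e m) \<and> body (e' m) = body (e m)"
  interpret s: signature e' "\<lambda>_. None" "\<lambda>_. False" D
  proof
    show "D m = den D (body (e' m))" for m using *[of m] D_body[of m] by simp
    show "scoped (length (tele (e' m))) (D m)" for m
      using * by (simp add: scoped_D)
  qed simp_all
  show ?thesis by (rule s.den_expand)
qed

text \<open>Once all definitions are expanded, the interpretation does not depend on
  \<open>D\<close> and can be computed outright.\<close>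

lemma den_expanded:
  assumes "\<And>m. tele (e' m) = tele (e m) \<and> body (e' m) = body (e m)"
    and "wsc (\<lambda>_. False) k ((expand e' ^^ n) t)"
  shows "den D t = den (\<lambda>_. Univ 0) ((expand e' ^^ n) t)"
proof -
  have "den D ((expand e' ^^ n) t) = den D t"
    by (induction n) (simp_all add: den_expand_sg[OF assms(1)])
  with den_cong[OF assms(2), of D "\<lambda>_. Univ 0"] show ?thesis by simp
qed

text \<open>Induction on the rank: while a definition is checked, those of smaller rank are relied
  on, and they are typed by the induction hypothesis.\<close>

theorem typed:
  assumes kty: "\<And>c T. kty c = Some T \<Longrightarrow> den D T = cty 0 0 c 0"
    and check: "\<And>m. check e kty (\<lambda>m'. rank m' < rank m) m"
  shows "rev (map (den D) (tele (e m))) \<turnstile> D m \<^bold>: den D (mty (e m))"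
proof (induction m rule: measure_induct_rule[of rank])
  case (less m)
  interpret signature e kty "\<lambda>m'. rank m' < rank m" D
  proof
    show "D m' = den D (body (e m'))" for m' by (rule D_body)
    show "scoped (length (tele (e m'))) (D m')" for m'
      by (rule scoped_D)
    show "\<Gamma> \<turnstile> Con c \<^bold>: den D T" if "kty c = Some T" "wf_ctx \<Gamma>" for c T \<Gamma>
      using ty_con[OF that(2)] kty[OF that(1)] by metis
  qed (rule less)
  show ?case by (rule check_typed[OF check])
qed

end

section \<open>The homotopy-theoretic argument, written in the object theory\<close>

section \<open>The development\<close>

datatype (plugins only: code) mac =
    Cat | Inv | Ap | Tr | TrCat | TrInv | DComm
  | WhiskL | WhiskR | Ap2 | RUnit | Assoc | ApId | ApCat | ApCancel | ApCatCancel | CatInv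
  | RetractConj | ConjFst | ConjSnd | InvCat | CatInvCat | CatCatInvCat | HtpyConj
  | TrNat | TrNatId | SwapNat0 | SwapNatEq | SwapNat | CommFix | AssocWhisk | DCommFix
  | PathsTo | TrPath | LoopNat | TrPathLoop | EH0 | EH | EHBase
  | TrOver | TrOverInv | ActPath | ActTrivial | ActTrivialBase | LoopOver | CellOver | BHSection
  | PAct | PUnit | PLift | PCoh0 | PCoh | WBase | PTr | BHConst0 | BHConst
  | TrPathRight | TrReflRight | Susp | North | South | Merid | PathsFrom | AtInl | AtInr | AtGlue
  | BHAcyclic

text \<open>As in the statement, a term is a function of the number of binders above it.\<close>

type_synonym dxt = "nat \<Rightarrow> mac xtm"
type_synonym xpath = "dxt \<times> dxt \<times> dxt \<times> dxt"
type_synonym xtele = "nat \<Rightarrow> mac xtm list \<times> mac xtm \<times> mac xtm"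

definition varX :: "nat \<Rightarrow> dxt" where
  "varX n m = XV (m - (n + 1))"

text \<open>The argument takes place at level 0: BH, its suspension and their identity types lie in
  the lowest universe.\<close>

definition univX :: dxt where
  "univX n = XU 0"

definition conX :: "const \<Rightarrow> dxt" where
  "conX c n = XK c"

definition appX :: "dxt \<Rightarrow> dxt \<Rightarrow> dxt"  (infixl "$" 95) where
  "(f $ a) n = XA (f n) (a n)"

definition lamX :: "dxt \<Rightarrow> (dxt \<Rightarrow> dxt) \<Rightarrow> dxt" where
  "lamX A F n = XL (A n) (F (varX n) (n + 1))"

definition piX :: "dxt \<Rightarrow> (dxt \<Rightarrow> dxt) \<Rightarrow> dxt" where
  "piX A F n = XP (A n) (F (varX n) (n + 1))"

definition arrX :: "dxt \<Rightarrow> dxt \<Rightarrow> dxt"  (infixr "\<rightarrow>" 55) where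
  "(A \<rightarrow> B) n = XP (A n) (B (n + 1))"

definition eqX :: "dxt \<Rightarrow> dxt \<Rightarrow> dxt \<Rightarrow> dxt"  ("(_ \<simeq>[_]/ _)" [66, 0, 66] 65) where
  "(x \<simeq>[A] y) n = XE (A n) (x n) (y n)"

definition reflX :: "dxt \<Rightarrow> dxt \<Rightarrow> dxt" where
  "reflX A x n = XR (A n) (x n)"

definition jX :: "dxt \<Rightarrow> (dxt \<Rightarrow> dxt \<Rightarrow> dxt \<Rightarrow> dxt) \<Rightarrow> (dxt \<Rightarrow> dxt) \<Rightarrow> dxt \<Rightarrow> dxt \<Rightarrow> dxt \<Rightarrow> dxt" where
  "jX A C c x y p n = XJ (A n) (C (varX n) (varX (n + 1)) (varX (n + 2)) (n + 3)) (c (varX n) (n + 1)) (x n) (y n) (p n)"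

definition macX :: "mac \<Rightarrow> dxt list \<Rightarrow> dxt"  (infix "\<triangleright>" 100) where
  "(m \<triangleright> ts) n = XM m (map (\<lambda>t. t n) ts)"

definition teleX :: "dxt \<Rightarrow> (dxt \<Rightarrow> xtele) \<Rightarrow> xtele" where
  "teleX A F n = (case F (varX n) (n + 1) of (ts, T, t) \<Rightarrow> (A n # ts, T, t))"

definition bodyX :: "dxt \<Rightarrow> dxt \<Rightarrow> xtele"  (infix "\<ni>" 50) where
  "(T \<ni> t) n = ([], T n, t n)"

definition entryX :: "mode \<Rightarrow> xtele \<Rightarrow> mac entry" where
  "entryX u F = (case F 0 of (ts, T, t) \<Rightarrow> Entry ts T t u)"

syntax
  "_lamX" :: "pttrns \<Rightarrow> 'a \<Rightarrow> 'b \<Rightarrow> 'c"  ("(3\<Lambda> _\<in>_./ _)" [0, 0, 10] 10)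
  "_piX" :: "pttrns \<Rightarrow> 'a \<Rightarrow> 'b \<Rightarrow> 'c"  ("(3\<Pi> _\<in>_./ _)" [0, 0, 10] 10)
  "_teleX" :: "pttrns \<Rightarrow> 'a \<Rightarrow> 'b \<Rightarrow> 'c"  ("(3\<Delta> _\<in>_./ _)" [0, 0, 10] 10)

translations
  "_lamX (_pttrns x xs) A t" \<rightharpoonup> "_lamX x A (_lamX xs A t)"
  "_lamX x A t" \<rightharpoonup> "CONST lamX A (\<lambda>x. t)"
  "_piX (_pttrns x xs) A t" \<rightharpoonup> "_piX x A (_piX xs A t)"
  "_piX x A t" \<rightharpoonup> "CONST piX A (\<lambda>x. t)"
  "_teleX (_pttrns x xs) A t" \<rightharpoonup> "_teleX x A (_teleX xs A t)"
  "_teleX x A t" \<rightharpoonup> "CONST teleX A (\<lambda>x. t)"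

text \<open>A path \<open>p\<close> from \<open>x\<close> to \<open>y\<close> in \<open>A\<close> is handled as the tuple \<open>(A, x, y, p)\<close>.\<close>

fun srcX :: "xpath \<Rightarrow> dxt" where "srcX (A, x, y, p) = x"
fun tgtX :: "xpath \<Rightarrow> dxt" where "tgtX (A, x, y, p) = y"
fun tmX :: "xpath \<Rightarrow> dxt" where "tmX (A, x, y, p) = p"
fun tyX :: "xpath \<Rightarrow> dxt" where "tyX (A, x, y, p) = (x \<simeq>[A] y)"

text \<open>Type and source recorded in the second tuple are dropped. They should agree with type
  and target of the first up to conversion, and the checker verifies this.\<close>

fun path_cat :: "xpath \<Rightarrow> xpath \<Rightarrow> xpath"  (infixr "\<odot>" 75) where
  "(A, x, y, p) \<odot> (B, z, w, q) = (A, x, w, Cat \<triangleright> [A, x, y, w, p, q])"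

fun path_inv :: "xpath \<Rightarrow> xpath"  ("_\<inverse>" [100] 100) where
  "(A, x, y, p)\<inverse> = (A, y, x, Inv \<triangleright> [A, x, y, p])"

fun path_ap :: "dxt \<Rightarrow> dxt \<Rightarrow> xpath \<Rightarrow> xpath" where
  "path_ap B f (A, x, y, p) = (B, f $ x, f $ y, Ap \<triangleright> [A, B, f, x, y, p])"

definition path_refl :: "dxt \<Rightarrow> dxt \<Rightarrow> xpath" where
  "path_refl A x = (A, x, x, reflX A x)"

fun path_eq :: "xpath \<Rightarrow> xpath \<Rightarrow> dxt"  (infix "\<doteq>" 65) where
  "p \<doteq> q = (tmX p \<simeq>[tyX p] tmX q)"

fun path2 :: "xpath \<Rightarrow> xpath \<Rightarrow> dxt \<Rightarrow> xpath" where
  "path2 p q e = (tyX p, tmX p, tmX q, e)"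

fun path_J :: "xpath \<Rightarrow> (dxt \<Rightarrow> dxt \<Rightarrow> dxt \<Rightarrow> dxt) \<Rightarrow> (dxt \<Rightarrow> dxt) \<Rightarrow> dxt" where
  "path_J (A, x, y, p) C c = jX A C c x y p"

fun path_body :: "xpath \<Rightarrow> xtele" where
  "path_body p = (tyX p \<ni> tmX p)"

fun whiskL :: "xpath \<Rightarrow> xpath \<Rightarrow> xpath \<Rightarrow> dxt \<Rightarrow> xpath" where
  "whiskL (A, x, y, p) (B, z, w, q) q' e =
     path2 ((A, x, y, p) \<odot> (B, z, w, q)) ((A, x, y, p) \<odot> q') (WhiskL \<triangleright> [A, x, y, w, p, q, tmX q', e])"

fun whiskR :: "xpath \<Rightarrow> xpath \<Rightarrow> dxt \<Rightarrow> xpath \<Rightarrow> xpath" where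
  "whiskR (A, x, y, p) p' e (B, z, w, q) =
     path2 ((A, x, y, p) \<odot> (B, z, w, q)) (p' \<odot> (B, z, w, q)) (WhiskR \<triangleright> [A, x, y, w, p, tmX p', e, q])"

fun path_ap2 :: "dxt \<Rightarrow> dxt \<Rightarrow> xpath \<Rightarrow> xpath \<Rightarrow> dxt \<Rightarrow> xpath" where
  "path_ap2 B f (A, x, y, p) p' e =
     path2 (path_ap B f (A, x, y, p)) (path_ap B f p') (Ap2 \<triangleright> [A, B, f, x, y, p, tmX p', e])"

fun rUnit :: "xpath \<Rightarrow> xpath" where
  "rUnit (A, x, y, p) =
     path2 (A, x, y, p) ((A, x, y, p) \<odot> path_refl A y) (RUnit \<triangleright> [A, x, y, p])"

lemmas dsl_simps [simp] = varX_def univX_def conX_def appX_def lamX_def piX_def arrX_def eqX_def reflX_def jX_def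
  macX_def teleX_def bodyX_def entryX_def path_refl_def

text \<open>The depths of binders are evaluated as numerals.\<close>

declare One_nat_def [simp del]

subsection \<open>Paths and transport\<close>

abbreviation "trX A P x y p \<equiv> Tr \<triangleright> [A, P, x, y, p]"

text \<open>Argument 4, counted from 0, is the first path, on which the induction runs as in
  \<open>cat\<close>. Hence reflexivity is a judgmental left unit, while the right unit law is the
  path \<open>RUnit\<close>.\<close>

definition "e_Cat = entryX (At 4) (\<Delta> A\<in>univX. \<Delta> x y z\<in>A. \<Delta> p\<in>x \<simeq>[A] y. \<Delta> q\<in>y \<simeq>[A] z.
  x \<simeq>[A] z \<ni> jX A (\<lambda>x y p. \<Pi> z\<in>A. y \<simeq>[A] z \<rightarrow> x \<simeq>[A] z) (\<lambda>x. \<Lambda> z\<in>A. \<Lambda> q\<in>x \<simeq>[A] z. q) x y p $ z $ q)"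

definition "e_Inv = entryX (At 3) (\<Delta> A\<in>univX. \<Delta> x y\<in>A. \<Delta> p\<in>x \<simeq>[A] y.
  y \<simeq>[A] x \<ni> jX A (\<lambda>x y p. y \<simeq>[A] x) (\<lambda>x. reflX A x) x y p)"

definition "e_Ap = entryX (At 5) (\<Delta> A\<in>univX. \<Delta> B\<in>univX. \<Delta> f\<in>A \<rightarrow> B. \<Delta> x y\<in>A. \<Delta> p\<in>x \<simeq>[A] y.
  f $ x \<simeq>[B] f $ y \<ni> jX A (\<lambda>x y p. f $ x \<simeq>[B] f $ y) (\<lambda>x. reflX B (f $ x)) x y p)"

definition "e_Tr = entryX (At 4) (\<Delta> A\<in>univX. \<Delta> P\<in>A \<rightarrow> univX. \<Delta> x y\<in>A. \<Delta> p\<in>x \<simeq>[A] y.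
  P $ x \<rightarrow> P $ y \<ni> jX A (\<lambda>x y p. P $ x \<rightarrow> P $ y) (\<lambda>x. \<Lambda> u\<in>P $ x. u) x y p)"

definition "trCat_ty A P x y z p q u =
  (trX A P x z (Cat \<triangleright> [A, x, y, z, p, q]) $ u \<simeq>[P $ z] trX A P y z q $ (trX A P x y p $ u))"

definition "e_TrCat = entryX (At 5)
  (\<Delta> A\<in>univX. \<Delta> P\<in>A \<rightarrow> univX. \<Delta> x y z\<in>A. \<Delta> p\<in>x \<simeq>[A] y. \<Delta> q\<in>y \<simeq>[A] z. \<Delta> u\<in>P $ x.
   trCat_ty A P x y z p q u \<ni>
   jX A (\<lambda>x y p. \<Pi> z\<in>A. \<Pi> q\<in>y \<simeq>[A] z. \<Pi> u\<in>P $ x. trCat_ty A P x y z p q u)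
     (\<lambda>x. \<Lambda> z\<in>A. \<Lambda> q\<in>x \<simeq>[A] z. \<Lambda> u\<in>P $ x. reflX (P $ z) (trX A P x z q $ u)) x y p $ z $ q $ u)"

definition "trInv_ty A P x y p =
  (\<Pi> u\<in>P $ x. trX A P y x (Inv \<triangleright> [A, x, y, p]) $ (trX A P x y p $ u) \<simeq>[P $ x] u)"

definition "e_TrInv = entryX (At 4) (\<Delta> A\<in>univX. \<Delta> P\<in>A \<rightarrow> univX. \<Delta> x y\<in>A. \<Delta> p\<in>x \<simeq>[A] y.
  trInv_ty A P x y p \<ni> jX A (trInv_ty A P) (\<lambda>x. \<Lambda> u\<in>P $ x. reflX (P $ x) u) x y p)"

definition "trAp A P y z q a b s = path_ap (P $ z) (trX A P y z q) (P $ y, a, b, s)"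

definition "dcatX A P x y z p q u v w s t =
  tmX ((P $ z, trX A P x z (Cat \<triangleright> [A, x, y, z, p, q]) $ u, trX A P y z q $ (trX A P x y p $ u),
        TrCat \<triangleright> [A, P, x, y, z, p, q, u])
    \<odot> trAp A P y z q (trX A P x y p $ u) v s \<odot> (P $ z, trX A P y z q $ v, w, t))"

definition "dinvX A P x y p u v s =
  tmX (trAp A P y x (Inv \<triangleright> [A, x, y, p]) v (trX A P x y p $ u) (Inv \<triangleright> [P $ y, trX A P x y p $ u, v, s])
    \<odot> (P $ x, trX A P y x (Inv \<triangleright> [A, x, y, p]) $ (trX A P x y p $ u), u, TrInv \<triangleright> [A, P, x, y, p] $ u))"

definition "commX A x p q =
  tmX ((((A, x, x, p) \<odot> (A, x, x, q)) \<odot> (A, x, x, p)\<inverse>) \<odot> (A, x, x, q)\<inverse>)"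

definition "overX A P x u p = (trX A P x x p $ u \<simeq>[P $ x] u)"

definition "e_DComm = entryX Always (\<Delta> A\<in>univX. \<Delta> P\<in>A \<rightarrow> univX. \<Delta> x\<in>A. \<Delta> p q\<in>x \<simeq>[A] x. \<Delta> u\<in>P $ x.
  \<Delta> s\<in>overX A P x u p. \<Delta> t\<in>overX A P x u q.
  overX A P x u (commX A x p q) \<ni>
  (let p' = Inv \<triangleright> [A, x, x, p]; q' = Inv \<triangleright> [A, x, x, q];
       pq = Cat \<triangleright> [A, x, x, x, p, q]; pqp' = Cat \<triangleright> [A, x, x, x, pq, p'];
       d = (\<lambda>p q. dcatX A P x x x p q u u u) in
   d pqp' q' (d pq p' (d p q s t) (dinvX A P x x p u u s)) (dinvX A P x x q u u t)))"

section \<open>Path algebra and cancellation of inverse transports\<close>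

subsection \<open>Whiskering and naturality\<close>

definition "whiskL_ty A x y z p q q' = ((A, x, y, p) \<odot> (A, y, z, q) \<doteq> (A, x, y, p) \<odot> (A, y, z, q'))"

definition "e_WhiskL = entryX (At 7)
  (\<Delta> A\<in>univX. \<Delta> x y z\<in>A. \<Delta> p\<in>x \<simeq>[A] y. \<Delta> q q'\<in>y \<simeq>[A] z. \<Delta> e\<in>q \<simeq>[y \<simeq>[A] z] q'.
   whiskL_ty A x y z p q q' \<ni>
   jX (y \<simeq>[A] z) (\<lambda>q q' e. whiskL_ty A x y z p q q')
     (\<lambda>q. reflX (x \<simeq>[A] z) (Cat \<triangleright> [A, x, y, z, p, q])) q q' e)"

definition "whiskR_ty A x y z p p' q = ((A, x, y, p) \<odot> (A, y, z, q) \<doteq> (A, x, y, p') \<odot> (A, y, z, q))"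

text \<open>Definitions of mode \<open>Never\<close> serve as lemmas: later steps rely on their
  types, and normal forms stop at them.\<close>

definition "e_WhiskR = entryX Never
  (\<Delta> A\<in>univX. \<Delta> x y z\<in>A. \<Delta> p p'\<in>x \<simeq>[A] y. \<Delta> e\<in>p \<simeq>[x \<simeq>[A] y] p'. \<Delta> q\<in>y \<simeq>[A] z.
   whiskR_ty A x y z p p' q \<ni>
   jX (x \<simeq>[A] y) (\<lambda>p p' e. whiskR_ty A x y z p p' q)
     (\<lambda>p. reflX (x \<simeq>[A] z) (Cat \<triangleright> [A, x, y, z, p, q])) p p' e)"

definition "ap2_ty A B f x y p p' = (path_ap B f (A, x, y, p) \<doteq> path_ap B f (A, x, y, p'))"

definition "e_Ap2 = entryX Never
  (\<Delta> A\<in>univX. \<Delta> B\<in>univX. \<Delta> f\<in>A \<rightarrow> B. \<Delta> x y\<in>A. \<Delta> p p'\<in>x \<simeq>[A] y. \<Delta> e\<in>p \<simeq>[x \<simeq>[A] y] p'.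
   ap2_ty A B f x y p p' \<ni>
   jX (x \<simeq>[A] y) (\<lambda>p p' e. ap2_ty A B f x y p p')
     (\<lambda>p. reflX (f $ x \<simeq>[B] f $ y) (Ap \<triangleright> [A, B, f, x, y, p])) p p' e)"

definition "rUnit_ty A x y p = ((A, x, y, p) \<doteq> (A, x, y, p) \<odot> path_refl A y)"

definition "e_RUnit = entryX (At 3) (\<Delta> A\<in>univX. \<Delta> x y\<in>A. \<Delta> p\<in>x \<simeq>[A] y.
  rUnit_ty A x y p \<ni> jX A (rUnit_ty A) (\<lambda>x. reflX (x \<simeq>[A] x) (reflX A x)) x y p)"

definition "assoc_ty A x y z w p q r =
  ((A, x, y, p) \<odot> (A, y, z, q) \<odot> (A, z, w, r) \<doteq> ((A, x, y, p) \<odot> (A, y, z, q)) \<odot> (A, z, w, r))"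

definition "e_Assoc = entryX Never
  (\<Delta> A\<in>univX. \<Delta> x y z w\<in>A. \<Delta> p\<in>x \<simeq>[A] y. \<Delta> q\<in>y \<simeq>[A] z. \<Delta> r\<in>z \<simeq>[A] w.
   assoc_ty A x y z w p q r \<ni>
   jX A (\<lambda>x y p. \<Pi> q\<in>y \<simeq>[A] z. assoc_ty A x y z w p q r)
     (\<lambda>x. \<Lambda> q\<in>x \<simeq>[A] z. reflX (x \<simeq>[A] w) (Cat \<triangleright> [A, x, z, w, q, r])) x y p $ q)"

definition "apId_ty A x y p = ((A, x, y, p) \<doteq> path_ap A (\<Lambda> x\<in>A. x) (A, x, y, p))"

definition "e_ApId = entryX Never (\<Delta> A\<in>univX. \<Delta> x y\<in>A. \<Delta> p\<in>x \<simeq>[A] y.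
  apId_ty A x y p \<ni> jX A (apId_ty A) (\<lambda>x. reflX (x \<simeq>[A] x) (reflX A x)) x y p)"

definition "apCat_ty A B f x y z p q =
  (path_ap B f (A, x, y, p) \<odot> path_ap B f (A, y, z, q) \<doteq> path_ap B f ((A, x, y, p) \<odot> (A, y, z, q)))"

definition "e_ApCat = entryX Never
  (\<Delta> A\<in>univX. \<Delta> B\<in>univX. \<Delta> f\<in>A \<rightarrow> B. \<Delta> x y z\<in>A. \<Delta> p\<in>x \<simeq>[A] y. \<Delta> q\<in>y \<simeq>[A] z.
   apCat_ty A B f x y z p q \<ni>
   jX A (\<lambda>x y p. \<Pi> q\<in>y \<simeq>[A] z. apCat_ty A B f x y z p q)
     (\<lambda>x. \<Lambda> q\<in>x \<simeq>[A] z. reflX (f $ x \<simeq>[B] f $ z) (Ap \<triangleright> [A, B, f, x, z, q])) x y p $ q)"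

definition "apCancel_ty X Y g a w s y j =
  (path_ap Y g (X, a, w, s) \<odot> path_ap Y g ((X, a, w, s)\<inverse>) \<odot> (Y, g $ a, y, j) \<doteq> (Y, g $ a, y, j))"

definition "e_ApCancel = entryX Never
  (\<Delta> X\<in>univX. \<Delta> Y\<in>univX. \<Delta> g\<in>X \<rightarrow> Y. \<Delta> a w\<in>X. \<Delta> s\<in>a \<simeq>[X] w. \<Delta> y\<in>Y. \<Delta> j\<in>g $ a \<simeq>[Y] y.
   apCancel_ty X Y g a w s y j \<ni>
   jX X (\<lambda>a w s. \<Pi> j\<in>g $ a \<simeq>[Y] y. apCancel_ty X Y g a w s y j)
     (\<lambda>a. \<Lambda> j\<in>g $ a \<simeq>[Y] y. reflX (g $ a \<simeq>[Y] y) j) a w s $ j)"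

definition "apCatCancel_ty X Y g e a k w s y j =
  (path_ap Y g ((X, e, a, k) \<odot> (X, a, w, s)) \<odot> path_ap Y g ((X, a, w, s)\<inverse>) \<odot> (Y, g $ a, y, j)
     \<doteq> path_ap Y g (X, e, a, k) \<odot> (Y, g $ a, y, j))"

definition "e_ApCatCancel = entryX Never
  (\<Delta> X\<in>univX. \<Delta> Y\<in>univX. \<Delta> g\<in>X \<rightarrow> Y. \<Delta> e a\<in>X. \<Delta> k\<in>e \<simeq>[X] a. \<Delta> w\<in>X. \<Delta> s\<in>a \<simeq>[X] w. \<Delta> y\<in>Y. \<Delta> j\<in>g $ a \<simeq>[Y] y.
   apCatCancel_ty X Y g e a k w s y j \<ni>
   jX X (\<lambda>e a k. \<Pi> s\<in>a \<simeq>[X] w. \<Pi> j\<in>g $ a \<simeq>[Y] y. apCatCancel_ty X Y g e a k w s y j)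
     (\<lambda>a. \<Lambda> s\<in>a \<simeq>[X] w. \<Lambda> j\<in>g $ a \<simeq>[Y] y. ApCancel \<triangleright> [X, Y, g, a, w, s, y, j]) e a k $ s $ j)"

definition "catInv_ty X a b d h s = ((X, a, b, h) \<odot> (X, a, b, h)\<inverse> \<odot> (X, a, d, s) \<doteq> (X, a, d, s))"

definition "e_CatInv = entryX Never (\<Delta> X\<in>univX. \<Delta> a b d\<in>X. \<Delta> h\<in>a \<simeq>[X] b. \<Delta> s\<in>a \<simeq>[X] d.
  catInv_ty X a b d h s \<ni>
  jX X (\<lambda>a b h. \<Pi> s\<in>a \<simeq>[X] d. catInv_ty X a b d h s) (\<lambda>a. \<Lambda> s\<in>a \<simeq>[X] d. reflX (a \<simeq>[X] d) s) a b h $ s)"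

text \<open>
  Conjugating a path \<open>f t\<close> in the image of \<open>f\<close> by its retraction \<open>f'\<close> gives back \<open>t\<close>.  This is how the
  inverse transports in a dependent commutator are eliminated.
\<close>

definition "retractConj_ty X f f' i b u t e k w s =
  (path_ap X f' ((X, e, f $ b, k) \<odot> path_ap X f (X, b, u, t) \<odot> (X, f $ u, w, s))
     \<odot> path_ap X f' ((X, f $ u, w, s)\<inverse>) \<odot> (X, f' $ (f $ u), u, i $ u)
   \<doteq> (path_ap X f' (X, e, f $ b, k) \<odot> (X, f' $ (f $ b), b, i $ b)) \<odot> (X, b, u, t))"

definition "retractConj_refl X f f' i x e k w s =
  (let fx = f $ x; K = (X, e, fx, k); S = (X, fx, w, s); I = (X, f' $ fx, x, i $ x) in
   tmX (path2 (path_ap X f' (K \<odot> S) \<odot> path_ap X f' (S\<inverse>) \<odot> I) (path_ap X f' K \<odot> I)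
          (ApCatCancel \<triangleright> [X, X, f', e, fx, k, w, s, x, i $ x])
        \<odot> rUnit (path_ap X f' K \<odot> I)))"

definition "retractionX X f f' = (\<Pi> v\<in>X. f' $ (f $ v) \<simeq>[X] v)"

definition "e_RetractConj = entryX Never
  (\<Delta> X\<in>univX. \<Delta> f f'\<in>X \<rightarrow> X. \<Delta> i\<in>retractionX X f f'. \<Delta> b u\<in>X. \<Delta> t\<in>b \<simeq>[X] u. \<Delta> e\<in>X. \<Delta> k\<in>e \<simeq>[X] f $ b.
   \<Delta> w\<in>X. \<Delta> s\<in>f $ u \<simeq>[X] w.
   retractConj_ty X f f' i b u t e k w s \<ni>
   jX X (\<lambda>b u t. \<Pi> k\<in>e \<simeq>[X] f $ b. \<Pi> s\<in>f $ u \<simeq>[X] w. retractConj_ty X f f' i b u t e k w s)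
     (\<lambda>x. \<Lambda> k\<in>e \<simeq>[X] f $ x. \<Lambda> s\<in>f $ x \<simeq>[X] w. retractConj_refl X f f' i x e k w s) b u t $ k $ s)"

text \<open>Removes s from the dependent commutator. M will be the dependent path over pq, and f, f'
  the transports along p and its inverse. Since n factors M with s at the end, the inverse of s
  cancels, and t is left in the last place.\<close>

definition "e_ConjFst = entryX Never
  (\<Delta> X\<in>univX. \<Delta> f f'\<in>X \<rightarrow> X. \<Delta> i\<in>retractionX X f f'. \<Delta> u b\<in>X. \<Delta> t\<in>b \<simeq>[X] u. \<Delta> s\<in>f $ u \<simeq>[X] u. \<Delta> e\<in>X.
   \<Delta> m\<in>e \<simeq>[X] u. \<Delta> k\<in>e \<simeq>[X] f $ b.
   \<Delta> n\<in>(X, e, f $ b, k) \<odot> path_ap X f (X, b, u, t) \<odot> (X, f $ u, u, s) \<doteq> (X, e, u, m).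
   (let T = (X, b, u, t); S = (X, f $ u, u, s); K = (X, e, f $ b, k); M = (X, e, u, m);
        KS = K \<odot> path_ap X f T \<odot> S; D = path_ap X f' (S\<inverse>) \<odot> (X, f' $ (f $ u), u, i $ u) in
    path_body (whiskR (path_ap X f' M) (path_ap X f' KS) (tmX (path_ap2 X f' M KS (tmX ((path2 KS M n)\<inverse>)))) D
      \<odot> path2 (path_ap X f' KS \<odot> D) ((path_ap X f' K \<odot> (X, f' $ (f $ b), b, i $ b)) \<odot> T)
          (RetractConj \<triangleright> [X, f, f', i, b, u, t, e, k, u, s]))))"

text \<open>Removes t. By h the dependent path over p q and the inverse of p ends in t, which
  cancels against the inverse of t coming from the last factor of the commutator.\<close>

definition "e_ConjSnd = entryX Never
  (\<Delta> X\<in>univX. \<Delta> g\<in>X \<rightarrow> X. \<Delta> u b\<in>X. \<Delta> t\<in>b \<simeq>[X] u. \<Delta> j\<in>g $ b \<simeq>[X] u. \<Delta> d\<in>X. \<Delta> a\<in>d \<simeq>[X] u. \<Delta> m\<in>d \<simeq>[X] b.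
   \<Delta> h\<in>a \<simeq>[d \<simeq>[X] u] Cat \<triangleright> [X, d, b, u, m, t]. \<Delta> e2\<in>X. \<Delta> c2\<in>e2 \<simeq>[X] d. \<Delta> e1\<in>X. \<Delta> c1\<in>e1 \<simeq>[X] g $ e2.
   (let T = (X, b, u, t); J = (X, g $ b, u, j); A = (X, d, u, a); M = (X, d, b, m);
        C2 = (X, e2, d, c2); C1 = (X, e1, g $ e2, c1); D = path_ap X g (T\<inverse>) \<odot> J;
        CA = C2 \<odot> A; CMT = (C2 \<odot> M) \<odot> T;
        H = whiskL C2 A (M \<odot> T) h \<odot> path2 (C2 \<odot> M \<odot> T) CMT (Assoc \<triangleright> [X, e2, d, b, u, c2, m, t]);
        Z = path_ap X g CA \<odot> D; Z' = path_ap X g (C2 \<odot> M) \<odot> J in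
    path_body (whiskL C1 Z Z'
      (tmX (whiskR (path_ap X g CA) (path_ap X g CMT) (tmX (path_ap2 X g CA CMT (tmX H))) D
        \<odot> path2 (path_ap X g CMT \<odot> D) Z'
            (ApCatCancel \<triangleright> [X, X, g, e2, b, tmX (C2 \<odot> M), u, t, u, j]))))))"

definition "invCat_ty X d a x h k =
  ((X, d, a, h)\<inverse> \<odot> (X, d, a, h) \<odot> (X, a, x, k) \<doteq> (X, a, x, k) \<odot> path_refl X x)"

definition "e_InvCat = entryX Never (\<Delta> X\<in>univX. \<Delta> d a x\<in>X. \<Delta> h\<in>d \<simeq>[X] a. \<Delta> k\<in>a \<simeq>[X] x.
  invCat_ty X d a x h k \<ni>
  jX X (\<lambda>d a h. \<Pi> k\<in>a \<simeq>[X] x. invCat_ty X d a x h k) (\<lambda>a. \<Lambda> k\<in>a \<simeq>[X] x. RUnit \<triangleright> [X, a, x,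
    k]) d a h $ k)"

definition "catInvCat_ty X z a d x n h k =
  (((X, z, a, n) \<odot> (X, d, a, h)\<inverse>) \<odot> (X, d, a, h) \<odot> (X, a, x, k)
     \<doteq> ((X, z, a, n) \<odot> (X, a, x, k)) \<odot> path_refl X x)"

definition "e_CatInvCat = entryX Never
  (\<Delta> X\<in>univX. \<Delta> z a d x\<in>X. \<Delta> n\<in>z \<simeq>[X] a. \<Delta> h\<in>d \<simeq>[X] a. \<Delta> k\<in>a \<simeq>[X] x.
   catInvCat_ty X z a d x n h k \<ni>
   jX X (\<lambda>z a n. \<Pi> h\<in>d \<simeq>[X] a. \<Pi> k\<in>a \<simeq>[X] x. catInvCat_ty X z a d x n h k)
     (\<lambda>a. \<Lambda> h\<in>d \<simeq>[X] a. \<Lambda> k\<in>a \<simeq>[X] x. InvCat \<triangleright> [X, d, a, x, h, k]) z a n $ h $ k)"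

definition "catCatInvCat_ty X y z a d x r n h k =
  (((X, y, z, r) \<odot> (X, z, a, n) \<odot> (X, d, a, h)\<inverse>) \<odot> (X, d, a, h) \<odot> (X, a, x, k)
     \<doteq> ((X, y, z, r) \<odot> (X, z, a, n) \<odot> (X, a, x, k)) \<odot> path_refl X x)"

definition "e_CatCatInvCat = entryX Never
  (\<Delta> X\<in>univX. \<Delta> y z a d x\<in>X. \<Delta> r\<in>y \<simeq>[X] z. \<Delta> n\<in>z \<simeq>[X] a. \<Delta> h\<in>d \<simeq>[X] a. \<Delta> k\<in>a \<simeq>[X] x.
   catCatInvCat_ty X y z a d x r n h k \<ni>
   jX X (\<lambda>y z r. \<Pi> n\<in>z \<simeq>[X] a. catCatInvCat_ty X y z a d x r n h k)
     (\<lambda>z. \<Lambda> n\<in>z \<simeq>[X] a. CatInvCat \<triangleright> [X, z, a, d, x, n, h, k]) y z r $ n)"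

definition "homotopyX X f g = (\<Pi> v\<in>X. f $ v \<simeq>[X] g $ v)"

text \<open>Naturality along T of the composite homotopy from f to the identity, with
  \<open>H b\<close> cancelled against the inverse in front.\<close>

definition "htpyConj_ty X f g h k b u t y z r n =
  (let H = (\<lambda>v. (X, f $ v, g $ v, h $ v)); K = (\<lambda>v. (X, g $ v, v, k $ v));
       T = (X, b, u, t); R = (X, y, z, r); N = (X, z, g $ b, n) in
   (R \<odot> N \<odot> (H b)\<inverse>) \<odot> path_ap X f T \<odot> H u \<odot> K u \<doteq> (R \<odot> N \<odot> K b) \<odot> T)"

definition "e_HtpyConj = entryX Never
  (\<Delta> X\<in>univX. \<Delta> f g\<in>X \<rightarrow> X. \<Delta> h\<in>homotopyX X f g. \<Delta> k\<in>\<Pi> v\<in>X. g $ v \<simeq>[X] v. \<Delta> b u\<in>X. \<Delta> t\<in>b \<simeq>[X] u.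
   \<Delta> y z\<in>X. \<Delta> r\<in>y \<simeq>[X] z. \<Delta> n\<in>z \<simeq>[X] g $ b.
   htpyConj_ty X f g h k b u t y z r n \<ni>
   jX X (\<lambda>b u t. \<Pi> n\<in>z \<simeq>[X] g $ b. htpyConj_ty X f g h k b u t y z r n)
     (\<lambda>x. \<Lambda> n\<in>z \<simeq>[X] g $ x. CatCatInvCat \<triangleright> [X, y, z, g $ x, f $ x, x, r, n, h $ x, k $ x]) b u t $ n)"

section \<open>Independence of the dependent commutator from its two paths\<close>

subsection \<open>Dependent commutators\<close>

definition "fibrewiseX A P = (\<Pi> x\<in>A. P $ x \<rightarrow> P $ x)"
definition "fibrewiseId A P g = (\<Pi> x\<in>A. \<Pi> v\<in>P $ x. g $ x $ v \<simeq>[P $ x] v)"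

definition "trNat_ty A P g x y q v =
  (trX A P x y q $ (g $ x $ v) \<simeq>[P $ y] g $ y $ (trX A P x y q $ v))"

definition "e_TrNat = entryX (At 5)
  (\<Delta> A\<in>univX. \<Delta> P\<in>A \<rightarrow> univX. \<Delta> g\<in>fibrewiseX A P. \<Delta> x y\<in>A. \<Delta> q\<in>x \<simeq>[A] y. \<Delta> v\<in>P $ x.
   trNat_ty A P g x y q v \<ni>
   jX A (\<lambda>x y q. \<Pi> v\<in>P $ x. trNat_ty A P g x y q v) (\<lambda>x. \<Lambda> v\<in>P $ x. reflX (P $ x) (g $ x $ v)) x y q $ v)"

text \<open>If a fibrewise map is homotopic to the identity, its naturality square with transport is
  filled by the homotopy on both sides; at reflexivity this is \<open>ApId\<close>.\<close>

definition "trNatId_ty A P g k x y q v =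
  (let w = trX A P x y q $ v in
   (P $ y, trX A P x y q $ (g $ x $ v), g $ y $ w, TrNat \<triangleright> [A, P, g, x, y, q, v]) \<odot> (P $ y, g $ y $ w,
     w, k $ y $ w)
     \<doteq> trAp A P x y q (g $ x $ v) v (k $ x $ v))"

definition "e_TrNatId = entryX Never
  (\<Delta> A\<in>univX. \<Delta> P\<in>A \<rightarrow> univX. \<Delta> g\<in>fibrewiseX A P. \<Delta> k\<in>fibrewiseId A P g. \<Delta> x y\<in>A. \<Delta> q\<in>x \<simeq>[A] y. \<Delta> v\<in>P $ x.
   trNatId_ty A P g k x y q v \<ni>
   jX A (\<lambda>x y q. \<Pi> v\<in>P $ x. trNatId_ty A P g k x y q v)
     (\<lambda>x. \<Lambda> v\<in>P $ x. ApId \<triangleright> [P $ x, g $ x $ v, v, k $ x $ v]) x y q $ v)"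

text \<open>Commutes f with q by way of g: replace f by g, move g past q by n, and return from g to
  f. Only h and n enter, neither s nor t.\<close>

definition "swapX X f g h q u n =
  path_ap X q (X, f $ u, g $ u, h $ u) \<odot> (X, q $ (g $ u), g $ (q $ u), n) \<odot> (X, f $ (q $ u),
    g $ (q $ u), h $ (q $ u))\<inverse>"

definition "swapNat_ty X f g h q u n t s =
  (swapX X f g h q u n \<odot> path_ap X f (X, q $ u, u, t) \<odot> (X, f $ u, u, s)
     \<doteq> path_ap X q (X, f $ u, u, s) \<odot> (X, q $ u, u, t))"

text \<open>The case in which s is the composite of H and K. Naturality of this composite carries t
  to the end; what precedes t is q applied to H and K, by \<open>l\<close> and functoriality. Other
  s are reached by \<open>SwapNatEq\<close>.\<close>

definition "e_SwapNat0 = entryX Never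
  (\<Delta> X\<in>univX. \<Delta> f g\<in>X \<rightarrow> X. \<Delta> h\<in>homotopyX X f g. \<Delta> k\<in>\<Pi> v\<in>X. g $ v \<simeq>[X] v. \<Delta> q\<in>X \<rightarrow> X. \<Delta> u\<in>X.
   \<Delta> n\<in>q $ (g $ u) \<simeq>[X] g $ (q $ u).
   \<Delta> l\<in>(X, q $ (g $ u), g $ (q $ u), n) \<odot> (X, g $ (q $ u), q $ u, k $ (q $ u)) \<doteq> path_ap X q (X,
     g $ u, u, k $ u).
   \<Delta> t\<in>q $ u \<simeq>[X] u.
   (let b = q $ u; H = (X, f $ u, g $ u, h $ u); K = (X, g $ u, u, k $ u); T = (X, b, u, t);
        R = path_ap X q H; NK = (X, q $ (g $ u), g $ b, n) \<odot> (X, g $ b, b, k $ b);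
        L = swapX X f g h q u n \<odot> path_ap X f T \<odot> H \<odot> K in
    path_body (path2 L ((R \<odot> NK) \<odot> T) (HtpyConj \<triangleright> [X, f, g, h, k, b, u, t, q $ (f $ u), q $ (g $ u),
      tmX R, n])
      \<odot> whiskR (R \<odot> NK) (path_ap X q (H \<odot> K))
          (tmX (whiskL R NK (path_ap X q K) l
            \<odot> path2 (R \<odot> path_ap X q K) (path_ap X q (H \<odot> K))
                (ApCat \<triangleright> [X, X, q, f $ u, g $ u, u, h $ u, k $ u]))) T)))"

definition "e_SwapNatEq = entryX Never
  (\<Delta> X\<in>univX. \<Delta> f g\<in>X \<rightarrow> X. \<Delta> h\<in>homotopyX X f g. \<Delta> q\<in>X \<rightarrow> X. \<Delta> u\<in>X. \<Delta> n\<in>q $ (g $ u) \<simeq>[X] g $ (q $ u).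
   \<Delta> t\<in>q $ u \<simeq>[X] u. \<Delta> s s'\<in>f $ u \<simeq>[X] u. \<Delta> e\<in>s \<simeq>[f $ u \<simeq>[X] u] s'. \<Delta> w\<in>swapNat_ty X f g h q u n t s.
   swapNat_ty X f g h q u n t s' \<ni>
   jX (f $ u \<simeq>[X] u) (\<lambda>s s' e. swapNat_ty X f g h q u n t s \<rightarrow> swapNat_ty X f g h q u n t s')
     (\<lambda>s. \<Lambda> w\<in>swapNat_ty X f g h q u n t s. w) s s' e $ w)"

definition "trHtpy A P x p g = (\<Pi> v\<in>P $ x. trX A P x x p $ v \<simeq>[P $ x] g $ x $ v)"

definition "commTele F =
  (\<Delta> A\<in>univX. \<Delta> P\<in>A \<rightarrow> univX. \<Delta> x\<in>A. \<Delta> p q\<in>x \<simeq>[A] x. \<Delta> g\<in>fibrewiseX A P. \<Delta> h\<in>trHtpy A P x p g. \<Delta> u\<in>P $ x.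
   F A P x p q g h u)"

text \<open>k spreads s over the whole family: by e, the homotopy h followed by k is s at the point
  u.\<close>

definition "dcommTele F = commTele (\<lambda>A P x p q g h u.
  \<Delta> k\<in>fibrewiseId A P g. \<Delta> s\<in>overX A P x u p.
  \<Delta> e\<in>(P $ x, trX A P x x p $ u, g $ x $ u, h $ u) \<odot> (P $ x, g $ x $ u, u, k $ x $ u)
     \<doteq> (P $ x, trX A P x x p $ u, u, s).
  \<Delta> t\<in>overX A P x u q. F A P x p q g h u k s e t)"

definition "e_SwapNat = entryX Never (dcommTele (\<lambda>A P x p q g h u k s e t.
  (let X = P $ x; f = trX A P x x p; q' = trX A P x x q; g' = g $ x; n = TrNat \<triangleright> [A, P, g, x, x, q, u];
       s' = tmX ((X, f $ u, g' $ u, h $ u) \<odot> (X, g' $ u, u, k $ x $ u)) in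
   swapNat_ty X f g' h q' u n t s \<ni>
   SwapNatEq \<triangleright> [X, f, g', h, q', u, n, t, s', s, e,
     SwapNat0 \<triangleright> [X, f, g', h, k $ x, q', u, n, TrNatId \<triangleright> [A, P, g, k, x, x, q, u], t]])))"

definition "commCells A P x p q u =
  (let X = P $ x; T = (\<lambda>r v. trX A P x x r $ v); p' = Inv \<triangleright> [A, x, x, p]; q' = Inv \<triangleright> [A, x, x, q];
       pq = Cat \<triangleright> [A, x, x, x, p, q]; pqp' = Cat \<triangleright> [A, x, x, x, pq, p']; c = Cat \<triangleright> [A, x, x, x, pqp',
         q'] in
   ((X, T c u, T q' (T pqp' u), TrCat \<triangleright> [A, P, x, x, x, pqp', q', u]),
    (X, T pqp' u, T p' (T pq u), TrCat \<triangleright> [A, P, x, x, x, pq, p', u]),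
    (X, T pq u, T q (T p u), TrCat \<triangleright> [A, P, x, x, x, p, q, u])))"

definition "trSwap A P x p q g h u =
  swapX (P $ x) (trX A P x x p) (g $ x) h (trX A P x x q) u (TrNat \<triangleright> [A, P, g, x, x, q, u])"

text \<open>What remains of the dependent commutator after s and t have cancelled: transport along
  it is split up, p and q are swapped, and each meets its own inverse.\<close>

definition "commFix A P x p q g h u =
  (let X = P $ x; T = (\<lambda>r v. trX A P x x r $ v); p' = Inv \<triangleright> [A, x, x, p]; q' = Inv \<triangleright> [A, x, x, q];
    b = T q u in
   (case commCells A P x p q u of (C1, C2, C3) \<Rightarrow>
    C1 \<odot> path_ap X (trX A P x x q')
           (C2 \<odot> path_ap X (trX A P x x p') (C3 \<odot> trSwap A P x p q g h u)
              \<odot> (X, T p' (T p b), b, TrInv \<triangleright> [A, P, x, x, p] $ b))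
       \<odot> (X, T q' b, u, TrInv \<triangleright> [A, P, x, x, q] $ u)))"

definition "e_CommFix = entryX Always (commTele (\<lambda>A P x p q g h u.
  overX A P x u (commX A x p q) \<ni> tmX (commFix A P x p q g h u)))"

definition "e_AssocWhisk = entryX Never
  (\<Delta> X\<in>univX. \<Delta> a b c d\<in>X. \<Delta> p\<in>a \<simeq>[X] b. \<Delta> q\<in>b \<simeq>[X] c. \<Delta> r\<in>c \<simeq>[X] d. \<Delta> m\<in>b \<simeq>[X] d.
   \<Delta> e\<in>Cat \<triangleright> [X, b, c, d, q, r] \<simeq>[b \<simeq>[X] d] m.
   (let P = (X, a, b, p); Q = (X, b, c, q); R = (X, c, d, r) in
    path_body ((path2 (P \<odot> Q \<odot> R) ((P \<odot> Q) \<odot> R) (Assoc \<triangleright> [X, a, b, c, d, p, q, r]))\<inverse>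
      \<odot> whiskL P (Q \<odot> R) (X, b, d, m) e)))"

text \<open>
  Transport along \<open>p\<close> is homotopic to a fibrewise map, which transport along \<open>q\<close> commutes with by
  naturality.  If that map is moreover homotopic to the identity, then \<open>s\<close> and \<open>t\<close> commute up to this
  naturality square, and the dependent commutator of \<open>s\<close> and \<open>t\<close> is a path that mentions neither.
\<close>

definition "e_DCommFix = entryX Never (dcommTele (\<lambda>A P x p q g h u k s e t.
  DComm \<triangleright> [A, P, x, p, q, u, s, t] \<simeq>[overX A P x u (commX A x p q)] CommFix \<triangleright> [A, P, x, p, q, g, h, u] \<ni>
  (let X = P $ x; f = trX A P x x; p' = Inv \<triangleright> [A, x, x, p]; q' = Inv \<triangleright> [A, x, x, q]; b = f q $ u;
       S = (X, f p $ u, u, s); T = (X, b, u, t); SW = trSwap A P x p q g h u; i = TrInv \<triangleright> [A, P, x, x,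
         p] in
   (case commCells A P x p q u of (C1, C2, C3) \<Rightarrow>
    (let m0 = path_ap X (f q) S \<odot> T; m = C3 \<odot> m0; k' = C3 \<odot> SW;
         n = AssocWhisk \<triangleright> [X, srcX C3, tgtX C3, tgtX SW, u, tmX C3, tmX SW,
           tmX (path_ap X (f p) T \<odot> S), tmX m0,
               SwapNat \<triangleright> [A, P, x, p, q, g, h, u, k, s, e, t]] in
     ConjSnd \<triangleright> [X, f q', u, b, t, TrInv \<triangleright> [A, P, x, x, q] $ u, f p' $ srcX C3,
       tmX (path_ap X (f p') m \<odot> path_ap X (f p') (S\<inverse>) \<odot> (X, f p' $ (f p $ u), u, i $ u)),
       tmX (path_ap X (f p') k' \<odot> (X, f p' $ (f p $ b), b, i $ b)),
       ConjFst \<triangleright> [X, f p, f p', i, u, b, t, s, srcX C3, tmX m, tmX k', n],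
       srcX C2, tmX C2, srcX C1, tmX C1])))))"

section \<open>Transport in path families and centrality of loops\<close>

subsection \<open>Families of paths and the Eckmann-Hilton argument\<close>

definition "e_PathsTo = entryX Always (\<Delta> A\<in>univX. \<Delta> Y\<in>univX. \<Delta> F\<in>A \<rightarrow> Y. \<Delta> c\<in>Y.
  A \<rightarrow> univX \<ni> (\<Lambda> x\<in>A. F $ x \<simeq>[Y] c))"

definition "trPaths A Y F c x y p = trX A (PathsTo \<triangleright> [A, Y, F, c]) x y p"

text \<open>Transport in \<open>F x = c\<close> is left multiplication by a path that depends on
  neither c nor v.\<close>

definition "trPath_ty A Y F c x y p v =
  (trPaths A Y F c x y p $ v \<simeq>[F $ y \<simeq>[Y] c]
   tmX ((Y, F $ y, F $ x, trPaths A Y F (F $ x) x y p $ reflX Y (F $ x)) \<odot> (Y, F $ x, c, v)))"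

definition "e_TrPath = entryX Never
  (\<Delta> A\<in>univX. \<Delta> Y\<in>univX. \<Delta> F\<in>A \<rightarrow> Y. \<Delta> c\<in>Y. \<Delta> x y\<in>A. \<Delta> p\<in>x \<simeq>[A] y. \<Delta> v\<in>F $ x \<simeq>[Y] c.
   trPath_ty A Y F c x y p v \<ni>
   jX A (\<lambda>x y p. \<Pi> v\<in>F $ x \<simeq>[Y] c. trPath_ty A Y F c x y p v)
     (\<lambda>x. \<Lambda> v\<in>F $ x \<simeq>[Y] c. reflX (F $ x \<simeq>[Y] c) v) x y p $ v)"

definition "globalLoop Y = (\<Pi> y\<in>Y. y \<simeq>[Y] y)"

definition "loopNat_ty Y w x y v =
  ((Y, x, x, w $ x) \<odot> (Y, x, y, v) \<doteq> (Y, x, y, v) \<odot> (Y, y, y, w $ y))"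

definition "e_LoopNat = entryX Never (\<Delta> Y\<in>univX. \<Delta> w\<in>globalLoop Y. \<Delta> x y\<in>Y. \<Delta> v\<in>x \<simeq>[Y] y.
  loopNat_ty Y w x y v \<ni>
  jX Y (loopNat_ty Y w) (\<lambda>x. tmX ((rUnit (Y, x, x, w $ x))\<inverse>)) x y v)"

text \<open>Left multiplication by a loop at \<open>F x\<close> makes sense at x only. Where the
  loop belongs to a homotopy w, naturality turns it into right multiplication by \<open>w c\<close>,
  which is defined on all fibres \<open>F y = c\<close>.\<close>

definition "e_TrPathLoop = entryX Never
  (\<Delta> A\<in>univX. \<Delta> Y\<in>univX. \<Delta> F\<in>A \<rightarrow> Y. \<Delta> x\<in>A. \<Delta> p\<in>x \<simeq>[A] x. \<Delta> w\<in>globalLoop Y.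
   \<Delta> e\<in>trPaths A Y F (F $ x) x x p $ reflX Y (F $ x) \<simeq>[F $ x \<simeq>[Y] F $ x] w $ (F $ x).
   \<Delta> c\<in>Y. \<Delta> v\<in>F $ x \<simeq>[Y] c.
   (let y = F $ x; T = (Y, y, y, trPaths A Y F y x x p $ reflX Y y); W = (Y, y, y, w $ y); V = (Y, y,
     c, v) in
    path_body ((y \<simeq>[Y] c, trPaths A Y F c x x p $ v, tmX (T \<odot> V), TrPath \<triangleright> [A, Y, F, c, x, x, p, v])
      \<odot> whiskR T W e V \<odot> path2 (W \<odot> V) (V \<odot> (Y, c, c, w $ c)) (LoopNat \<triangleright> [Y, w, y, c, v]))))"

definition "loop2X Z x = (reflX Z x \<simeq>[x \<simeq>[Z] x] reflX Z x)"

text \<open>Whiskering of a loop on reflexivity with an arbitrary path. Defined by induction on that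
  path, it returns the loop itself judgmentally at reflexivity, and so \<open>EHBase\<close> holds
  by reflexivity.\<close>

definition "e_EH0 = entryX (At 3) (\<Delta> Z\<in>univX. \<Delta> x y\<in>Z. \<Delta> c\<in>x \<simeq>[Z] y.
  loop2X Z x \<rightarrow> (c \<simeq>[x \<simeq>[Z] y] c) \<ni>
  jX Z (\<lambda>x y c. loop2X Z x \<rightarrow> (c \<simeq>[x \<simeq>[Z] y] c)) (\<lambda>x. \<Lambda> a\<in>loop2X Z x. a) x y c)"

text \<open>A loop at one point of \<open>n = s\<close> extends to a homotopy from the identity of \<open>n = s\<close> to itself.\<close>

definition "e_EH = entryX (At 3) (\<Delta> Z\<in>univX. \<Delta> n s\<in>Z. \<Delta> y\<in>n \<simeq>[Z] s. \<Delta> a\<in>y \<simeq>[n \<simeq>[Z] s] y.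
  globalLoop (n \<simeq>[Z] s) \<ni>
  jX Z (\<lambda>n s y. (y \<simeq>[n \<simeq>[Z] s] y) \<rightarrow> globalLoop (n \<simeq>[Z] s))
    (\<lambda>x. \<Lambda> a\<in>loop2X Z x. \<Lambda> c\<in>x \<simeq>[Z] x. EH0 \<triangleright> [Z, x, x, c] $ a) n s y $ a)"

definition "ehBase_ty Z n s y a = (a \<simeq>[y \<simeq>[n \<simeq>[Z] s] y] EH \<triangleright> [Z, n, s, y, a] $ y)"

definition "e_EHBase = entryX Never (\<Delta> Z\<in>univX. \<Delta> n s\<in>Z. \<Delta> y\<in>n \<simeq>[Z] s. \<Delta> a\<in>y \<simeq>[n \<simeq>[Z] s] y.
  ehBase_ty Z n s y a \<ni>
  jX Z (\<lambda>n s y. \<Pi> a\<in>y \<simeq>[n \<simeq>[Z] s] y. ehBase_ty Z n s y a)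
    (\<lambda>x. \<Lambda> a\<in>loop2X Z x. reflX (loop2X Z x) a) n s y $ a)"

section \<open>Solving the cyclic system of equations for the 2-cells\<close>

subsection \<open>Sections over BH\<close>

abbreviation "BHx \<equiv> conX cBH"
abbreviation "ptx \<equiv> conX cPt"
abbreviation "loopx g \<equiv> conX (cLoop g)"
abbreviation "cellx g \<equiv> conX (cCell g)"

definition "loopsX = (ptx \<simeq>[BHx] ptx)"
definition "relX g = commX BHx ptx (loopx (prev g)) (loopx g)"
definition "overBH P u p = overX BHx P ptx u p"

text \<open>Separate from \<open>Tr\<close>, whose family is a term of the object theory: applied to
  an abstraction it would leave beta redexes, whereas \<open>overCell\<close> in the statement has
  none. The types of the constants are compared syntactically.\<close>

definition "e_TrOver = entryX (At 4)
  (\<Delta> P\<in>BHx \<rightarrow> univX. \<Delta> u\<in>P $ ptx. \<Delta> l r\<in>loopsX. \<Delta> c\<in>l \<simeq>[loopsX] r. \<Delta> t\<in>overBH P u l.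
   overBH P u r \<ni>
   jX loopsX (\<lambda>l r c. overBH P u l \<rightarrow> overBH P u r) (\<lambda>l. \<Lambda> t\<in>overBH P u l. t) l r c $ t)"

definition "trOverInv_ty P u l r c t =
  (TrOver \<triangleright> [P, u, l, r, c, TrOver \<triangleright> [P, u, r, l, Inv \<triangleright> [loopsX, l, r, c], t]] \<simeq>[overBH P u r] t)"

definition "e_TrOverInv = entryX Never
  (\<Delta> P\<in>BHx \<rightarrow> univX. \<Delta> u\<in>P $ ptx. \<Delta> l r\<in>loopsX. \<Delta> c\<in>l \<simeq>[loopsX] r. \<Delta> t\<in>overBH P u r.
   trOverInv_ty P u l r c t \<ni>
   jX loopsX (\<lambda>l r c. \<Pi> t\<in>overBH P u r. trOverInv_ty P u l r c t)
     (\<lambda>l. \<Lambda> t\<in>overBH P u l. reflX (overBH P u l) t) l r c $ t)"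

definition "overCellX P u g s t =
  (TrOver \<triangleright> [P, u, loopx g, relX g, cellx g, t] \<simeq>[overBH P u (relX g)]
   DComm \<triangleright> [BHx, P, ptx, loopx (prev g), loopx g, u, s, t])"

text \<open>
  A type \<open>C\<close> acts on the family \<open>P\<close> by \<open>act\<close>, with unit \<open>r\<close>; by \<open>li\<close>, an element whose action fixes \<open>u\<close>
  is the unit.  For \<open>P x = (F x = c)\<close> this will be the action of \<open>c = c\<close> by composition.
\<close>

definition "actX A P C = (C \<rightarrow> fibrewiseX A P)"

definition "actPath A P C act x v b d e = (P $ x, act $ b $ x $ v, act $ d $ x $ v, ActPath \<triangleright> [A, P,
  C, act, x, v, b, d, e])"

definition "e_ActPath = entryX (At 8)
  (\<Delta> A\<in>univX. \<Delta> P\<in>A \<rightarrow> univX. \<Delta> C\<in>univX. \<Delta> act\<in>actX A P C. \<Delta> x\<in>A. \<Delta> v\<in>P $ x. \<Delta> b d\<in>C. \<Delta> e\<in>b \<simeq>[C] d.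
   act $ b $ x $ v \<simeq>[P $ x] act $ d $ x $ v \<ni>
   jX C (\<lambda>b d e. act $ b $ x $ v \<simeq>[P $ x] act $ d $ x $ v) (\<lambda>b. reflX (P $ x) (act $ b $ x $ v)) b d e)"

definition "fixes_ty P x u act b = (act $ b $ x $ u \<simeq>[P $ x] u)"

text \<open>The trivialization obtained from s by \<open>li\<close> and the unit law gives back s at
  the base point. Without this coherence only the action would be known to be trivial, not that its
  trivialization extends s.\<close>

definition "actCoh_ty A P x u C r act un li b s =
  (tmX (actPath A P C act x u b r (li $ b $ s) \<odot> (P $ x, act $ r $ x $ u, u,
    un $ x $ u)) \<simeq>[fixes_ty P x u act b] s)"

definition "actTele A P x u F =
  (\<Delta> C\<in>univX. \<Delta> r\<in>C. \<Delta> act\<in>actX A P C. \<Delta> un\<in>fibrewiseId A P (act $ r).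
   \<Delta> li\<in>\<Pi> b\<in>C. fixes_ty P x u act b \<rightarrow> (b \<simeq>[C] r).
   \<Delta> co\<in>\<Pi> b\<in>C. \<Pi> s\<in>fixes_ty P x u act b. actCoh_ty A P x u C r act un li b s.
   F C r act un li co)"

definition "trivTele F =
  (\<Delta> A\<in>univX. \<Delta> P\<in>A \<rightarrow> univX. \<Delta> x\<in>A. \<Delta> u\<in>P $ x. actTele A P x u (\<lambda>C r act un li co.
   \<Delta> b\<in>C. \<Delta> a\<in>P $ x. \<Delta> h\<in>a \<simeq>[P $ x] act $ b $ x $ u. \<Delta> s\<in>a \<simeq>[P $ x] u. F A P x u C r act un li co b a h s))"

definition "trivPath P x u act b a h s = (P $ x, a, act $ b $ x $ u, h)\<inverse> \<odot> (P $ x, a, u, s)"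

text \<open>A path s over the loop shows that b fixes the base point; then b is the unit by
  \<open>li\<close>, so b acts trivially on every fibre.\<close>

definition "e_ActTrivial = entryX Always (trivTele (\<lambda>A P x u C r act un li co b a h s.
  fibrewiseId A P (act $ b) \<ni>
  (\<Lambda> y\<in>A. \<Lambda> v\<in>P $ y. tmX (actPath A P C act y v b r (li $ b $ tmX (trivPath P x u act b a h s))
     \<odot> (P $ y, act $ r $ y $ v, v, un $ y $ v)))))"

definition "e_ActTrivialBase = entryX Never (trivTele (\<lambda>A P x u C r act un li co b a h s.
  (let X = P $ x; H = (X, a, act $ b $ x $ u, h); S = (X, a, u, s); Q = trivPath P x u act b a h s;
       k = ActTrivial \<triangleright> [A, P, x, u, C, r, act, un, li, co, b, a, h, s] $ x $ u in
   (tmX (H \<odot> (X, act $ b $ x $ u, u, k)) \<simeq>[a \<simeq>[X] u] s) \<ni>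
   tmX (whiskL H (actPath A P C act x u b r (li $ b $ tmX Q) \<odot> (X, act $ r $ x $ u, u,
     un $ x $ u)) Q (co $ b $ tmX Q)
     \<odot> path2 (H \<odot> Q) S (CatInv \<triangleright> [X, a, act $ b $ x $ u, u, h, s])))))"

definition "relTele F = (\<Delta> p q\<in>loopsX. \<Delta> c\<in>q \<simeq>[loopsX] commX BHx ptx p q. F p q c)"

definition "windTele P C act F = (\<Delta> w\<in>loopsX \<rightarrow> C. \<Delta> h\<in>\<Pi> p\<in>loopsX. trHtpy BHx P ptx p (act $ (w $ p)). F w h)"

text \<open>
  The path over the loop \<open>q\<close> is \<open>CommFix\<close> moved back along the 2-cell \<open>c : q = [p, q]\<close>.  The equation for
  the 2-cell then says that the dependent commutator is \<open>CommFix\<close>.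
\<close>

definition "e_LoopOver = entryX Always (\<Delta> P\<in>BHx \<rightarrow> univX. \<Delta> u\<in>P $ ptx. \<Delta> C\<in>univX. \<Delta> act\<in>actX BHx P C.
  windTele P C act (\<lambda>w h. relTele (\<lambda>p q c.
  overBH P u q \<ni>
  TrOver \<triangleright> [P, u, commX BHx ptx p q, q, Inv \<triangleright> [loopsX, q, commX BHx ptx p q, c],
    tmX (commFix BHx P ptx p q (act $ (w $ p)) (h $ p) u)])))"

definition "sectionTele F = (\<Delta> P\<in>BHx \<rightarrow> univX. \<Delta> u\<in>P $ ptx. actTele BHx P ptx u (\<lambda>C r act un li co.
  windTele P C act (\<lambda>w h. F P u C r act un li co w h)))"

text \<open>Both sides equal \<open>CommFix\<close>: transport along the cell undoes the inverse
  transport in \<open>LoopOver\<close>, and \<open>DCommFix\<close> evaluates the commutator. As s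
  is arbitrary, the path chosen over the preceding generator may be inserted.\<close>

definition "e_CellOver = entryX Never (sectionTele (\<lambda>P u C r act un li co w h. relTele (\<lambda>p q c. \<Delta> s\<in>overBH P u p.
  (let rl = commX BHx ptx p q; V = overBH P u rl;
       g = act $ (w $ p); f = CommFix \<triangleright> [BHx, P, ptx, p, q, g, h $ p, u];
       t = LoopOver \<triangleright> [P, u, C, act, w, h, p, q, c];
       z = [BHx, P, ptx, u, C, r, act, un, li, co, w $ p, trX BHx P ptx ptx p $ u, h $ p $ u, s] in
   path_body ((V, TrOver \<triangleright> [P, u, q, rl, c, t], f, TrOverInv \<triangleright> [P, u, q, rl, c, f])
     \<odot> (V, DComm \<triangleright> [BHx, P, ptx, p, q, u, s, t], f,
        DCommFix \<triangleright> [BHx, P, ptx, p, q, g, h $ p, u, ActTrivial \<triangleright> z, s, ActTrivialBase \<triangleright> z, t])\<inverse>)))))"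

definition "e_BHSection = entryX Never (sectionTele (\<lambda>P u C r act un li co w h.
  (\<Pi> x\<in>BHx. P $ x) \<ni>
  (let s = (\<lambda>g. LoopOver \<triangleright> [P, u, C, act, w, h, loopx (prev g), loopx g, cellx g]);
       d = (\<lambda>g. CellOver \<triangleright> [P, u, C, r, act, un, li, co, w, h, loopx (prev g), loopx g, cellx g,
         s (prev g)]) in
   conX cIndBH $ P $ u $ s Ga $ s Gb $ s Gc $ s Gd $ d Ga $ d Gb $ d Gc $ d Gd)))"

section \<open>The action of loops on a family of paths\<close>

subsection \<open>Functions from BH to identity types are constant\<close>

definition "baseTele F = (\<Delta> A\<in>univX. \<Delta> Y\<in>univX. \<Delta> f\<in>A \<rightarrow> Y. \<Delta> x\<in>A. F A Y f x)"

definition "baseLoops Y f x = (f $ x \<simeq>[Y] f $ x)"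
definition "basePaths A Y f x = PathsTo \<triangleright> [A, Y, f, f $ x]"
definition "baseRefl Y f x = reflX Y (f $ x)"

definition "e_PAct = entryX Always (baseTele (\<lambda>A Y f x.
  actX A (basePaths A Y f x) (baseLoops Y f x) \<ni>
  (\<Lambda> b\<in>baseLoops Y f x. \<Lambda> y\<in>A. \<Lambda> v\<in>basePaths A Y f x $ y. Cat \<triangleright> [Y, f $ y, f $ x, f $ x, v, b])))"

definition "e_PUnit = entryX Always (baseTele (\<lambda>A Y f x.
  fibrewiseId A (basePaths A Y f x) (PAct \<triangleright> [A, Y, f, x] $ baseRefl Y f x) \<ni>
  (\<Lambda> y\<in>A. \<Lambda> v\<in>f $ y \<simeq>[Y] f $ x. tmX ((rUnit (Y, f $ y, f $ x, v))\<inverse>))))"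

definition "baseFixes A Y f x b = fixes_ty (basePaths A Y f x) x (baseRefl Y f x) (PAct \<triangleright> [A, Y, f,
  x]) b"

text \<open>Well typed because the action of \<open>b\<close> on the reflexivity path computes to \<open>b\<close>.\<close>

definition "e_PLift = entryX Always (baseTele (\<lambda>A Y f x.
  (\<Pi> b\<in>baseLoops Y f x. baseFixes A Y f x b \<rightarrow> (b \<simeq>[baseLoops Y f x] baseRefl Y f x)) \<ni>
  (\<Lambda> b\<in>baseLoops Y f x. \<Lambda> s\<in>b \<simeq>[baseLoops Y f x] baseRefl Y f x. s)))"

text \<open>The target d of s is free, where \<open>PCoh\<close> has reflexivity: path induction on
  s needs a variable endpoint.\<close>

definition "pCoh0_ty A Y f x b d s =
  (let X = baseLoops Y f x in
   Cat \<triangleright> [X, b, d, d, ActPath \<triangleright> [A, basePaths A Y f x, X, PAct \<triangleright> [A, Y, f, x], x, baseRefl Y f x, b,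
     d, s], reflX X d]
     \<simeq>[b \<simeq>[X] d] s)"

definition "e_PCoh0 = entryX Never (baseTele (\<lambda>A Y f x. \<Delta> b d\<in>baseLoops Y f x. \<Delta> s\<in>b \<simeq>[baseLoops Y f x] d.
  pCoh0_ty A Y f x b d s \<ni>
  jX (baseLoops Y f x) (pCoh0_ty A Y f x)
    (\<lambda>b. reflX (b \<simeq>[baseLoops Y f x] b) (reflX (baseLoops Y f x) b)) b d s))"

definition "e_PCoh = entryX Never (baseTele (\<lambda>A Y f x.
  (\<Pi> b\<in>baseLoops Y f x. \<Pi> s\<in>baseFixes A Y f x b.
     actCoh_ty A (basePaths A Y f x) x (baseRefl Y f x) (baseLoops Y f x) (baseRefl Y f x) (PAct \<triangleright> [A,
       Y, f, x])
       (PUnit \<triangleright> [A, Y, f, x]) (PLift \<triangleright> [A, Y, f, x]) b s) \<ni>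
  (\<Lambda> b\<in>baseLoops Y f x. \<Lambda> s\<in>b \<simeq>[baseLoops Y f x] baseRefl Y f x. PCoh0 \<triangleright> [A, Y, f, x, b,
    baseRefl Y f x, s])))"

definition "windX Y F p = trX BHx (PathsTo \<triangleright> [BHx, Y, F, F $ ptx]) ptx ptx p $ reflX Y (F $ ptx)"

definition "constTele F = (\<Delta> Y\<in>univX. \<Delta> f\<in>BHx \<rightarrow> Y. \<Delta> w\<in>loopsX \<rightarrow> globalLoop Y. F Y f w)"
text \<open>Isolates the property of the target type on which constancy rests: the path by which a
  loop p acts in the fibre over the base point extends to a homotopy on the whole type.
  \<open>EH\<close> and \<open>EHBase\<close> provide this when the target is an identity
  type.\<close>

definition "constTele' F = constTele (\<lambda>Y f w.
  \<Delta> W\<in>\<Pi> p\<in>loopsX. windX Y f p \<simeq>[baseLoops Y f ptx] w $ p $ (f $ ptx). F Y f w W)"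

definition "e_WBase = entryX Always (constTele (\<lambda>Y f w.
  loopsX \<rightarrow> baseLoops Y f ptx \<ni> (\<Lambda> p\<in>loopsX. w $ p $ (f $ ptx))))"

definition "e_PTr = entryX Never (constTele' (\<lambda>Y f w W.
  (\<Pi> p\<in>loopsX. trHtpy BHx (basePaths BHx Y f ptx) ptx p (PAct \<triangleright> [BHx, Y, f, ptx] $ (WBase \<triangleright> [Y, f,
    w] $ p))) \<ni>
  (\<Lambda> p\<in>loopsX. \<Lambda> v\<in>baseLoops Y f ptx.
     TrPathLoop \<triangleright> [BHx, Y, f, ptx, p, w $ p, W $ p, f $ ptx, v])))"

definition "e_BHConst0 = entryX Never (constTele' (\<lambda>Y f w W.
  (\<Pi> x\<in>BHx. basePaths BHx Y f ptx $ x) \<ni>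
  (let z = [BHx, Y, f, ptx] in
   BHSection \<triangleright> [basePaths BHx Y f ptx, baseRefl Y f ptx, baseLoops Y f ptx, baseRefl Y f ptx,
     PAct \<triangleright> z, PUnit \<triangleright> z, PLift \<triangleright> z, PCoh \<triangleright> z, WBase \<triangleright> [Y, f, w], PTr \<triangleright> [Y, f, w, W]])))"

definition "e_BHConst = entryX Never (\<Delta> Z\<in>univX. \<Delta> n s\<in>Z. \<Delta> f\<in>BHx \<rightarrow> (n \<simeq>[Z] s).
  (\<Pi> x\<in>BHx. PathsTo \<triangleright> [BHx, n \<simeq>[Z] s, f, f $ ptx] $ x) \<ni>
  BHConst0 \<triangleright> [n \<simeq>[Z] s, f,
    \<Lambda> p\<in>loopsX. EH \<triangleright> [Z, n, s, f $ ptx, windX (n \<simeq>[Z] s) f p],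
    \<Lambda> p\<in>loopsX. EHBase \<triangleright> [Z, n, s, f $ ptx, windX (n \<simeq>[Z] s) f p]])"

section \<open>From equality of the meridians to contractibility of the suspension\<close>

subsection \<open>The suspension of BH\<close>

definition "trPathRight_ty Z n x y g r =
  (trX Z (\<Lambda> y\<in>Z. n \<simeq>[Z] y) x y g $ r \<simeq>[n \<simeq>[Z] y] Cat \<triangleright> [Z, n, x, y, r, g])"

definition "e_TrPathRight = entryX Never (\<Delta> Z\<in>univX. \<Delta> n x y\<in>Z. \<Delta> g\<in>x \<simeq>[Z] y. \<Delta> r\<in>n \<simeq>[Z] x.
  trPathRight_ty Z n x y g r \<ni>
  jX Z (\<lambda>x y g. \<Pi> r\<in>n \<simeq>[Z] x. trPathRight_ty Z n x y g r) (\<lambda>x. \<Lambda> r\<in>n \<simeq>[Z] x. RUnit \<triangleright> [Z, n, x,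
    r]) x y g $ r)"

definition "e_TrReflRight = entryX Never (\<Delta> Z\<in>univX. \<Delta> n s\<in>Z. \<Delta> g\<in>n \<simeq>[Z] s.
  trX Z (\<Lambda> y\<in>Z. n \<simeq>[Z] y) n s g $ reflX Z n \<simeq>[n \<simeq>[Z] s] g \<ni> TrPathRight \<triangleright> [Z, n, n, s, g, reflX Z n])"

abbreviation "starx \<equiv> conX cStar"
abbreviation "unitx \<equiv> conX cUnit"

definition "suspCon c = conX c $ unitx $ unitx $ BHx $ (\<Lambda> x\<in>BHx. starx) $ (\<Lambda> x\<in>BHx. starx)"

abbreviation "suspx \<equiv> Susp \<triangleright> []"
abbreviation "northx \<equiv> North \<triangleright> []"
abbreviation "southx \<equiv> South \<triangleright> []"
abbreviation "meridx \<equiv> Merid \<triangleright> []"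
abbreviation "pathsFrom \<equiv> PathsFrom \<triangleright> []"

definition "e_Susp = entryX Always (univX \<ni> suspCon cPushout)"
definition "e_North = entryX Always (suspx \<ni> suspCon cPInl $ starx)"
definition "e_South = entryX Always (suspx \<ni> suspCon cPInr $ starx)"
definition "e_Merid = entryX Always (BHx \<rightarrow> (northx \<simeq>[suspx] southx) \<ni> (\<Lambda> x\<in>BHx. suspCon cGlue $ x))"
definition "e_PathsFrom = entryX Always (suspx \<rightarrow> univX \<ni> (\<Lambda> y\<in>suspx. northx \<simeq>[suspx] y))"

definition "e_AtInl = entryX Always ((\<Pi> a\<in>unitx. pathsFrom $ (suspCon cPInl $ a)) \<ni>
  conX cIndUnit $ (\<Lambda> a\<in>unitx. northx \<simeq>[suspx] suspCon cPInl $ a) $ reflX suspx northx)"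

definition "e_AtInr = entryX Always ((\<Pi> a\<in>unitx. pathsFrom $ (suspCon cPInr $ a)) \<ni>
  conX cIndUnit $ (\<Lambda> a\<in>unitx. northx \<simeq>[suspx] suspCon cPInr $ a) $ (meridx $ ptx))"

text \<open>Transporting reflexivity along the meridian of c gives that meridian, whereas
  \<open>AtInr\<close> chose the one of the base point. Constancy of the meridian map identifies the
  two.\<close>

definition "e_AtGlue = entryX Never
  ((\<Pi> c\<in>BHx. trX suspx pathsFrom northx southx (meridx $ c) $ reflX suspx northx \<simeq>[northx \<simeq>[suspx] southx] meridx $ ptx) \<ni>
   (\<Lambda> c\<in>BHx.
     tmX ((northx \<simeq>[suspx] southx,
       trX suspx pathsFrom northx southx (meridx $ c) $ reflX suspx northx, meridx $ c,
           TrReflRight \<triangleright> [suspx, northx, southx, meridx $ c])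
       \<odot> (northx \<simeq>[suspx] southx, meridx $ c, meridx $ ptx, BHConst \<triangleright> [suspx, northx, southx,
         meridx] $ c))))"

definition "e_BHAcyclic = entryX Never
  (conX cSigma $ suspx $ (\<Lambda> x\<in>suspx. \<Pi> y\<in>suspx. x \<simeq>[suspx] y) \<ni>
   conX cPair $ suspx $ (\<Lambda> x\<in>suspx. \<Pi> y\<in>suspx. x \<simeq>[suspx] y) $ northx
     $ (suspCon cIndPushout $ pathsFrom $ AtInl \<triangleright> [] $ AtInr \<triangleright> [] $ AtGlue \<triangleright> []))"

subsection \<open>Types of the constants\<close>

definition "k_IndUnit = (\<Pi> P\<in>unitx \<rightarrow> univX. P $ starx \<rightarrow> (\<Pi> x\<in>unitx. P $ x)) 0"

definition "k_Pair = (\<Pi> A\<in>univX. \<Pi> B\<in>A \<rightarrow> univX. \<Pi> a\<in>A. B $ a \<rightarrow> conX cSigma $ A $ B) 0"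

definition "piSpanX F = (\<Pi> A B C\<in>univX. \<Pi> f\<in>C \<rightarrow> A. \<Pi> g\<in>C \<rightarrow> B. F A B C f g)"
definition "conSpan c A B C f g = conX c $ A $ B $ C $ f $ g"

definition "k_Pushout = piSpanX (\<lambda>A B C f g. univX) 0"
definition "k_PInl = piSpanX (\<lambda>A B C f g. A \<rightarrow> conSpan cPushout A B C f g) 0"
definition "k_PInr = piSpanX (\<lambda>A B C f g. B \<rightarrow> conSpan cPushout A B C f g) 0"
definition "k_Glue = piSpanX (\<lambda>A B C f g. \<Pi> c\<in>C.
  conSpan cPInl A B C f g $ (f $ c) \<simeq>[conSpan cPushout A B C f g] conSpan cPInr A B C f g $ (g $ c)) 0"
definition "k_IndPushout = piSpanX (\<lambda>A B C f g.
  (let S = conSpan cPushout A B C f g; l' = conSpan cPInl A B C f g; r' = conSpan cPInr A B C f g in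
   \<Pi> P\<in>S \<rightarrow> univX. \<Pi> l\<in>(\<Pi> a\<in>A. P $ (l' $ a)). \<Pi> r\<in>(\<Pi> b\<in>B. P $ (r' $ b)).
   \<Pi> k\<in>(\<Pi> c\<in>C. trX S P (l' $ (f $ c)) (r' $ (g $ c)) (conSpan cGlue A B C f g $ c) $ (l $ (f $ c))
           \<simeq>[P $ (r' $ (g $ c))] r $ (g $ c)).
   \<Pi> x\<in>S. P $ x)) 0"

definition "k_Cell g = (loopx g \<simeq>[loopsX] relX g) 0"
definition "k_IndBH = (\<Pi> P\<in>BHx \<rightarrow> univX. \<Pi> u\<in>P $ ptx.
  \<Pi> sa\<in>overBH P u (loopx Ga). \<Pi> sb\<in>overBH P u (loopx Gb).
  \<Pi> sc\<in>overBH P u (loopx Gc). \<Pi> sd\<in>overBH P u (loopx Gd).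
  \<Pi> ra\<in>overCellX P u Ga sd sa. \<Pi> rb\<in>overCellX P u Gb sa sb.
  \<Pi> rc\<in>overCellX P u Gc sb sc. \<Pi> rd\<in>overCellX P u Gd sc sd.
  \<Pi> x\<in>BHx. P $ x) 0"

declare
  trCat_ty_def trInv_ty_def trAp_def dcatX_def dinvX_def commX_def overX_def whiskL_ty_def
  whiskR_ty_def ap2_ty_def rUnit_ty_def assoc_ty_def apId_ty_def apCat_ty_def apCancel_ty_def
  apCatCancel_ty_def catInv_ty_def retractConj_ty_def retractConj_refl_def retractionX_def
  invCat_ty_def catInvCat_ty_def catCatInvCat_ty_def homotopyX_def htpyConj_ty_def fibrewiseX_def
  fibrewiseId_def trNat_ty_def trNatId_ty_def swapX_def swapNat_ty_def trHtpy_def commTele_def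
  dcommTele_def commCells_def trSwap_def commFix_def trPaths_def trPath_ty_def globalLoop_def
  loopNat_ty_def loop2X_def ehBase_ty_def loopsX_def relX_def overBH_def trOverInv_ty_def
  overCellX_def actX_def actPath_def fixes_ty_def actCoh_ty_def actTele_def trivTele_def
  trivPath_def relTele_def windTele_def sectionTele_def baseTele_def baseLoops_def basePaths_def
  baseRefl_def baseFixes_def pCoh0_ty_def windX_def constTele_def constTele'_def trPathRight_ty_def
  suspCon_def piSpanX_def conSpan_def Let_def [simp]

text \<open>The definitions above are brought to de Bruijn form once, not at each use by the checker.\<close>

lemmas e_code [simplified, code] =
  e_Cat_def e_Inv_def e_Ap_def e_Tr_def e_TrCat_def e_TrInv_def e_DComm_def e_WhiskL_def
  e_WhiskR_def e_Ap2_def e_RUnit_def e_Assoc_def e_ApId_def e_ApCat_def e_ApCancel_def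
  e_ApCatCancel_def e_CatInv_def e_RetractConj_def e_ConjFst_def e_ConjSnd_def e_InvCat_def
  e_CatInvCat_def e_CatCatInvCat_def e_HtpyConj_def e_TrNat_def e_TrNatId_def e_SwapNat0_def
  e_SwapNatEq_def e_SwapNat_def e_CommFix_def e_AssocWhisk_def e_DCommFix_def e_PathsTo_def
  e_TrPath_def e_LoopNat_def e_TrPathLoop_def e_EH0_def e_EH_def e_EHBase_def e_TrOver_def
  e_TrOverInv_def e_ActPath_def e_ActTrivial_def e_ActTrivialBase_def e_LoopOver_def e_CellOver_def
  e_BHSection_def e_PAct_def e_PUnit_def e_PLift_def e_PCoh0_def e_PCoh_def e_WBase_def e_PTr_def
  e_BHConst0_def e_BHConst_def e_TrPathRight_def e_TrReflRight_def e_Susp_def e_North_def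
  e_South_def e_Merid_def e_PathsFrom_def e_AtInl_def e_AtInr_def e_AtGlue_def e_BHAcyclic_def

lemmas k_code [simplified, code] =
  k_IndUnit_def k_Pair_def k_Pushout_def k_PInl_def k_PInr_def k_Glue_def k_IndPushout_def
  k_Cell_def k_IndBH_def

primrec dev :: "mac \<Rightarrow> mac entry" where
  "dev Cat = e_Cat" | "dev Inv = e_Inv" | "dev Ap = e_Ap" | "dev Tr = e_Tr" | "dev TrCat = e_TrCat"
| "dev TrInv = e_TrInv" | "dev DComm = e_DComm" | "dev WhiskL = e_WhiskL"
| "dev WhiskR = e_WhiskR" | "dev Ap2 = e_Ap2" | "dev RUnit = e_RUnit" | "dev Assoc = e_Assoc"
| "dev ApId = e_ApId" | "dev ApCat = e_ApCat" | "dev ApCancel = e_ApCancel"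
| "dev ApCatCancel = e_ApCatCancel" | "dev CatInv = e_CatInv" | "dev RetractConj = e_RetractConj"
| "dev ConjFst = e_ConjFst" | "dev ConjSnd = e_ConjSnd" | "dev InvCat = e_InvCat"
| "dev CatInvCat = e_CatInvCat" | "dev CatCatInvCat = e_CatCatInvCat"
| "dev HtpyConj = e_HtpyConj" | "dev TrNat = e_TrNat" | "dev TrNatId = e_TrNatId"
| "dev SwapNat0 = e_SwapNat0" | "dev SwapNatEq = e_SwapNatEq" | "dev SwapNat = e_SwapNat"
| "dev CommFix = e_CommFix" | "dev AssocWhisk = e_AssocWhisk" | "dev DCommFix = e_DCommFix"
| "dev PathsTo = e_PathsTo" | "dev TrPath = e_TrPath" | "dev LoopNat = e_LoopNat"
| "dev TrPathLoop = e_TrPathLoop" | "dev EH0 = e_EH0" | "dev EH = e_EH" | "dev EHBase = e_EHBase"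
| "dev TrOver = e_TrOver" | "dev TrOverInv = e_TrOverInv" | "dev ActPath = e_ActPath"
| "dev ActTrivial = e_ActTrivial" | "dev ActTrivialBase = e_ActTrivialBase"
| "dev LoopOver = e_LoopOver" | "dev CellOver = e_CellOver" | "dev BHSection = e_BHSection"
| "dev PAct = e_PAct" | "dev PUnit = e_PUnit" | "dev PLift = e_PLift" | "dev PCoh0 = e_PCoh0"
| "dev PCoh = e_PCoh" | "dev WBase = e_WBase" | "dev PTr = e_PTr" | "dev BHConst0 = e_BHConst0"
| "dev BHConst = e_BHConst" | "dev TrPathRight = e_TrPathRight"
| "dev TrReflRight = e_TrReflRight" | "dev Susp = e_Susp" | "dev North = e_North"
| "dev South = e_South" | "dev Merid = e_Merid" | "dev PathsFrom = e_PathsFrom"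
| "dev AtInl = e_AtInl" | "dev AtInr = e_AtInr" | "dev AtGlue = e_AtGlue"
| "dev BHAcyclic = e_BHAcyclic"

primrec rank :: "mac \<Rightarrow> nat" where
  "rank Cat = 0" | "rank Inv = 1" | "rank Ap = 2" | "rank Tr = 3" | "rank TrCat = 4"
| "rank TrInv = 5" | "rank DComm = 6" | "rank WhiskL = 7" | "rank WhiskR = 8" | "rank Ap2 = 9"
| "rank RUnit = 10" | "rank Assoc = 11" | "rank ApId = 12" | "rank ApCat = 13"
| "rank ApCancel = 14" | "rank ApCatCancel = 15" | "rank CatInv = 16" | "rank RetractConj = 17"
| "rank ConjFst = 18" | "rank ConjSnd = 19" | "rank InvCat = 20" | "rank CatInvCat = 21"
| "rank CatCatInvCat = 22" | "rank HtpyConj = 23" | "rank TrNat = 24" | "rank TrNatId = 25"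
| "rank SwapNat0 = 26" | "rank SwapNatEq = 27" | "rank SwapNat = 28" | "rank CommFix = 29"
| "rank AssocWhisk = 30" | "rank DCommFix = 31" | "rank PathsTo = 32" | "rank TrPath = 33"
| "rank LoopNat = 34" | "rank TrPathLoop = 35" | "rank EH0 = 36" | "rank EH = 37"
| "rank EHBase = 38" | "rank TrOver = 39" | "rank TrOverInv = 40" | "rank ActPath = 41"
| "rank ActTrivial = 42" | "rank ActTrivialBase = 43" | "rank LoopOver = 44"
| "rank CellOver = 45" | "rank BHSection = 46" | "rank PAct = 47" | "rank PUnit = 48"
| "rank PLift = 49" | "rank PCoh0 = 50" | "rank PCoh = 51" | "rank WBase = 52" | "rank PTr = 53"
| "rank BHConst0 = 54" | "rank BHConst = 55" | "rank TrPathRight = 56" | "rank TrReflRight = 57"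
| "rank Susp = 58" | "rank North = 59" | "rank South = 60" | "rank Merid = 61"
| "rank PathsFrom = 62" | "rank AtInl = 63" | "rank AtInr = 64" | "rank AtGlue = 65"
| "rank BHAcyclic = 66"

text \<open>The instances of the types of the constants at level 0 are all that is needed.\<close>

definition kty :: "const \<Rightarrow> mac xtm option" where
  "kty c = (case c of cUnit \<Rightarrow> Some (XU 0) | cStar \<Rightarrow> Some (XK cUnit) | cIndUnit \<Rightarrow> Some k_IndUnit
     | cSigma \<Rightarrow> Some ((\<Pi> A\<in>univX. (A \<rightarrow> univX) \<rightarrow> univX) 0) | cPair \<Rightarrow> Some k_Pair
     | cPushout \<Rightarrow> Some k_Pushout | cPInl \<Rightarrow> Some k_PInl | cPInr \<Rightarrow> Some k_PInr | cGlue \<Rightarrow> Some k_Glue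
     | cIndPushout \<Rightarrow> Some k_IndPushout
     | cBH \<Rightarrow> Some (XU 0) | cPt \<Rightarrow> Some (XK cBH) | cLoop g \<Rightarrow> Some (loopsX 0) | cCell g \<Rightarrow> Some (k_Cell g)
     | cIndBH \<Rightarrow> Some k_IndBH | _ \<Rightarrow> None)"

section \<open>Evaluation of the checker and comparison with the statement\<close>

section \<open>The checks\<close>

definition below :: "nat \<Rightarrow> mac \<Rightarrow> bool" where
  "below n m \<longleftrightarrow> rank m < n"

text \<open>Makes every definition expandable, so that types can be reduced to definition-free terms
  and compared with those of the statement syntactically.\<close>

definition unfolded :: "mac \<Rightarrow> mac entry" where
  "unfolded m = Entry (tele (dev m)) (mty (dev m)) (body (dev m)) Always"

text \<open>8 exceeds the nesting depth of the definitions in the types of the constants.\<close>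

definition denotes :: "mac xtm \<Rightarrow> tm \<Rightarrow> bool" where
  "denotes t u \<longleftrightarrow> (let t' = (expand unfolded ^^ 8) t in wsc (\<lambda>_. False) 0 t' \<and> den (\<lambda>_. Univ 0) t' = u)"

lemma body_below: "wsc (below (rank m)) (length (tele (dev m))) (body (dev m))"
  by (cases m; hypsubst; code_simp)

interpretation bh: development dev kty rank
  by unfold_locales (use body_below in \<open>simp add: below_def[abs_def]\<close>)

lemma denotes_den: "denotes t u \<Longrightarrow> den bh.D t = u"
  using bh.den_expanded[of unfolded 0 8 t] by (simp add: denotes_def unfolded_def Let_def)

text \<open>Ties the types that the checker assumes for constants to those of the type theory, by
  computing both as raw terms.\<close>

lemma kty_denotes: "case kty c of None \<Rightarrow> True | Some T \<Rightarrow> denotes T (cty 0 0 c 0)"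
proof (cases c)
  case (cLoop g) then show ?thesis by (cases g; hypsubst; code_simp)
next
  case (cCell g) then show ?thesis by (cases g; hypsubst; code_simp)
qed (hypsubst; code_simp)+

lemma entry_check: "check dev kty (below (rank m)) m"
  by (cases m; hypsubst; code_simp)

lemma BHAcyclic_tele: "tele (dev BHAcyclic) = []"
  by code_simp

lemma BHAcyclic_denotes: "denotes (mty (dev BHAcyclic)) (acyclic BH 0)"
  by code_simp

theorem proposition7p5:
  shows "inhabited (acyclic BH)"
proof -
  have "den bh.D T = cty 0 0 c 0" if "kty c = Some T" for c T
    using kty_denotes[of c] that by (simp add: denotes_den)
  moreover have "check dev kty (\<lambda>m'. rank m' < rank m) m" for m
    using entry_check[of m] by (simp add: below_def[abs_def])
  \<comment> \<open>The telescope of \<open>BHAcyclic\<close> is empty, so this typing is closed;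
    its type is compared with \<open>acyclic BH 0\<close> by evaluation.\<close>
  ultimately have "rev (map (den bh.D) (tele (dev BHAcyclic)))
      \<turnstile> bh.D BHAcyclic \<^bold>: den bh.D (mty (dev BHAcyclic))"
    by (rule bh.typed)
  then have "[] \<turnstile> bh.D BHAcyclic \<^bold>: acyclic BH 0"
    by (simp only: BHAcyclic_tele denotes_den[OF BHAcyclic_denotes] list.map rev.simps)
  then show ?thesis unfolding inhabited_def ..
qed

end
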